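(* Let $M$ be an uncountable compact metric space. Then the Polish group $C(M,U(1))$ admits a Boolean action on a separable atomless probability algebra which is whirly.
   Context: $U(1)$ is the circle group $\{z\in\mathbb{C}:|z|=1\}$. $C(M,U(1))$ is the group of all continuous functions from $M$ to $U(1)$ with pointwise multiplication and the topology of uniform convergence. For a standard Borel space $X$ (one whose Borel sets arise from a Polish topology) with a Borel probability measure $\mu$, $\mathcal{B}_\mu$ denotes the quotient of the Borel subsets of $X$ modulo the $\mu$-null sets, equipped with $\mu$ and with the metric $d_\mu(A,B)=\mu(A\triangle B)$; these are the separable probability algebras considered (atomless when $\mu$ is atomless). $\operatorname{Aut}(\mathcal{B}_\mu,\mu)$ is the group of measure preserving automorphisms of the Boolean algebra $\mathcal{B}_\mu$, with the topology of pointwise convergence with respect to $d_\mu$ (the coarsest topology making all the maps $T\mapsto T(A)$, $A\in\mathcal{B}_\mu$, continuous). A Boolean action of a Polish group $G$ on $\mathcal{B}_\mu$ is an action of $G$ on $\mathcal{B}_\mu$ induced by a continuous homomorphism from $G$ into $\operatorname{Aut}(\mathcal{B}_\mu,\mu)$. A Boolean action of a Polish group $G$ on $\mathcal{B}_\mu$ is whirly if whenever $V$ is a neighborhood of $1_G$ and $A,B\in\mathcal{B}_\mu$ have positive measure, there is $g\in V$ such that $\mu((g\cdot A)\cap B)>0$. *)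

theory Defs
  imports "HOL-Probability.Probability" "HOL-Algebra.Bij"
begin

section \<open>Polish groups and the group of circle-valued continuous maps\<close>

definition polish_space_on :: "'a topology \<Rightarrow> bool" where
  "polish_space_on T \<longleftrightarrow> completely_metrizable_space T \<and> separable_space T"

definition polish_group :: "('g, 'm) monoid_scheme \<Rightarrow> 'g topology \<Rightarrow> bool" where
  "polish_group G T \<longleftrightarrow>
     group G \<and> topspace T = carrier G \<and>
     continuous_map (prod_topology T T) T (\<lambda>(g, h). g \<otimes>\<^bsub>G\<^esub> h) \<and>
     continuous_map T T (\<lambda>g. inv\<^bsub>G\<^esub> g) \<and>
     polish_space_on T"

definition circle_metric :: "complex metric" where
  "circle_metric = submetric euclidean_metric (sphere 0 1)"

text \<open>The elements are extensional functions (equal to undefined off the space \<^term>\<open>X\<close>).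
  The library's \<^const>\<open>cfunspace\<close> carries the supremum metric; its boundedness requirement
  is vacuous here because the circle is bounded.\<close>

definition circle_maps :: "'a topology \<Rightarrow> ('a \<Rightarrow> complex) monoid" where
  "circle_maps X =
     \<lparr>carrier = mspace (cfunspace X circle_metric),
      mult = (\<lambda>f g. \<lambda>x\<in>topspace X. f x * g x),
      one = (\<lambda>x\<in>topspace X. 1)\<rparr>"

definition uniform_topology :: "'a topology \<Rightarrow> ('a \<Rightarrow> complex) topology" where
  "uniform_topology X = mtopology_of (cfunspace X circle_metric)"

lemma carrier_circle_maps:
  "carrier (circle_maps X) =
     {f \<in> extensional (topspace X). f ` topspace X \<subseteq> sphere 0 1 \<and> continuous_map X euclidean f}"
proof -
  interpret C: Metric_space "sphere (0::complex) 1" dist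
    by unfold_locales (auto simp: dist_commute dist_triangle)
  have m: "mspace circle_metric = sphere 0 1" "mdist circle_metric = dist"
    by (simp_all add: circle_metric_def)
  have "C.mbounded S" if "S \<subseteq> sphere 0 1" for S
  proof -
    have "dist (1::complex) y \<le> 2" if "y \<in> sphere 0 1" for y
      using that norm_triangle_ineq4[of 1 y] by (simp add: dist_norm)
    then have "S \<subseteq> C.mcball 1 2"
      using that by (auto simp: C.in_mcball)
    then show ?thesis unfolding C.mbounded_def by blast
  qed
  then show ?thesis
    by (auto simp: circle_maps_def m circle_metric_def mtopology_of_submetric
          continuous_map_in_subtopology image_subset_iff_funcset)
qed


section \<open>Standard Borel probability spaces and their measure algebras\<close>

definition standard_borel :: "'b measure \<Rightarrow> bool" where
  "standard_borel N \<longleftrightarrow>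
     (\<exists>T. polish_space_on T \<and> topspace T = space N \<and>
          sets N = sigma_sets (topspace T) {U. openin T U})"

definition atomless :: "'b measure \<Rightarrow> bool" where
  "atomless N \<longleftrightarrow>
     (\<forall>A\<in>sets N. measure N A > 0 \<longrightarrow>
        (\<exists>B\<in>sets N. B \<subseteq> A \<and> 0 < measure N B \<and> measure N B < measure N A))"

definition null_equiv :: "'b measure \<Rightarrow> ('b set \<times> 'b set) set" where
  "null_equiv N = {(A, B). A \<in> sets N \<and> B \<in> sets N \<and> sym_diff A B \<in> null_sets N}"

definition malg :: "'b measure \<Rightarrow> 'b set set set" where
  "malg N = sets N // null_equiv N"

definition malg_class :: "'b measure \<Rightarrow> 'b set \<Rightarrow> 'b set set" where
  "malg_class N A = null_equiv N `` {A}"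

text \<open>Set operations, and the measure, descend to classes; the lemmas below show that the
  values do not depend on the representatives.\<close>

definition malg_lift2 ::
  "'b measure \<Rightarrow> ('b set \<Rightarrow> 'b set \<Rightarrow> 'b set) \<Rightarrow> 'b set set \<Rightarrow> 'b set set \<Rightarrow> 'b set set" where
  "malg_lift2 N f a b = (\<Union>A\<in>a. \<Union>B\<in>b. malg_class N (f A B))"

definition malg_inf :: "'b measure \<Rightarrow> 'b set set \<Rightarrow> 'b set set \<Rightarrow> 'b set set" where
  "malg_inf N = malg_lift2 N (\<lambda>A B. A \<inter> B)"

definition malg_sup :: "'b measure \<Rightarrow> 'b set set \<Rightarrow> 'b set set \<Rightarrow> 'b set set" where
  "malg_sup N = malg_lift2 N (\<lambda>A B. A \<union> B)"

definition malg_symdiff :: "'b measure \<Rightarrow> 'b set set \<Rightarrow> 'b set set \<Rightarrow> 'b set set" where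
  "malg_symdiff N = malg_lift2 N (\<lambda>A B. sym_diff A B)"

definition malg_compl :: "'b measure \<Rightarrow> 'b set set \<Rightarrow> 'b set set" where
  "malg_compl N a = (\<Union>A\<in>a. malg_class N (space N - A))"

definition malg_measure :: "'b measure \<Rightarrow> 'b set set \<Rightarrow> real" where
  "malg_measure N a = measure N (SOME A. A \<in> a)"

definition malg_dist :: "'b measure \<Rightarrow> 'b set set \<Rightarrow> 'b set set \<Rightarrow> real" where
  "malg_dist N a b = malg_measure N (malg_symdiff N a b)"

definition malg_metric :: "'b measure \<Rightarrow> 'b set set metric" where
  "malg_metric N = metric (malg N, malg_dist N)"

lemma equiv_null_equiv: "equiv (sets N) (null_equiv N)"
proof (rule equivI)
  show "null_equiv N \<subseteq> sets N \<times> sets N" by (auto simp: null_equiv_def)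
  show "refl_on (sets N) (null_equiv N)" by (auto simp: null_equiv_def refl_on_def)
  show "sym (null_equiv N)" by (auto simp: null_equiv_def sym_def Un_commute)
  show "trans (null_equiv N)"
  proof (rule transI)
    fix A B C assume AB: "(A, B) \<in> null_equiv N" and BC: "(B, C) \<in> null_equiv N"
    then have "sym_diff A B \<union> sym_diff B C \<in> null_sets N"
      by (auto simp: null_equiv_def intro!: null_sets.Un)
    then have "sym_diff A C \<in> null_sets N"
      using AB BC by (elim null_sets_subset) (auto simp: null_equiv_def)
    then show "(A, C) \<in> null_equiv N" using AB BC by (auto simp: null_equiv_def)
  qed
qed

lemma malgE:
  assumes "a \<in> malg N"
  obtains A where "A \<in> sets N" "a = malg_class N A"
  using assms by (auto simp: malg_def malg_class_def elim: quotientE)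

lemma malg_class_in_malg: "A \<in> sets N \<Longrightarrow> malg_class N A \<in> malg N"
  by (auto simp: malg_def malg_class_def intro: quotientI)

lemma malg_class_eq_iff:
  "A \<in> sets N \<Longrightarrow> B \<in> sets N \<Longrightarrow>
     malg_class N A = malg_class N B \<longleftrightarrow> sym_diff A B \<in> null_sets N"
  unfolding malg_class_def by (subst eq_equiv_class_iff[OF equiv_null_equiv]) (auto simp: null_equiv_def)

lemma malg_class_self: "A \<in> sets N \<Longrightarrow> A \<in> malg_class N A"
  unfolding malg_class_def by (rule equiv_class_self[OF equiv_null_equiv])

lemma malg_class_memD:
  assumes "B \<in> malg_class N A"
  shows "A \<in> sets N" "B \<in> sets N" "sym_diff A B \<in> null_sets N"
  using assms by (auto simp: malg_class_def null_equiv_def)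

lemma UN_eq_const: "S \<noteq> {} \<Longrightarrow> (\<And>x. x \<in> S \<Longrightarrow> g x = K) \<Longrightarrow> (\<Union>x\<in>S. g x) = K"
  by auto

lemma malg_lift2_class:
  assumes A: "A \<in> sets N" and B: "B \<in> sets N"
    and f: "\<And>A B. A \<in> sets N \<Longrightarrow> B \<in> sets N \<Longrightarrow> f A B \<in> sets N"
    and sub: "\<And>A B A' B'. sym_diff (f A B) (f A' B') \<subseteq> sym_diff A A' \<union> sym_diff B B'"
  shows "malg_lift2 N f (malg_class N A) (malg_class N B) = malg_class N (f A B)"
proof -
  have "malg_class N (f A' B') = malg_class N (f A B)"
    if "A' \<in> malg_class N A" "B' \<in> malg_class N B" for A' B'
  proof -
    note AA = malg_class_memD[OF that(1)] and BB = malg_class_memD[OF that(2)]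
    have "sym_diff A A' \<union> sym_diff B B' \<in> null_sets N"
      using AA(3) BB(3) by (rule null_sets.Un)
    then have "sym_diff (f A B) (f A' B') \<in> null_sets N"
      by (rule null_sets_subset) (use AA BB f sub in auto)
    then show ?thesis
      using malg_class_eq_iff[OF f[OF A B] f[OF AA(2) BB(2)]] by simp
  qed
  then show ?thesis
    unfolding malg_lift2_def
    by (intro UN_eq_const) (use malg_class_self[OF A] malg_class_self[OF B] in blast)+
qed

lemma
  assumes "A \<in> sets N" "B \<in> sets N"
  shows malg_inf_class: "malg_inf N (malg_class N A) (malg_class N B) = malg_class N (A \<inter> B)"
    and malg_sup_class: "malg_sup N (malg_class N A) (malg_class N B) = malg_class N (A \<union> B)"
    and malg_symdiff_class:
      "malg_symdiff N (malg_class N A) (malg_class N B) = malg_class N (sym_diff A B)"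
  unfolding malg_inf_def malg_sup_def malg_symdiff_def
  by (rule malg_lift2_class; use assms in auto)+

lemma malg_compl_class:
  assumes "A \<in> sets N"
  shows "malg_compl N (malg_class N A) = malg_class N (space N - A)"
proof -
  have "malg_class N (space N - A') = malg_class N (space N - A)" if "A' \<in> malg_class N A" for A'
  proof -
    note AA = malg_class_memD[OF that]
    have "sym_diff (space N - A) (space N - A') \<in> null_sets N"
      by (rule null_sets_subset[OF AA(3)]) (use AA in auto)
    then show ?thesis using malg_class_eq_iff[of "space N - A" N "space N - A'"] AA by auto
  qed
  then show ?thesis
    unfolding malg_compl_def
    by (intro UN_eq_const) (use malg_class_self[OF assms] in blast)+
qed

lemma malg_measure_class:
  assumes "A \<in> sets N"
  shows "malg_measure N (malg_class N A) = measure N A"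
proof -
  have "measure N B = measure N A" if "B \<in> malg_class N A" for B
  proof -
    note AB = malg_class_memD[OF that]
    have "A - B \<in> null_sets N" "B - A \<in> null_sets N"
      by (rule null_sets_subset[OF AB(3)]; use AB in auto)+
    then have "AE x in N. x \<notin> A - B" "AE x in N. x \<notin> B - A"
      by (blast intro: AE_not_in)+
    then have "AE x in N. x \<in> A \<longleftrightarrow> x \<in> B" by eventually_elim auto
    then show ?thesis
      unfolding measure_def using AB by (metis emeasure_eq_AE)
  qed
  moreover have "(SOME B. B \<in> malg_class N A) \<in> malg_class N A"
    using malg_class_self[OF assms] by (rule someI)
  ultimately show ?thesis by (simp add: malg_measure_def)
qed

lemma malg_dist_class:
  "A \<in> sets N \<Longrightarrow> B \<in> sets N \<Longrightarrow>
     malg_dist N (malg_class N A) (malg_class N B) = measure N (sym_diff A B)"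
  by (simp add: malg_dist_def malg_symdiff_class malg_measure_class)

lemma Metric_space_malg:
  assumes "finite_measure N"
  shows "Metric_space (malg N) (malg_dist N)"
proof -
  interpret finite_measure N by fact
  have comm: "malg_symdiff N a b = malg_symdiff N b a" for a b
    unfolding malg_symdiff_def malg_lift2_def by (subst SUP_commute) (simp only: Un_commute)
  show ?thesis
  proof
    fix a b
    show "malg_dist N a b = malg_dist N b a"
      by (simp add: malg_dist_def comm)
    show "0 \<le> malg_dist N a b"
      by (simp add: malg_dist_def malg_measure_def)
  next
    fix a b assume "a \<in> malg N" "b \<in> malg N"
    then obtain A B where "A \<in> sets N" "a = malg_class N A" "B \<in> sets N" "b = malg_class N B"
      by (metis malgE)
    then show "malg_dist N a b = 0 \<longleftrightarrow> a = b"
      by (simp add: malg_dist_class malg_class_eq_iff null_sets_def emeasure_eq_measure)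
  next
    fix a b c assume "a \<in> malg N" "b \<in> malg N" "c \<in> malg N"
    then obtain A B C where *: "A \<in> sets N" "a = malg_class N A" "B \<in> sets N" "b = malg_class N B"
      "C \<in> sets N" "c = malg_class N C"
      by (metis malgE)
    have "measure N (sym_diff A C) \<le> measure N (sym_diff A B \<union> sym_diff B C)"
      using * by (intro finite_measure_mono) auto
    also have "\<dots> \<le> measure N (sym_diff A B) + measure N (sym_diff B C)"
      using * by (intro measure_Un_le) auto
    finally show "malg_dist N a c \<le> malg_dist N a b + malg_dist N b c"
      using * by (simp add: malg_dist_class)
  qed
qed


section \<open>Automorphisms and Boolean actions\<close>

definition malg_auts :: "'b measure \<Rightarrow> ('b set set \<Rightarrow> 'b set set) set" where
  "malg_auts N =
     {T \<in> Bij (malg N).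
        (\<forall>a\<in>malg N. \<forall>b\<in>malg N. T (malg_inf N a b) = malg_inf N (T a) (T b)) \<and>
        (\<forall>a\<in>malg N. \<forall>b\<in>malg N. T (malg_sup N a b) = malg_sup N (T a) (T b)) \<and>
        (\<forall>a\<in>malg N. T (malg_compl N a) = malg_compl N (T a)) \<and>
        (\<forall>a\<in>malg N. malg_measure N (T a) = malg_measure N a)}"

definition malg_Aut :: "'b measure \<Rightarrow> ('b set set \<Rightarrow> 'b set set) monoid" where
  "malg_Aut N = (BijGroup (malg N))\<lparr>carrier := malg_auts N\<rparr>"

text \<open>Since automorphisms are extensional functions on the algebra, the topology of pointwise
  convergence is the subspace topology from the product of copies of the metric space
  \<^term>\<open>malg_metric N\<close>, indexed by the elements of the algebra.\<close>

definition malg_Aut_topology :: "'b measure \<Rightarrow> ('b set set \<Rightarrow> 'b set set) topology" where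
  "malg_Aut_topology N =
     subtopology (product_topology (\<lambda>_. mtopology_of (malg_metric N)) (malg N)) (malg_auts N)"

definition boolean_action ::
  "('g, 'm) monoid_scheme \<Rightarrow> 'g topology \<Rightarrow> 'b measure \<Rightarrow> ('g \<Rightarrow> 'b set set \<Rightarrow> 'b set set) \<Rightarrow> bool"
where
  "boolean_action G T N \<phi> \<longleftrightarrow>
     polish_group G T \<and> standard_borel N \<and> prob_space N \<and>
     \<phi> \<in> hom G (malg_Aut N) \<and> continuous_map T (malg_Aut_topology N) \<phi>"

definition whirly ::
  "('g, 'm) monoid_scheme \<Rightarrow> 'g topology \<Rightarrow> 'b measure \<Rightarrow> ('g \<Rightarrow> 'b set set \<Rightarrow> 'b set set) \<Rightarrow> bool"
where
  "whirly G T N \<phi> \<longleftrightarrow>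
     (\<forall>V a b. V \<subseteq> topspace T \<and> (\<exists>U. openin T U \<and> \<one>\<^bsub>G\<^esub> \<in> U \<and> U \<subseteq> V) \<and>
        a \<in> malg N \<and> b \<in> malg N \<and> malg_measure N a > 0 \<and> malg_measure N b > 0 \<longrightarrow>
        (\<exists>g\<in>V. malg_measure N (malg_inf N (\<phi> g a) b) > 0))"

lemma malg_ops_closed:
  assumes "a \<in> malg N" "b \<in> malg N"
  shows "malg_inf N a b \<in> malg N" "malg_sup N a b \<in> malg N" "malg_compl N a \<in> malg N"
proof -
  obtain A B where "A \<in> sets N" "a = malg_class N A" "B \<in> sets N" "b = malg_class N B"
    using assms by (metis malgE)
  then show "malg_inf N a b \<in> malg N" "malg_sup N a b \<in> malg N" "malg_compl N a \<in> malg N"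
    by (auto simp: malg_inf_class malg_sup_class malg_compl_class intro!: malg_class_in_malg)
qed

lemma group_malg_Aut: "group (malg_Aut N)"
proof -
  interpret B: group "BijGroup (malg N)" by (rule group_BijGroup)
  have "subgroup (malg_auts N) (BijGroup (malg N))"
  proof (rule B.subgroupI)
    show "malg_auts N \<subseteq> carrier (BijGroup (malg N))"
      by (auto simp: malg_auts_def BijGroup_def)
    have "(\<lambda>a\<in>malg N. a) \<in> malg_auts N"
      by (auto simp: malg_auts_def id_Bij malg_ops_closed)
    then show "malg_auts N \<noteq> {}" by blast
  next
    fix T assume T: "T \<in> malg_auts N"
    then have bij: "T \<in> Bij (malg N)" by (simp add: malg_auts_def)
    then have bb: "bij_betw T (malg N) (malg N)" by (simp add: Bij_def)
    define S where "S = inv_into (malg N) T"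
    have S: "S a \<in> malg N" "T (S a) = a" if "a \<in> malg N" for a
      using that bb by (auto simp: S_def bij_betw_def f_inv_into_f inv_into_into)
    have eq: "S a = c" if "c \<in> malg N" "T c = a" for a c
      using that bb by (auto simp: S_def bij_betw_def)
    have "restrict S (malg N) \<in> malg_auts N"
      using T S restrict_inv_into_Bij[OF bij]
      by (auto simp: malg_auts_def malg_ops_closed S_def[symmetric] intro!: eq)
        (metis S)
    then show "inv\<^bsub>BijGroup (malg N)\<^esub> T \<in> malg_auts N"
      by (simp add: inv_BijGroup[OF bij] S_def)
  next
    fix S T assume "S \<in> malg_auts N" "T \<in> malg_auts N"
    then show "S \<otimes>\<^bsub>BijGroup (malg N)\<^esub> T \<in> malg_auts N"
      by (auto simp: malg_auts_def BijGroup_def compose_Bij compose_eq malg_ops_closed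
          dest!: Bij_imp_funcset simp: Pi_iff)
  qed
  then show ?thesis
    unfolding malg_Aut_def by (rule subgroup.subgroup_is_group) (rule B.is_group)
qed

end

theory Submission
  imports Defs
begin

text \<open>An uncountable compact metric space contains a Cantor set, which carries the fair coin
measure. The circle-valued functions act by multiplication, hence by real orthogonal
transformations, on the square integrable complex functions on the Cantor set, and this induces
an action on the standard Gaussian measure of a sequence space, whose coordinates correspond to a
Walsh basis.

The action is whirly because of the functions \<open>f\<^sub>m = cos \<epsilon> + \<i> r\<^sub>m sin \<epsilon>\<close> on the
Cantor set, where \<open>r\<^sub>m\<close> is the \<open>m\<close>-th coordinate in \<open>{-1, 1}\<close>. They extend to continuous
maps uniformly within \<open>\<epsilon>\<close> of the constant 1, but as operators they converge weakly to the scalar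
\<open>\<rho> = cos \<epsilon>\<close>. So the joint law of a Gaussian point \<open>w\<close> and its image under \<open>f\<^sub>m\<close> converges to
that of \<open>x\<close> and \<open>\<rho> x + \<sigma> y\<close> with \<open>x\<close>, \<open>y\<close> independent and \<open>\<sigma> = sin \<epsilon>\<close>, and this
limit law charges every product of two sets of positive measure.\<close>

section \<open>Trigonometric polynomials on sequence space\<close>

text \<open>Two obstacles shape the proof. A Gaussian point is almost surely not square summable, so
  its image under an operator exists only as a limit of finite sums, up to null sets; the point maps
  compose almost everywhere, which suffices for an action on the measure algebra. And the limit law
  is singular with respect to the product measure, because infinitely many coordinates have the same
  correlation \<open>\<rho>\<close>, so positivity on a product of two sets cannot be read off from
  a density. It is obtained by decoupling finitely many coordinates and by approximating one of the
  sets by a set that sees only these.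

  Trigonometric polynomials take the place of inversion and weak convergence theorems. Their
  Gaussian integrals are explicit, and they are dense in mean for every finite Borel measure on
  sequence space; so they identify laws, give continuity of the action and carry the limit over to
  measurable sets. On them the convergence is an equality from some \<open>m\<close> on, since each
  of them involves finitely many basis vectors.\<close>

abbreviation lin :: "(nat \<Rightarrow> real) \<Rightarrow> nat \<Rightarrow> (nat \<Rightarrow> real) \<Rightarrow> real" where
  "lin a n x \<equiv> \<Sum>j<n. a j * x j"

abbreviation L1_dist :: "'b measure \<Rightarrow> ('b \<Rightarrow> real) \<Rightarrow> ('b \<Rightarrow> real) \<Rightarrow> real" where
  "L1_dist M f g \<equiv> \<integral>x. \<bar>f x - g x\<bar> \<partial>M"

text \<open>The phase \<open>b\<close> covers sines and, with \<open>n = 0\<close>, constants, so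
  cosines alone span the class. It is introduced as a linear span, not as an algebra, so that an
  induction reduces an integral identity to single cosines.\<close>

inductive trig_poly :: "((nat \<Rightarrow> real) \<Rightarrow> real) \<Rightarrow> bool" where
  cos: "trig_poly (\<lambda>w. cos (lin a n w + b))"
| scale: "trig_poly P \<Longrightarrow> trig_poly (\<lambda>w. c * P w)"
| add: "trig_poly P \<Longrightarrow> trig_poly Q \<Longrightarrow> trig_poly (\<lambda>w. P w + Q w)"

lemma trig_poly_const: "trig_poly (\<lambda>w. c)"
  using trig_poly.scale[OF trig_poly.cos[where n=0 and a="\<lambda>_. 0" and b=0], of c] by simp

lemma sum_lessThan_pad:
  fixes a :: "nat \<Rightarrow> real"
  assumes "n \<le> N"
  shows "lin a n x = (\<Sum>j<N. (if j < n then a j else 0) * x j)"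
  using assms by (intro sum.mono_neutral_cong_left) auto

text \<open>The product-to-sum formula, after both frequency vectors are padded with zeros to a
  common length.\<close>

lemma cos_linear_mult_cos_linear:
  fixes a a' :: "nat \<Rightarrow> real"
  obtains N s t where "\<And>x. cos (lin a n x + b) * cos (lin a' m x + b') =
    (1/2) * cos (lin s N x + (b + b')) + (1/2) * cos (lin t N x + (b - b'))"
proof -
  let ?N = "max n m"
  let ?p = "\<lambda>j. if j < n then a j else 0" and ?q = "\<lambda>j. if j < m then a' j else 0"
  have "cos (lin a n x + b) * cos (lin a' m x + b') =
    (1/2) * cos ((\<Sum>j<?N. (?p j + ?q j) * x j) + (b + b')) +
    (1/2) * cos ((\<Sum>j<?N. (?p j - ?q j) * x j) + (b - b'))" for x
  proof -
    have "(\<Sum>j<?N. (?p j + ?q j) * x j) = lin a n x + lin a' m x"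
      "(\<Sum>j<?N. (?p j - ?q j) * x j) = lin a n x - lin a' m x"
      by (simp_all only: sum_lessThan_pad[of n ?N] sum_lessThan_pad[of m ?N] max.cobounded1
            max.cobounded2 distrib_right left_diff_distrib sum.distrib sum_subtractf)
    then show ?thesis
      by (simp only: cos_times_cos) (simp add: add_diff_eq diff_add_eq diff_diff_eq2 add_ac diff_diff_add)
  qed
  then show thesis by (rule that)
qed

lemma trig_poly_mult:
  assumes "trig_poly P" "trig_poly Q"
  shows "trig_poly (\<lambda>w. P w * Q w)"
  using assms
proof (induction P rule: trig_poly.induct)
  case (cos a n b)
  from cos.prems show ?case
  proof (induction Q rule: trig_poly.induct)
    case (cos a' m b')
    show ?case
    proof (rule cos_linear_mult_cos_linear[where n=n and a=a and b=b and m=m and a'=a' and b'=b'])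
      fix N s t
      assume *: "\<And>x. cos (lin a n x + b) * cos (lin a' m x + b') =
        (1/2) * cos (lin s N x + (b + b')) + (1/2) * cos (lin t N x + (b - b'))"
      show "trig_poly (\<lambda>x. cos (lin a n x + b) * cos (lin a' m x + b'))"
        unfolding * by (intro trig_poly.intros)
    qed
  next
    case (scale P c)
    then show ?case using trig_poly.scale[of _ c] by (simp add: mult.left_commute)
  next
    case (add P Q)
    then show ?case using trig_poly.add by (simp add: distrib_left)
  qed
next
  case (scale P c)
  then show ?case using trig_poly.scale[of _ c] by (simp add: mult.assoc)
next
  case (add P Q)
  then show ?case using trig_poly.add by (simp add: distrib_right)
qed

lemma measurable_component_borel [measurable]: "(\<lambda>w::nat \<Rightarrow> real. w j) \<in> borel_measurable borel"
  by (intro borel_measurable_continuous_onI continuous_on_coordinatewise_then_product) simp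

lemma trig_poly_measurable: "trig_poly P \<Longrightarrow> P \<in> borel_measurable borel"
  by (induction rule: trig_poly.induct)
    (auto intro!: borel_measurable_times borel_measurable_add, measurable)

lemma trig_poly_bounded: "trig_poly P \<Longrightarrow> \<exists>B. \<forall>w. \<bar>P w\<bar> \<le> B"
proof (induction rule: trig_poly.induct)
  case (cos a n b)
  then show ?case by (intro exI[of _ 1]) auto
next
  case (scale P c)
  then obtain B where "\<And>w. \<bar>P w\<bar> \<le> B" by blast
  then show ?case by (intro exI[of _ "\<bar>c\<bar> * B"]) (auto simp: abs_mult mult_left_mono)
next
  case (add P Q)
  then obtain B C where "\<And>w. \<bar>P w\<bar> \<le> B" "\<And>w. \<bar>Q w\<bar> \<le> C" by blast
  then show ?case by (intro exI[of _ "B + C"]) (auto intro: order_trans[OF abs_triangle_ineq] add_mono)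
qed

lemma abs_cos_diff_le: "\<bar>cos x - cos y\<bar> \<le> \<bar>x - y :: real\<bar>"
proof -
  have "\<bar>sin ((x + y) / 2)\<bar> * \<bar>sin ((y - x) / 2)\<bar> \<le> 1 * \<bar>(y - x) / 2\<bar>"
    by (intro mult_mono abs_sin_x_le_abs_x) auto
  then show ?thesis by (simp add: cos_diff_cos abs_mult)
qed

text \<open>Only finitely many coordinates enter the bound. It therefore yields two things at once:
  \<open>P\<close> depends on these coordinates alone, and closeness in mean of the coordinates
  passes to \<open>P\<close>.\<close>

lemma trig_poly_lipschitz:
  "trig_poly P \<Longrightarrow> \<exists>n L. 0 \<le> L \<and> (\<forall>x y. \<bar>P x - P y\<bar> \<le> L * (\<Sum>j<n. \<bar>x j - y j\<bar>))"
proof (induction rule: trig_poly.induct)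
  case (cos a n b)
  let ?L = "\<Sum>j<n. \<bar>a j\<bar>"
  have *: "\<bar>cos (lin a n x + b) - cos (lin a n y + b)\<bar> \<le> ?L * (\<Sum>j<n. \<bar>x j - y j\<bar>)" for x y
  proof -
    have "\<bar>cos (lin a n x + b) - cos (lin a n y + b)\<bar> \<le> \<bar>\<Sum>j<n. a j * (x j - y j)\<bar>"
      using abs_cos_diff_le[of "lin a n x + b" "lin a n y + b"]
      by (simp add: right_diff_distrib sum_subtractf)
    also have "\<dots> \<le> (\<Sum>j<n. \<bar>a j\<bar> * \<bar>x j - y j\<bar>)"
      by (rule order_trans[OF sum_abs]) (simp add: abs_mult)
    also have "\<dots> \<le> (\<Sum>j<n. \<bar>a j\<bar> * (\<Sum>j<n. \<bar>x j - y j\<bar>))"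
      by (intro sum_mono mult_left_mono member_le_sum) auto
    finally show ?thesis by (simp add: sum_distrib_right)
  qed
  have "0 \<le> ?L" by (simp add: sum_nonneg)
  with * show ?case by blast
next
  case (scale P c)
  then obtain n L where "0 \<le> L" and L: "\<And>x y. \<bar>P x - P y\<bar> \<le> L * (\<Sum>j<n. \<bar>x j - y j\<bar>)" by blast
  have *: "\<bar>c * P x - c * P y\<bar> \<le> \<bar>c\<bar> * L * (\<Sum>j<n. \<bar>x j - y j\<bar>)" for x y
  proof -
    have "\<bar>c * P x - c * P y\<bar> = \<bar>c\<bar> * \<bar>P x - P y\<bar>"
      by (metis abs_mult right_diff_distrib)
    also have "\<dots> \<le> \<bar>c\<bar> * (L * (\<Sum>j<n. \<bar>x j - y j\<bar>))"
      by (rule mult_left_mono[OF L abs_ge_zero])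
    also have "\<dots> = \<bar>c\<bar> * L * (\<Sum>j<n. \<bar>x j - y j\<bar>)" by (rule mult.assoc[symmetric])
    finally show ?thesis .
  qed
  have "0 \<le> \<bar>c\<bar> * L" using \<open>0 \<le> L\<close> by simp
  with * show ?case by blast
next
  case (add P Q)
  from add.IH(1) obtain n L where "0 \<le> L"
    and L: "\<And>x y. \<bar>P x - P y\<bar> \<le> L * (\<Sum>j<n. \<bar>x j - y j\<bar>)" by blast
  from add.IH(2) obtain m K where "0 \<le> K"
    and K: "\<And>x y. \<bar>Q x - Q y\<bar> \<le> K * (\<Sum>j<m. \<bar>x j - y j\<bar>)" by blast
  have *: "\<bar>P x + Q x - (P y + Q y)\<bar> \<le> (L + K) * (\<Sum>j<max n m. \<bar>x j - y j\<bar>)" for x y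
  proof -
    have le: "(\<Sum>j<k. \<bar>x j - y j\<bar>) \<le> (\<Sum>j<max n m. \<bar>x j - y j\<bar>)" if "k \<le> max n m" for k
      using that by (intro sum_mono2) auto
    have "L * (\<Sum>j<n. \<bar>x j - y j\<bar>) \<le> L * (\<Sum>j<max n m. \<bar>x j - y j\<bar>)"
      "K * (\<Sum>j<m. \<bar>x j - y j\<bar>) \<le> K * (\<Sum>j<max n m. \<bar>x j - y j\<bar>)"
      by (rule mult_left_mono[OF le[OF max.cobounded1] \<open>0 \<le> L\<close>],
          rule mult_left_mono[OF le[OF max.cobounded2] \<open>0 \<le> K\<close>])
    then show ?thesis using L[of x y] K[of x y] by (simp add: distrib_right)
  qed
  have "0 \<le> L + K" using \<open>0 \<le> L\<close> \<open>0 \<le> K\<close> by simp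
  with * show ?case by blast
qed

section \<open>Approximation in mean of bounded measurable functions\<close>

definition trig_approx :: "(nat \<Rightarrow> real) measure \<Rightarrow> ((nat \<Rightarrow> real) \<Rightarrow> real) \<Rightarrow> bool" where
  "trig_approx \<mu> F \<longleftrightarrow> F \<in> borel_measurable borel \<and> (\<exists>B. \<forall>w. \<bar>F w\<bar> \<le> B) \<and>
     (\<forall>\<epsilon>>0. \<exists>P. trig_poly P \<and> L1_dist \<mu> F P < \<epsilon>)"

lemma trig_approx_measurable: "trig_approx \<mu> F \<Longrightarrow> F \<in> borel_measurable borel"
  and trig_approx_bounded: "trig_approx \<mu> F \<Longrightarrow> \<exists>B. \<forall>w. \<bar>F w\<bar> \<le> B"
  and trig_approxD: "trig_approx \<mu> F \<Longrightarrow> \<epsilon> > 0 \<Longrightarrow> \<exists>P. trig_poly P \<and> L1_dist \<mu> F P < \<epsilon>"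
  by (simp_all add: trig_approx_def)

lemma trig_approxI:
  assumes "F \<in> borel_measurable borel" "\<And>w. \<bar>F w\<bar> \<le> B"
    and "\<And>\<epsilon>. \<epsilon> > 0 \<Longrightarrow> \<exists>P. trig_poly P \<and> L1_dist \<mu> F P < \<epsilon>"
  shows "trig_approx \<mu> F"
  using assms unfolding trig_approx_def by blast

context
  fixes \<mu> :: "(nat \<Rightarrow> real) measure"
  assumes fin: "finite_measure \<mu>" and sets_\<mu> [measurable_cong]: "sets \<mu> = sets borel"
begin

interpretation finite_measure \<mu> by (rule fin)

lemma integrable_bounded_borel:
  assumes "F \<in> borel_measurable borel" "\<And>w. \<bar>F w\<bar> \<le> (B::real)"
  shows "integrable \<mu> F"
  using assms by (intro integrable_const_bound[of _ B]) auto

lemma trig_approx_trig_poly: "trig_poly P \<Longrightarrow> trig_approx \<mu> P"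
  unfolding trig_approx_def using trig_poly_measurable trig_poly_bounded
  by (auto intro!: exI[of _ P])

lemma integrable_diff_trig_poly:
  assumes "trig_approx \<mu> F" "trig_poly P"
  shows "integrable \<mu> (\<lambda>w. F w - P w)"
proof -
  obtain B where "\<And>w. \<bar>F w\<bar> \<le> B" using trig_approx_bounded[OF assms(1)] by blast
  moreover obtain C where "\<And>w. \<bar>P w\<bar> \<le> C" using trig_poly_bounded[OF assms(2)] by blast
  ultimately show ?thesis
    using assms trig_poly_measurable[of P]
    by (intro Bochner_Integration.integrable_diff integrable_bounded_borel[of _ B] integrable_bounded_borel[of _ C])
      (auto simp: trig_approx_def)
qed

lemma trig_approx_add:
  assumes F: "trig_approx \<mu> F" and G: "trig_approx \<mu> G"
  shows "trig_approx \<mu> (\<lambda>w. F w + G w)"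
proof -
  obtain B where B: "\<And>w. \<bar>F w\<bar> \<le> B" using trig_approx_bounded[OF F] by blast
  obtain C where C: "\<And>w. \<bar>G w\<bar> \<le> C" using trig_approx_bounded[OF G] by blast
  have *: "\<exists>P. trig_poly P \<and> (\<integral>w. \<bar>F w + G w - P w\<bar> \<partial>\<mu>) < \<epsilon>" if e: "\<epsilon> > 0" for \<epsilon>
  proof -
    obtain P where P: "trig_poly P" "L1_dist \<mu> F P < \<epsilon> / 2"
      using trig_approxD[OF F half_gt_zero[OF e]] by blast
    obtain Q where Q: "trig_poly Q" "L1_dist \<mu> G Q < \<epsilon> / 2"
      using trig_approxD[OF G half_gt_zero[OF e]] by blast
    have I: "integrable \<mu> (\<lambda>w. \<bar>F w - P w\<bar>)" "integrable \<mu> (\<lambda>w. \<bar>G w - Q w\<bar>)"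
      by (intro integrable_abs integrable_diff_trig_poly F G P Q)+
    have "(\<integral>w. \<bar>F w + G w - (P w + Q w)\<bar> \<partial>\<mu>) \<le> (\<integral>w. \<bar>F w - P w\<bar> + \<bar>G w - Q w\<bar> \<partial>\<mu>)"
      using integrable_diff_trig_poly[OF F P(1)] integrable_diff_trig_poly[OF G Q(1)]
      by (intro integral_mono' Bochner_Integration.integrable_add I) auto
    also have "\<dots> < \<epsilon>" using P(2) Q(2) I by simp
    finally show ?thesis using trig_poly.add[OF P(1) Q(1)] by blast
  qed
  have **: "\<bar>F w + G w\<bar> \<le> B + C" for w
    using B[of w] C[of w] by linarith
  show ?thesis
    by (rule trig_approxI[OF borel_measurable_add[OF trig_approx_measurable[OF F] trig_approx_measurable[OF G]] ** *])
qed

text \<open>The approximant of the second factor is chosen after the sup norm of the approximant of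
  the first one is known.\<close>

lemma trig_approx_mult:
  assumes F: "trig_approx \<mu> F" and G: "trig_approx \<mu> G"
  shows "trig_approx \<mu> (\<lambda>w. F w * G w)"
proof -
  obtain B where B: "\<And>w. \<bar>F w\<bar> \<le> B" using trig_approx_bounded[OF F] by blast
  obtain C where C: "\<And>w. \<bar>G w\<bar> \<le> C" using trig_approx_bounded[OF G] by blast
  have C0: "C \<ge> 0" using C[of undefined] by simp
  have *: "\<exists>P. trig_poly P \<and> (\<integral>w. \<bar>F w * G w - P w\<bar> \<partial>\<mu>) < \<epsilon>" if e: "\<epsilon> > 0" for \<epsilon>
  proof -
    have "\<epsilon> / 2 / (C + 1) > 0" using e C0 by simp
    then obtain P where P: "trig_poly P" "L1_dist \<mu> F P < \<epsilon> / 2 / (C + 1)"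
      using trig_approxD[OF F] by blast
    obtain D where D: "\<And>w. \<bar>P w\<bar> \<le> D" using trig_poly_bounded[OF P(1)] by auto
    have D0: "D \<ge> 0" using D[of undefined] by simp
    then have "\<epsilon> / 2 / (D + 1) > 0" using e by simp
    then obtain Q where Q: "trig_poly Q" "L1_dist \<mu> G Q < \<epsilon> / 2 / (D + 1)"
      using trig_approxD[OF G] by blast
    have I: "integrable \<mu> (\<lambda>w. \<bar>F w - P w\<bar>)" "integrable \<mu> (\<lambda>w. \<bar>G w - Q w\<bar>)"
      by (intro integrable_abs integrable_diff_trig_poly F G P Q)+
    have "\<bar>F w * G w - P w * Q w\<bar> \<le> (C + 1) * \<bar>F w - P w\<bar> + (D + 1) * \<bar>G w - Q w\<bar>" for w
    proof -
      have "\<bar>F w * G w - P w * Q w\<bar> = \<bar>(F w - P w) * G w + P w * (G w - Q w)\<bar>"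
        by (simp add: algebra_simps)
      also have "\<dots> \<le> \<bar>G w\<bar> * \<bar>F w - P w\<bar> + \<bar>P w\<bar> * \<bar>G w - Q w\<bar>"
        by (rule order_trans[OF abs_triangle_ineq]) (simp add: abs_mult)
      also have "\<dots> \<le> (C + 1) * \<bar>F w - P w\<bar> + (D + 1) * \<bar>G w - Q w\<bar>"
        using C[of w] D[of w] by (intro add_mono mult_right_mono) auto
      finally show ?thesis .
    qed
    then have "(\<integral>w. \<bar>F w * G w - P w * Q w\<bar> \<partial>\<mu>) \<le>
        (\<integral>w. (C + 1) * \<bar>F w - P w\<bar> + (D + 1) * \<bar>G w - Q w\<bar> \<partial>\<mu>)"
      using I C0 D0 by (intro integral_mono') auto
    also have "\<dots> = (C + 1) * L1_dist \<mu> F P + (D + 1) * L1_dist \<mu> G Q"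
      using I by simp
    finally have le: "(\<integral>w. \<bar>F w * G w - P w * Q w\<bar> \<partial>\<mu>) \<le>
      (C + 1) * L1_dist \<mu> F P + (D + 1) * L1_dist \<mu> G Q" .
    have l1: "(C + 1) * L1_dist \<mu> F P < \<epsilon> / 2"
      using P(2) C0 by (subst (asm) pos_less_divide_eq) (auto simp: mult.commute)
    have l2: "(D + 1) * L1_dist \<mu> G Q < \<epsilon> / 2"
      using Q(2) D0 by (subst (asm) pos_less_divide_eq) (auto simp: mult.commute)
    have "(\<integral>w. \<bar>F w * G w - P w * Q w\<bar> \<partial>\<mu>) < \<epsilon>"
      using le l1 l2 by linarith
    then show ?thesis using trig_poly_mult[OF P(1) Q(1)] by blast
  qed
  have **: "\<bar>F w * G w\<bar> \<le> B * C" for w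
    using B[of w] C[of w] by (auto simp: abs_mult intro!: mult_mono)
  show ?thesis
    by (rule trig_approxI[OF borel_measurable_times[OF trig_approx_measurable[OF F] trig_approx_measurable[OF G]] ** *])
qed

text \<open>Dominated convergence with the constant \<open>2 * B\<close>. The uniform bound concerns
  the functions \<open>F n\<close> only; their approximating polynomials are under no common
  bound.\<close>

lemma trig_approx_limit:
  assumes F: "\<And>n. trig_approx \<mu> (F n)" and B: "\<And>n w. \<bar>F n w\<bar> \<le> B"
    and lim: "\<And>w. (\<lambda>n. F n w) \<longlonglongrightarrow> G w"
  shows "trig_approx \<mu> G"
proof -
  have mF[measurable]: "F n \<in> borel_measurable borel" for n using F by (auto simp: trig_approx_def)
  have mG[measurable]: "G \<in> borel_measurable borel"
    by (rule borel_measurable_LIMSEQ_real[OF lim mF])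
  have BG: "\<bar>G w\<bar> \<le> B" for w
    by (rule LIMSEQ_le_const2[OF tendsto_rabs[OF lim]]) (use B in auto)
  have "(\<lambda>n. \<integral>w. \<bar>G w - F n w\<bar> \<partial>\<mu>) \<longlonglongrightarrow> (\<integral>w. 0 \<partial>\<mu>)"
  proof (rule integral_dominated_convergence[where w="\<lambda>_. 2 * B"])
    show "AE w in \<mu>. (\<lambda>n. \<bar>G w - F n w\<bar>) \<longlonglongrightarrow> 0"
    proof (rule AE_I2)
      show "(\<lambda>n. \<bar>G w - F n w\<bar>) \<longlonglongrightarrow> 0" for w
        using tendsto_rabs[OF tendsto_diff[OF tendsto_const[of "G w"] lim[of w]]] by simp
    qed
    show "AE w in \<mu>. norm \<bar>G w - F n w\<bar> \<le> 2 * B" for n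
    proof (rule AE_I2)
      show "norm \<bar>G w - F n w\<bar> \<le> 2 * B" for w
        using BG[of w] B[of n w] by simp
    qed
  qed auto
  then have lim0: "(\<lambda>n. \<integral>w. \<bar>G w - F n w\<bar> \<partial>\<mu>) \<longlonglongrightarrow> 0" by simp
  have *: "\<exists>P. trig_poly P \<and> L1_dist \<mu> G P < \<epsilon>" if e: "\<epsilon> > 0" for \<epsilon>
  proof -
    obtain n where n: "L1_dist \<mu> G (F n) < \<epsilon> / 2"
      using eventually_happens'[OF sequentially_bot order_tendstoD(2)[OF lim0 half_gt_zero[OF e]]] by blast
    obtain P where P: "trig_poly P" "L1_dist \<mu> (F n) P < \<epsilon> / 2"
      using trig_approxD[OF F half_gt_zero[OF e]] by blast
    have I: "integrable \<mu> (\<lambda>w. \<bar>F n w - P w\<bar>)" "integrable \<mu> (\<lambda>w. \<bar>G w - F n w\<bar>)"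
      by (rule integrable_abs[OF integrable_diff_trig_poly[OF F P(1)]],
          rule integrable_abs[OF Bochner_Integration.integrable_diff[OF
            integrable_bounded_borel[OF mG BG] integrable_bounded_borel[OF mF B]]])
    have "L1_dist \<mu> G P \<le> (\<integral>w. \<bar>G w - F n w\<bar> + \<bar>F n w - P w\<bar> \<partial>\<mu>)"
      using I by (intro integral_mono' Bochner_Integration.integrable_add) auto
    also have "\<dots> < \<epsilon>" using n P(2) I by simp
    finally show ?thesis using P(1) by blast
  qed
  show ?thesis by (rule trig_approxI[OF mG BG *])
qed

lemma trig_approx_const: "trig_approx \<mu> (\<lambda>_. c)"
  by (rule trig_approx_trig_poly[OF trig_poly_const])

lemma trig_approx_scale: "trig_approx \<mu> F \<Longrightarrow> trig_approx \<mu> (\<lambda>w. c * F w)"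
  by (rule trig_approx_mult[OF trig_approx_const])

lemma trig_approx_polynomial:
  assumes "real_polynomial_function p" "trig_approx \<mu> F"
  shows "trig_approx \<mu> (\<lambda>w. p (F w))"
  using assms
proof (induction p rule: real_polynomial_function.induct)
  case (linear f)
  then obtain c where "f = (\<lambda>x. x * c)" by (metis real_bounded_linear)
  then show ?case using trig_approx_scale[OF linear(2), of c] by (simp add: mult.commute)
next
  case (const c)
  show ?case by (rule trig_approx_const)
next
  case (add f g)
  show ?case by (rule trig_approx_add[OF add.IH(1)[OF add.prems] add.IH(2)[OF add.prems]])
next
  case (mult f g)
  show ?case by (rule trig_approx_mult[OF mult.IH(1)[OF mult.prems] mult.IH(2)[OF mult.prems]])
qed

text \<open>\<open>F\<close> takes values in a compact interval, on which \<open>g\<close> is a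
  uniform limit of polynomials; these preserve approximability because it is closed under sums and
  products.\<close>

lemma trig_approx_continuous:
  fixes g :: "real \<Rightarrow> real"
  assumes g: "continuous_on UNIV g" and F: "trig_approx \<mu> F"
  shows "trig_approx \<mu> (\<lambda>w. g (F w))"
proof -
  obtain B where B: "\<And>w. \<bar>F w\<bar> \<le> B" using trig_approx_bounded[OF F] by blast
  have S: "compact {-B..B}" by simp
  have gS: "continuous_on {-B..B} g" using g continuous_on_subset by blast
  have "\<forall>n. \<exists>p. real_polynomial_function p \<and> (\<forall>x\<in>{-B..B}. \<bar>g x - p x\<bar> < 1 / real (Suc n))"
  proof
    fix n
    have "0 < 1 / real (Suc n)" by simp
    from S gS this show "\<exists>p. real_polynomial_function p \<and> (\<forall>x\<in>{-B..B}. \<bar>g x - p x\<bar> < 1 / real (Suc n))"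
    proof (rule Stone_Weierstrass_real_polynomial_function)
      fix p assume "real_polynomial_function p"
        and "\<And>x. x \<in> {-B..B} \<Longrightarrow> \<bar>g x - p x\<bar> < 1 / real (Suc n)"
      then show ?thesis by blast
    qed
  qed
  then obtain p where p: "\<And>n. real_polynomial_function (p n)"
    and pg: "\<And>n x. x \<in> {-B..B} \<Longrightarrow> \<bar>g x - p n x\<bar> < 1 / real (Suc n)"
    unfolding choice_iff by blast
  have FB: "F w \<in> {-B..B}" for w using B[of w] by auto
  obtain D where D: "\<And>x. x \<in> {-B..B} \<Longrightarrow> \<bar>g x\<bar> \<le> D"
    using compact_imp_bounded[OF compact_continuous_image[OF gS S]]
    by (simp only: bounded_iff ball_simps real_norm_def) blast
  show ?thesis
  proof (rule trig_approx_limit)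
    show "trig_approx \<mu> (\<lambda>w. p n (F w))" for n by (rule trig_approx_polynomial[OF p F])
    show "\<bar>p n (F w)\<bar> \<le> D + 1" for n w
    proof -
      have "1 / real (Suc n) \<le> 1" by simp
      then show ?thesis using pg[OF FB[of w], of n] D[OF FB[of w]] by linarith
    qed
    show "(\<lambda>n. p n (F w)) \<longlonglongrightarrow> g (F w)" for w
    proof (rule LIM_zero_cancel, rule tendsto_0_le[OF LIMSEQ_Suc[OF lim_inverse_n'], of _ 1])
      show "\<forall>\<^sub>F n in sequentially. norm (p n (F w) - g (F w)) \<le> norm (1 / real (Suc n)) * 1"
      proof (rule always_eventually, rule allI)
        fix n show "norm (p n (F w) - g (F w)) \<le> norm (1 / real (Suc n)) * 1"
          using pg[OF FB[of w], of n] by (simp add: abs_minus_commute)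
      qed
    qed
  qed
qed

text \<open>Continuous ramps converge pointwise to the indicator of the positive half-line; at 0 all
  of them vanish, in agreement with the strict inequality.\<close>

lemma trig_approx_indicator_positive:
  assumes F: "trig_approx \<mu> F"
  shows "trig_approx \<mu> (indicator {w. F w > 0})"
proof (rule trig_approx_limit)
  let ?g = "\<lambda>n x. min 1 (max 0 (real n * x)) :: real"
  show "trig_approx \<mu> (\<lambda>w. ?g n (F w))" for n
    by (rule trig_approx_continuous[OF _ F]) (intro continuous_intros)
  show "\<bar>?g n (F w)\<bar> \<le> 1" for n w by auto
  show "(\<lambda>n. ?g n (F w)) \<longlonglongrightarrow> indicator {w. F w > 0} w" for w
  proof (cases "F w > 0")
    case True
    obtain N where N: "real N * F w > 1" using reals_Archimedean3[OF True] by blast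
    have "?g n (F w) = 1" if "n \<ge> N" for n
    proof -
      have "real N * F w \<le> real n * F w" using that True by (intro mult_right_mono) auto
      then show ?thesis using N by auto
    qed
    then have "\<forall>\<^sub>F n in sequentially. ?g n (F w) = 1"
      unfolding eventually_sequentially by blast
    then have "(\<lambda>n. ?g n (F w)) \<longlonglongrightarrow> 1" by (rule tendsto_eventually)
    then show ?thesis using True by (simp only: indicator_simps mem_Collect_eq)
  next
    case False
    then have "real n * F w \<le> 0" for n by (simp add: mult_nonneg_nonpos)
    then have "?g n (F w) = 0" for n by (simp only: max_absorb1)
    then have "(\<lambda>n. ?g n (F w)) \<longlonglongrightarrow> 0" by (simp only: tendsto_const)
    then show ?thesis using False by (simp only: indicator_simps mem_Collect_eq not_False_eq_True)
  qed
qed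

text \<open>A coordinate is unbounded, so the half-space is reached through the bounded function sin
  of a small multiple of \<open>w j - t\<close>: once \<open>Suc n\<close> exceeds
  \<open>\<bar>w j - t\<bar>\<close>, the argument lies between -pi and pi, where the sine has the
  sign of its argument.\<close>

lemma trig_approx_halfspace: "trig_approx \<mu> (indicator {w. w j > t})"
proof (rule trig_approx_limit)
  let ?s = "\<lambda>n w. sin ((w j - t) / real (Suc n)) :: real"
  show "trig_approx \<mu> (indicator {w. ?s n w > 0})" for n
  proof (rule trig_approx_indicator_positive, rule trig_approx_trig_poly)
    \<comment> \<open>A sine is a cosine with phase shifted by \<open>- pi / 2\<close>; the
      coefficient vector is supported at the single index \<open>j\<close>.\<close>
    have "?s n w = cos ((\<Sum>k<Suc j. (if k = j then 1 / real (Suc n) else 0) * w k) + (- t / real (Suc n) - pi / 2))" for w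
    proof -
      have "(\<Sum>k<Suc j. (if k = j then 1 / real (Suc n) else 0) * w k) = (1 / real (Suc n)) * w j"
        by simp
      moreover have "sin x = cos (x - pi / 2)" for x :: real by (simp add: cos_diff)
      ultimately show ?thesis by (simp add: diff_divide_distrib algebra_simps)
    qed
    then show "trig_poly (?s n)" using trig_poly.cos by presburger
  qed
  show "\<bar>indicator {w. ?s n w > 0} w :: real\<bar> \<le> 1" for n w
    by (simp add: indicator_def)
  show "(\<lambda>n. indicator {w. ?s n w > 0} w :: real) \<longlonglongrightarrow> indicator {w. w j > t} w" for w
  proof (intro tendsto_eventually)
    obtain N where N: "\<bar>w j - t\<bar> < real N" using reals_Archimedean2 by blast
    have "?s n w > 0 \<longleftrightarrow> w j > t" if "n \<ge> N" for n
    proof -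
      have "\<bar>w j - t\<bar> < real (Suc n)" using N that by linarith
      then have a: "\<bar>(w j - t) / real (Suc n)\<bar> < 1" by (simp add: abs_divide)
      have "pi > 1" using pi_gt3 by simp
      show ?thesis
      proof (cases "w j > t")
        case True
        then have "0 < (w j - t) / real (Suc n)" by simp
        moreover have "(w j - t) / real (Suc n) < pi"
          using a \<open>pi > 1\<close> by linarith
        ultimately have "?s n w > 0" by (rule sin_gt_zero)
        then show ?thesis using True by simp
      next
        case False
        then have "0 \<le> - ((w j - t) / real (Suc n))" by (simp add: divide_le_0_iff)
        moreover have "- ((w j - t) / real (Suc n)) \<le> pi"
          using a \<open>pi > 1\<close> by linarith
        ultimately have "sin (- ((w j - t) / real (Suc n))) \<ge> 0" by (rule sin_ge_zero)
        then have "?s n w \<le> 0" by (simp only: sin_minus neg_0_le_iff_le)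
        with False show ?thesis by linarith
      qed
    qed
    then show "\<forall>\<^sub>F n in sequentially. indicator {w. ?s n w > 0} w = (indicator {w. w j > t} w :: real)"
      by (auto simp: eventually_sequentially indicator_def intro!: exI[of _ N])
  qed
qed

text \<open>The sets with approximable indicator form a sigma-algebra: products give intersections,
  affine combinations give complements, bounded limits give countable unions. It contains the
  coordinate half-spaces, hence all Borel sets of sequence space.\<close>

proposition trig_poly_dense:
  assumes "A \<in> sets borel"
  shows "trig_approx \<mu> (indicator A)"
proof -
  define \<A> where "\<A> = {A. trig_approx \<mu> (indicator A)}"
  have compl: "UNIV - A \<in> \<A>" if "A \<in> \<A>" for A
  proof -
    have "trig_approx \<mu> (\<lambda>w. 1 + (-1) * indicator A w)"
      using that unfolding \<A>_def by (intro trig_approx_add trig_approx_const trig_approx_scale) auto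
    moreover have "(\<lambda>w. 1 + (-1) * indicator A w :: real) = indicator (UNIV - A)"
      by (auto simp: indicator_def)
    ultimately show ?thesis by (simp add: \<A>_def)
  qed
  have int: "A \<inter> B \<in> \<A>" if "A \<in> \<A>" "B \<in> \<A>" for A B
  proof -
    have "trig_approx \<mu> (\<lambda>w. indicator A w * indicator B w)"
      using that unfolding \<A>_def by (intro trig_approx_mult) auto
    then show ?thesis by (simp add: \<A>_def indicator_inter_arith[abs_def])
  qed
  have empty: "{} \<in> \<A>"
    unfolding \<A>_def using trig_approx_const[of 0] by (simp add: indicator_def[abs_def])
  have un: "A \<union> B \<in> \<A>" if "A \<in> \<A>" "B \<in> \<A>" for A B
  proof -
    have "A \<union> B = UNIV - ((UNIV - A) \<inter> (UNIV - B))" by auto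
    then show ?thesis using that compl int by simp
  qed
  have sig: "sigma_algebra UNIV \<A>"
    unfolding sigma_algebra_iff
  proof (intro conjI allI impI)
    show "algebra UNIV \<A>" unfolding algebra_iff_Un using compl un empty by auto
    fix A :: "nat \<Rightarrow> (nat \<Rightarrow> real) set" assume A: "range A \<subseteq> \<A>"
    have fin: "(\<Union>i<n. A i) \<in> \<A>" for n
      using A by (induction n) (auto simp: lessThan_Suc intro!: un empty)
    have "trig_approx \<mu> (indicator (\<Union>i. A i))"
    proof (rule trig_approx_limit)
      show "trig_approx \<mu> (indicator (\<Union>i<n. A i))" for n using fin by (simp add: \<A>_def)
      show "\<bar>indicator (\<Union>i<n. A i) w :: real\<bar> \<le> 1" for n w by (simp add: indicator_def)
      show "(\<lambda>n. indicator (\<Union>i<n. A i) w :: real) \<longlonglongrightarrow> indicator (\<Union>i. A i) w" for w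
        by (rule LIMSEQ_indicator_UN)
    qed
    then show "(\<Union>i. A i) \<in> \<A>" by (simp add: \<A>_def)
  qed
  then have sets\<A>: "sets (sigma UNIV \<A>) = \<A>" by (simp add: sigma_algebra.sigma_sets_eq)
  \<comment> \<open>Measurability of the identity from this sigma-algebra is just the inclusion of
    the Borel sets in \<open>\<A>\<close>; coordinatewise it reduces to half-spaces.\<close>
  have "(\<lambda>w. w) \<in> borel_measurable (sigma UNIV \<A>)"
  proof (rule measurable_coordinatewise_then_product, rule borel_measurableI_greater)
    show "{w \<in> space (sigma UNIV \<A>). t < w j} \<in> sets (sigma UNIV \<A>)" for j t
      using trig_approx_halfspace[where j=j and t=t] by (simp add: sets\<A>) (simp add: \<A>_def)
  qed
  then have "(\<lambda>w. w) -` A \<inter> space (sigma UNIV \<A>) \<in> sets (sigma UNIV \<A>)"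
    using assms by (rule measurable_sets)
  then show ?thesis by (simp add: sets\<A>) (simp add: \<A>_def)
qed

end

section \<open>The Gaussian measure and a coupling of it with itself\<close>

text \<open>Restriction to the finitely many coordinates in \<open>F\<close> carries the infinite
  product to a finite one, where integrals of products factor.\<close>

lemma
  fixes g :: "'i \<Rightarrow> 'b \<Rightarrow> 'c::{real_normed_field, banach, second_countable_topology}"
  assumes N: "prob_space N" and F: "finite F" and g: "\<And>j. j \<in> F \<Longrightarrow> integrable N (g j)"
  shows integral_PiM_prod: "(\<integral>w. (\<Prod>j\<in>F. g j (w j)) \<partial>PiM UNIV (\<lambda>_. N)) = (\<Prod>j\<in>F. \<integral>x. g j x \<partial>N)"
    and integrable_PiM_prod: "integrable (PiM UNIV (\<lambda>_. N)) (\<lambda>w. \<Prod>j\<in>F. g j (w j))"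
proof -
  interpret prob_space N by (rule N)
  interpret P: product_prob_space "\<lambda>_. N" "UNIV :: 'i set" ..
  have [measurable]: "g j \<in> borel_measurable N" if "j \<in> F" for j using g[OF that] by simp
  have m: "(\<lambda>w. \<Prod>j\<in>F. g j (w j)) \<in> borel_measurable (PiM F (\<lambda>_. N))" by measurable
  have r: "(\<lambda>x. restrict x F) \<in> measurable (PiM UNIV (\<lambda>_. N)) (PiM F (\<lambda>_. N))"
    by (rule measurable_restrict_subset) simp
  have d: "distr (PiM UNIV (\<lambda>_. N)) (PiM F (\<lambda>_. N)) (\<lambda>x. restrict x F) = PiM F (\<lambda>_. N)"
    by (rule P.distr_PiM_restrict_finite[OF F]) simp
  have e: "(\<Prod>j\<in>F. g j (restrict w F j)) = (\<Prod>j\<in>F. g j (w j))" for w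
    by (rule prod.cong) auto
  have "(\<Prod>j\<in>F. \<integral>x. g j x \<partial>N) = (\<integral>w. (\<Prod>j\<in>F. g j (w j)) \<partial>PiM F (\<lambda>_. N))"
    by (rule P.product_integral_prod[symmetric, OF F g])
  also have "\<dots> = (\<integral>w. (\<Prod>j\<in>F. g j (w j)) \<partial>PiM UNIV (\<lambda>_. N))"
    by (subst d[symmetric], subst integral_distr[OF r m]) (simp only: e)
  finally show "(\<integral>w. (\<Prod>j\<in>F. g j (w j)) \<partial>PiM UNIV (\<lambda>_. N)) = (\<Prod>j\<in>F. \<integral>x. g j x \<partial>N)" ..
  have "integrable (PiM F (\<lambda>_. N)) (\<lambda>w. \<Prod>j\<in>F. g j (w j))"
    by (rule P.product_integrable_prod[OF F g])
  then have "integrable (PiM UNIV (\<lambda>_. N)) (\<lambda>w. \<Prod>j\<in>F. g j (restrict w F j))"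
    by (subst (asm) d[symmetric], subst (asm) integrable_distr_eq[OF r m])
  then show "integrable (PiM UNIV (\<lambda>_. N)) (\<lambda>w. \<Prod>j\<in>F. g j (w j))" by (simp only: e)
qed

text \<open>The white noise of an infinite-dimensional Hilbert space, written in an orthonormal
  basis; the square summable sequences, which are the points of the Hilbert space itself, form a
  null set.\<close>

definition gauss :: "(nat \<Rightarrow> real) measure" where
  "gauss = PiM UNIV (\<lambda>_. std_normal_distribution)"

lemma prob_space_std_normal: "prob_space std_normal_distribution"
  using real_dist_normal_dist by (simp add: real_distribution_def)

lemma prob_space_gauss: "prob_space gauss"
  unfolding gauss_def by (rule prob_space_PiM) (rule prob_space_std_normal)

interpretation gauss: prob_space gauss by (rule prob_space_gauss)

lemma sets_gauss [measurable_cong]: "sets gauss = sets borel"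
proof -
  have "sets gauss = sets (PiM UNIV (\<lambda>_::nat. borel :: real measure))"
    unfolding gauss_def by (intro sets_PiM_cong) auto
  then show ?thesis by (simp add: sets_PiM_equal_borel)
qed

lemma space_gauss [simp]: "space gauss = UNIV"
  using sets_eq_imp_space_eq[OF sets_gauss] by simp

lemma gauss_iexp_linear:
  "integrable gauss (\<lambda>w. iexp (lin a n w))"
  "(\<integral>w. iexp (lin a n w) \<partial>gauss) = complex_of_real (exp (- (\<Sum>j<n. (a j)\<^sup>2) / 2))"
proof -
  have prod: "iexp (lin a n w) = (\<Prod>j<n. iexp (a j * w j))" for w :: "nat \<Rightarrow> real"
    by (simp add: exp_sum[symmetric] sum_distrib_left)
  have int: "integrable std_normal_distribution (\<lambda>x. iexp (t * x))" for t
    by (rule finite_measure.integrable_const_bound[OF prob_space.finite_measure[OF prob_space_std_normal], of _ 1])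
      auto
  have char: "(\<integral>x. iexp (t * x) \<partial>std_normal_distribution) = complex_of_real (exp (- t\<^sup>2 / 2))" for t
    using char_std_normal_distribution[THEN fun_cong, of t] by (simp add: char_def)
  show "integrable gauss (\<lambda>w. iexp (lin a n w))"
    unfolding prod gauss_def
    by (rule integrable_PiM_prod[OF prob_space_std_normal, where g="\<lambda>j x. iexp (a j * x)"]) (simp_all only: finite_lessThan int)
  have "(\<integral>w. iexp (lin a n w) \<partial>gauss) = (\<Prod>j<n. \<integral>x. iexp (a j * x) \<partial>std_normal_distribution)"
    unfolding prod gauss_def
    by (rule integral_PiM_prod[OF prob_space_std_normal, where g="\<lambda>j x. iexp (a j * x)"]) (simp_all only: finite_lessThan int)
  also have "\<dots> = complex_of_real (\<Prod>j<n. exp (- (a j)\<^sup>2 / 2))" by (simp only: char of_real_prod)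
  also have "(\<Prod>j<n. exp (- (a j)\<^sup>2 / 2)) = exp (- (\<Sum>j<n. (a j)\<^sup>2) / 2)"
    by (simp add: exp_sum[symmetric] sum_divide_distrib sum_negf)
  finally show "(\<integral>w. iexp (lin a n w) \<partial>gauss) = complex_of_real (exp (- (\<Sum>j<n. (a j)\<^sup>2) / 2))" .
qed

text \<open>The characteristic function is real, so the phase contributes only the factor
  \<open>cos b\<close>. Apart from it the integral is determined by the variance; the later
  comparisons of laws rest on this.\<close>

lemma gauss_cos_linear:
  "(\<integral>w. cos (lin a n w + b) \<partial>gauss) = cos b * exp (- (\<Sum>j<n. (a j)\<^sup>2) / 2)"
proof -
  have "cos (s + b) = Re (iexp b * iexp s)" for s
    by (simp add: exp_add[symmetric] Re_exp cos_add)
  then have "(\<integral>w. cos (lin a n w + b) \<partial>gauss) = (\<integral>w. Re (iexp b * iexp (lin a n w)) \<partial>gauss)"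
    by (simp only:)
  also have "\<dots> = Re (\<integral>w. iexp b * iexp (lin a n w) \<partial>gauss)"
    by (rule integral_Re) (rule integrable_mult_right[OF gauss_iexp_linear(1)])
  also have "\<dots> = Re (iexp b * complex_of_real (exp (- (\<Sum>j<n. (a j)\<^sup>2) / 2)))"
    by (simp only: integral_mult_right_zero gauss_iexp_linear(2))
  also have "\<dots> = cos b * exp (- (\<Sum>j<n. (a j)\<^sup>2) / 2)" by (simp add: Re_exp)
  finally show ?thesis .
qed

lemma gauss_mult:
  "integrable gauss (\<lambda>w. w i * w j)"
  "(\<integral>w. w i * w j \<partial>gauss) = (if i = j then 1 else 0)"
proof -
  note int = integrable_std_normal_distribution_moment
  have "integrable gauss (\<lambda>w. w i * w j) \<and> (\<integral>w. w i * w j \<partial>gauss) = (if i = j then 1 else 0)"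
  proof (cases "i = j")
    case True
    have "integrable gauss (\<lambda>w. \<Prod>k\<in>{i}. (w k)\<^sup>2)"
      "(\<integral>w. (\<Prod>k\<in>{i}. (w k)\<^sup>2) \<partial>gauss) = (\<Prod>k\<in>{i}. \<integral>x. x\<^sup>2 \<partial>std_normal_distribution)"
      unfolding gauss_def
      by (rule integrable_PiM_prod[OF prob_space_std_normal, where g="\<lambda>_ x. x\<^sup>2"]
          integral_PiM_prod[OF prob_space_std_normal, where g="\<lambda>_ x. x\<^sup>2"]; simp add: int)+
    then show ?thesis using True std_normal_distribution_even_moments(1)[of 1]
      by (simp add: power2_eq_square)
  next
    case False
    have "integrable gauss (\<lambda>w. \<Prod>k\<in>{i,j}. (w k)^1)"
      "(\<integral>w. (\<Prod>k\<in>{i,j}. (w k)^1) \<partial>gauss) = (\<Prod>k\<in>{i,j}. \<integral>x. x^1 \<partial>std_normal_distribution)"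
      unfolding gauss_def
      by (rule integrable_PiM_prod[OF prob_space_std_normal, where g="\<lambda>_ x. x^1"]
          integral_PiM_prod[OF prob_space_std_normal, where g="\<lambda>_ x. x^1"]; simp only: int finite.intros)+
    then show ?thesis using False integral_std_normal_distribution_moment_odd[of 1] by simp
  qed
  then show "integrable gauss (\<lambda>w. w i * w j)"
    "(\<integral>w. w i * w j \<partial>gauss) = (if i = j then 1 else 0)" by blast+
qed

lemma gauss_linear_square:
  "integrable gauss (\<lambda>w. (lin a n w)\<^sup>2)"
  "(\<integral>w. (lin a n w)\<^sup>2 \<partial>gauss) = (\<Sum>j<n. (a j)\<^sup>2)"
proof -
  have eq: "(lin a n w)\<^sup>2 = (\<Sum>i<n. \<Sum>j<n. (a i * a j) * (w i * w j))" for w :: "nat \<Rightarrow> real"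
    by (simp add: power2_eq_square sum_product mult_ac)
  show "integrable gauss (\<lambda>w. (lin a n w)\<^sup>2)"
    unfolding eq by (intro Bochner_Integration.integrable_sum integrable_mult_right gauss_mult)
  have "(\<integral>w. (lin a n w)\<^sup>2 \<partial>gauss) = (\<Sum>i<n. \<Sum>j<n. (a i * a j) * (if i = j then 1 else 0))"
    unfolding eq
    by (simp only: Bochner_Integration.integral_sum Bochner_Integration.integrable_sum
        integrable_mult_right gauss_mult integral_mult_right_zero)
  also have "\<dots> = (\<Sum>j<n. (a j)\<^sup>2)"
    by (intro sum.cong refl) (simp add: power2_eq_square if_distrib cong: if_cong)
  finally show "(\<integral>w. (lin a n w)\<^sup>2 \<partial>gauss) = (\<Sum>j<n. (a j)\<^sup>2)" .
qed

lemma gauss_linear_abs: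
  "integrable gauss (\<lambda>w. \<Sum>j<n. a j * w j)"
  "(\<integral>w. \<bar>\<Sum>j<n. a j * w j\<bar> \<partial>gauss) \<le> sqrt (\<Sum>j<n. (a j)\<^sup>2)"
proof -
  have "integrable gauss (\<lambda>w. w j)" for j
    unfolding gauss_def
    using integrable_PiM_prod[OF prob_space_std_normal, of "{j}" "\<lambda>_ x. x^1"] integrable_std_normal_distribution_moment[of 1]
    by simp
  then show int: "integrable gauss (\<lambda>w. \<Sum>j<n. a j * w j)"
    by (intro Bochner_Integration.integrable_sum integrable_mult_right)
  define c where "c = sqrt (\<Sum>j<n. (a j)\<^sup>2)"
  have c2: "c\<^sup>2 = (\<Sum>j<n. (a j)\<^sup>2)" and c0: "0 \<le> c"
    by (simp_all add: c_def sum_nonneg)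
  show "(\<integral>w. \<bar>\<Sum>j<n. a j * w j\<bar> \<partial>gauss) \<le> sqrt (\<Sum>j<n. (a j)\<^sup>2)"
  proof (cases "c = 0")
    case True
    then have "\<And>j. j < n \<Longrightarrow> a j = 0" using c2 by (simp add: sum_nonneg_eq_0_iff)
    then have "lin a n w = 0" for w :: "nat \<Rightarrow> real" by (intro sum.neutral) auto
    then show ?thesis by (simp add: sum_nonneg)
  next
    case False
    with c0 have c: "c > 0" by simp
    \<comment> \<open>With \<open>c\<close> the standard deviation this is
      \<open>2 * c * \<bar>s\<bar> \<le> s^2 + c^2\<close>. Integration gives
      \<open>c / 2 + c / 2\<close>, so the mean absolute value is at most the standard
      deviation.\<close>
    have "\<bar>s\<bar> \<le> (1 / (2 * c)) * s\<^sup>2 + c / 2" for s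
    proof -
      have "0 \<le> (\<bar>s\<bar> - c)\<^sup>2" by simp
      then have "2 * c * \<bar>s\<bar> \<le> s\<^sup>2 + c\<^sup>2" by (simp add: power2_diff mult_ac)
      then show ?thesis using c by (simp add: field_simps power2_eq_square)
    qed
    then have "(\<integral>w. \<bar>\<Sum>j<n. a j * w j\<bar> \<partial>gauss) \<le> (\<integral>w. (1 / (2 * c)) * (lin a n w)\<^sup>2 + c / 2 \<partial>gauss)"
      using int gauss_linear_square(1)[of a n] by (intro integral_mono) auto
    also have "\<dots> = (1 / (2 * c)) * c\<^sup>2 + c / 2"
      using gauss_linear_square[of a n] by (simp add: c2 gauss.prob_space[unfolded space_gauss])
    also have "\<dots> = c" using c by (simp add: power2_eq_square)
    finally show ?thesis by (simp add: c_def)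
  qed
qed

text \<open>Comparing two measures calls for a single polynomial that approximates a set in both of
  them; an approximation in mean for a common upper bound provides it. The lattice supremum is such
  a bound, and it is finite because it lies below the sum.\<close>

lemma finite_measure_dominating:
  assumes fin: "finite_measure \<mu>" "finite_measure \<nu>" and sets: "sets \<nu> = sets \<mu>"
  obtains \<theta> where "finite_measure \<theta>" "sets \<theta> = sets \<mu>" "\<mu> \<le> \<theta>" "\<nu> \<le> \<theta>"
proof
  let ?\<theta> = "sup_measure' \<mu> \<nu>"
  show s: "sets ?\<theta> = sets \<mu>" using sets by simp
  have sp: "space ?\<theta> = space \<mu>" "space \<nu> = space \<mu>"
    using s sets by (auto dest: sets_eq_imp_space_eq)
  have "emeasure ?\<theta> (space \<mu>) \<le> emeasure \<mu> (space \<mu>) + emeasure \<nu> (space \<mu>)"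
    by (subst emeasure_sup_measure'[OF sets]) (auto intro!: SUP_least add_mono emeasure_mono simp: sets dest: sets.sets_into_space)
  also have "\<dots> < \<infinity>"
    using finite_measure.emeasure_finite[OF fin(1), of "space \<mu>"] finite_measure.emeasure_finite[OF fin(2), of "space \<mu>"]
    by (simp add: top.not_eq_extremum)
  finally show "finite_measure ?\<theta>" by (intro finite_measureI) (simp add: sp)
  show "\<mu> \<le> ?\<theta>" "\<nu> \<le> ?\<theta>"
    using le_emeasure_sup_measure'1[OF sets] le_emeasure_sup_measure'2[OF sets] s sp sets
    by (auto simp: le_measure_iff le_fun_def emeasure_notin_sets intro: emeasure_notin_sets)
      (metis emeasure_notin_sets order_refl s sets le_emeasure_sup_measure'1 le_emeasure_sup_measure'2)+
qed

lemma integral_mono_measure_nonneg: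
  fixes f :: "'b \<Rightarrow> real"
  assumes "\<mu> \<le> \<theta>" "sets \<mu> = sets \<theta>" "integrable \<theta> f" "\<And>x. 0 \<le> f x"
  shows "(\<integral>x. f x \<partial>\<mu>) \<le> (\<integral>x. f x \<partial>\<theta>)"
proof -
  have [measurable]: "f \<in> borel_measurable \<theta>" "f \<in> borel_measurable \<mu>"
    using assms(3) measurable_cong_sets[OF assms(2) refl] by auto
  have "(\<integral>\<^sup>+x. ennreal (f x) \<partial>\<mu>) \<le> (\<integral>\<^sup>+x. ennreal (f x) \<partial>\<theta>)"
    by (rule nn_integral_mono_measure[OF assms(2,1)])
  moreover have "(\<integral>\<^sup>+x. ennreal (f x) \<partial>\<theta>) < \<infinity>"
    using nn_integral_eq_integral[OF assms(3)] assms(4) by simp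
  ultimately show ?thesis
    using assms(4) by (simp add: integral_eq_nn_integral enn2real_mono)
qed

lemma integrable_trig_poly:
  assumes "finite_measure \<mu>" "sets \<mu> = sets borel" "trig_poly P"
  shows "integrable \<mu> P"
proof -
  obtain B where "\<And>w. \<bar>P w\<bar> \<le> B" using trig_poly_bounded[OF assms(3)] by blast
  then show ?thesis
    by (rule integrable_bounded_borel[OF assms(1,2) trig_poly_measurable[OF assms(3)]])
qed

text \<open>The analogue of Cramer-Wold and Levy uniqueness for sequences, obtained from density of
  trigonometric polynomials instead of inversion.\<close>

lemma borel_measure_eqI_cos:
  fixes \<mu> \<nu> :: "(nat \<Rightarrow> real) measure"
  assumes fin: "finite_measure \<mu>" "finite_measure \<nu>" and sets: "sets \<mu> = sets borel" "sets \<nu> = sets borel"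
    and cos: "\<And>n a b. (\<integral>w. cos (lin a n w + b) \<partial>\<mu>) = (\<integral>w. cos (lin a n w + b) \<partial>\<nu>)"
  shows "\<mu> = \<nu>"
proof (rule measure_eqI)
  show "sets \<mu> = sets \<nu>" using sets by simp
  fix A assume "A \<in> sets \<mu>"
  then have A: "A \<in> sets borel" using sets by simp
  have trig: "(\<integral>w. P w \<partial>\<mu>) = (\<integral>w. P w \<partial>\<nu>)" if "trig_poly P" for P
    using that
  proof (induction P rule: trig_poly.induct)
    case (add P Q)
    then show ?case
      using integrable_trig_poly[OF fin(1) sets(1)] integrable_trig_poly[OF fin(2) sets(2)] by simp
  qed (simp_all add: cos)
  obtain \<theta> where \<theta>: "finite_measure \<theta>" "sets \<theta> = sets \<mu>" "\<mu> \<le> \<theta>" "\<nu> \<le> \<theta>"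
    using finite_measure_dominating[OF fin] sets by metis
  have s\<theta>: "sets \<theta> = sets borel" using \<theta>(2) sets by simp
  have apx: "trig_approx \<theta> (indicator A)" by (rule trig_poly_dense[OF \<theta>(1) s\<theta> A])
  have "\<bar>measure \<mu> A - measure \<nu> A\<bar> \<le> \<epsilon>" if e: "\<epsilon> > 0" for \<epsilon>
  proof -
    obtain P where P: "trig_poly P" "L1_dist \<theta> (indicator A) P < \<epsilon> / 2"
      using trig_approxD[OF apx half_gt_zero[OF e]] by blast
    have *: "\<bar>measure \<kappa> A - (\<integral>w. P w \<partial>\<kappa>)\<bar> \<le> \<epsilon> / 2"
      if k: "finite_measure \<kappa>" "sets \<kappa> = sets borel" "\<kappa> \<le> \<theta>" for \<kappa>
    proof -
      interpret finite_measure \<kappa> by (rule k(1))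
      have iA: "integrable \<kappa> (indicator A :: _ \<Rightarrow> real)"
        using A k(2) by (intro integrable_bounded_borel[OF k(1,2), of _ 1]) auto
      have iP: "integrable \<kappa> P" by (rule integrable_trig_poly[OF k(1,2) P(1)])
      have "measure \<kappa> A - (\<integral>w. P w \<partial>\<kappa>) = (\<integral>w. indicator A w - P w \<partial>\<kappa>)"
        using iA iP A k(2) by simp
      also have "\<bar>\<dots>\<bar> \<le> L1_dist \<kappa> (indicator A) P" by (rule integral_abs_bound)
      also have "\<dots> \<le> L1_dist \<theta> (indicator A) P"
        using k(2,3) s\<theta>
        by (intro integral_mono_measure_nonneg integrable_abs integrable_diff_trig_poly[OF \<theta>(1) s\<theta> apx P(1)]) auto
      finally show ?thesis using P(2) by simp
    qed
    show ?thesis using *[OF fin(1) sets(1) \<theta>(3)] *[OF fin(2) sets(2) \<theta>(4)] trig[OF P(1)] by linarith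
  qed
  then have "\<bar>measure \<mu> A - measure \<nu> A\<bar> \<le> 0" by (rule field_le_epsilon[of _ 0, simplified])
  then show "emeasure \<mu> A = emeasure \<nu> A"
    using fin by (simp add: finite_measure.emeasure_eq_measure)
qed

section \<open>The coupling of two Gaussian points\<close>

interpretation gauss_pair: pair_prob_space gauss gauss ..

abbreviation "gauss2 \<equiv> gauss \<Otimes>\<^sub>M gauss"

lemma gauss2_measurable_component [measurable]:
  "(\<lambda>z. fst z j) \<in> borel_measurable gauss2" "(\<lambda>z. snd z j) \<in> borel_measurable gauss2"
  by measurable

lemma gauss2_cos_linear:
  "(\<integral>z. cos (lin a n (fst z) + lin b n (snd z) + c) \<partial>gauss2) =
     cos c * exp (- (\<Sum>j<n. (a j)\<^sup>2 + (b j)\<^sup>2) / 2)"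
proof -
  have int: "integrable gauss2 (\<lambda>z. cos (lin a n (fst z) + lin b n (snd z) + c))"
    by (rule gauss_pair.P.integrable_const_bound[of _ 1]) auto
  have "(\<integral>z. cos (lin a n (fst z) + lin b n (snd z) + c) \<partial>gauss2)
    = (\<integral>x. (\<integral>y. cos (lin b n y + (lin a n x + c)) \<partial>gauss) \<partial>gauss)"
    by (subst gauss_pair.integral_fst'[OF int, symmetric]) (simp add: add_ac)
  also have "\<dots> = cos c * exp (- (\<Sum>j<n. (a j)\<^sup>2) / 2) * exp (- (\<Sum>j<n. (b j)\<^sup>2) / 2)"
    by (simp add: gauss_cos_linear)
  also have "\<dots> = cos c * exp (- (\<Sum>j<n. (a j)\<^sup>2 + (b j)\<^sup>2) / 2)"
    by (simp add: exp_add[symmetric] sum.distrib add_divide_distrib)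
  finally show ?thesis .
qed

text \<open>With \<open>\<rho>^2 + \<sigma>^2 = 1\<close>, the value \<open>n = 0\<close> gives the
  limit law, in which each coordinate has correlation \<open>\<rho>\<close> with the same coordinate
  of the first point. In general the coordinates below \<open>n\<close> have already been decoupled
  from the first point.\<close>

definition mix :: "real \<Rightarrow> real \<Rightarrow> nat \<Rightarrow> (nat \<Rightarrow> real) \<times> (nat \<Rightarrow> real) \<Rightarrow> nat \<Rightarrow> real" where
  "mix \<rho> \<sigma> n z = (\<lambda>j. if j < n then snd z j else \<rho> * fst z j + \<sigma> * snd z j)"

lemma measurable_mix [measurable]: "mix \<rho> \<sigma> n \<in> borel_measurable gauss2"
  unfolding mix_def by (rule measurable_coordinatewise_then_product) measurable

text \<open>The exponent is the variance of the Gaussian variable inside the cosine. The correlation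
  enters through the mixed term \<open>2 * \<rho> * a j * b j\<close>; the same quadratic form will
  come out of the action.\<close>

lemma gauss2_mix_cos:
  assumes "\<rho>\<^sup>2 + \<sigma>\<^sup>2 = 1"
  shows "(\<integral>z. cos (lin a n (fst z) + lin b n (mix \<rho> \<sigma> 0 z) + c) \<partial>gauss2) =
     cos c * exp (- (\<Sum>j<n. (a j)\<^sup>2 + (b j)\<^sup>2 + 2 * \<rho> * a j * b j) / 2)"
proof -
  have e: "lin a n (fst z) + lin b n (mix \<rho> \<sigma> 0 z) =
    (\<Sum>j<n. (a j + \<rho> * b j) * fst z j) + (\<Sum>j<n. (\<sigma> * b j) * snd z j)" for z
    by (simp add: mix_def algebra_simps sum.distrib)
  have "(a j + \<rho> * b j)\<^sup>2 + (\<sigma> * b j)\<^sup>2 = (a j)\<^sup>2 + (b j)\<^sup>2 + 2 * \<rho> * a j * b j" for j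
  proof -
    have "(a j + \<rho> * b j)\<^sup>2 + (\<sigma> * b j)\<^sup>2 = (a j)\<^sup>2 + (\<rho>\<^sup>2 + \<sigma>\<^sup>2) * (b j)\<^sup>2 + 2 * \<rho> * a j * b j"
      by (simp add: power2_eq_square algebra_simps)
    then show ?thesis by (simp add: assms)
  qed
  then show ?thesis unfolding e by (subst gauss2_cos_linear) simp
qed

text \<open>Rotation invariance in each coordinate: \<open>\<rho> * s + \<sigma> * t\<close> with
  independent standard normal \<open>s\<close> and \<open>t\<close> is again standard normal. So the
  decoupling leaves the law of the second point unchanged at every stage.\<close>

lemma distr_mix:
  assumes "\<rho>\<^sup>2 + \<sigma>\<^sup>2 = 1"
  shows "distr gauss2 borel (mix \<rho> \<sigma> n) = gauss"
proof (rule borel_measure_eqI_cos)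
  show "finite_measure (distr gauss2 borel (mix \<rho> \<sigma> n))"
    by (rule prob_space.finite_measure, rule gauss_pair.P.prob_space_distr) measurable
  show "finite_measure gauss" by (rule gauss.finite_measure_axioms)
  fix m :: nat and a :: "nat \<Rightarrow> real" and b :: real
  let ?p = "\<lambda>j. if j < n then 0 else \<rho> * a j" and ?q = "\<lambda>j. if j < n then a j else \<sigma> * a j"
  have e: "lin a m (mix \<rho> \<sigma> n z) = lin ?p m (fst z) + lin ?q m (snd z)" for z
    unfolding sum.distrib[symmetric] by (rule sum.cong) (auto simp: mix_def algebra_simps)
  have "(\<integral>w. cos (lin a m w + b) \<partial>distr gauss2 borel (mix \<rho> \<sigma> n)) =
    (\<integral>z. cos (lin ?p m (fst z) + lin ?q m (snd z) + b) \<partial>gauss2)"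
    by (subst integral_distr[OF measurable_mix]) (simp_all only: e, measurable)
  also have "\<dots> = cos b * exp (- (\<Sum>j<m. (?p j)\<^sup>2 + (?q j)\<^sup>2) / 2)" by (rule gauss2_cos_linear)
  also have "(\<Sum>j<m. (?p j)\<^sup>2 + (?q j)\<^sup>2) = (\<Sum>j<m. (a j)\<^sup>2)"
  proof (intro sum.cong refl)
    fix j
    have "(\<rho> * a j)\<^sup>2 + (\<sigma> * a j)\<^sup>2 = (\<rho>\<^sup>2 + \<sigma>\<^sup>2) * (a j)\<^sup>2" by (simp add: power_mult_distrib distrib_right)
    then show "(?p j)\<^sup>2 + (?q j)\<^sup>2 = (a j)\<^sup>2" using assms by simp
  qed
  finally show "(\<integral>w. cos (lin a m w + b) \<partial>distr gauss2 borel (mix \<rho> \<sigma> n)) =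
    (\<integral>w. cos (lin a m w + b) \<partial>gauss)" by (simp only: gauss_cos_linear)
qed (simp_all add: sets_gauss)

interpretation normal_gauss: pair_prob_space std_normal_distribution gauss
  by (intro pair_prob_space.intro pair_sigma_finite.intro prob_space_std_normal prob_space_gauss
      prob_space_imp_sigma_finite)

text \<open>Coordinate \<open>n\<close> is independent of the others, so redrawing it leaves the law
  unchanged; Fubini then allows the redrawn coordinate to be quantified innermost.\<close>

lemma AE_gauss_fun_upd:
  assumes [measurable]: "Measurable.pred borel Q"
  shows "(AE y in gauss. Q y) \<longleftrightarrow> (AE y in gauss. AE t in std_normal_distribution. Q (y(n := t)))"
proof -
  have m [measurable]: "(\<lambda>p. (snd p)(n := fst p)) \<in> measurable (std_normal_distribution \<Otimes>\<^sub>M gauss) gauss"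
    unfolding measurable_cong_sets[OF refl sets_gauss] fun_upd_def
    by (rule measurable_coordinatewise_then_product) measurable
  have "(\<lambda>p. (snd p)(n := fst p)) \<in> borel_measurable (std_normal_distribution \<Otimes>\<^sub>M gauss)"
    using m unfolding measurable_cong_sets[OF refl sets_gauss] .
  from predE[OF measurable_compose[OF this assms]]
  have mQ: "{p \<in> space (std_normal_distribution \<Otimes>\<^sub>M gauss). Q ((snd p)(n := fst p))}
    \<in> sets (std_normal_distribution \<Otimes>\<^sub>M gauss)" .
  \<comment> \<open>Inserting \<open>n\<close> into \<open>UNIV\<close> changes nothing, so the
    product over the enlarged index set is \<open>gauss\<close> again.\<close>
  have D: "distr (std_normal_distribution \<Otimes>\<^sub>M gauss) gauss (\<lambda>p. (snd p)(n := fst p)) = gauss"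
    using distr_pair_PiM_eq_PiM[of UNIV "\<lambda>_. std_normal_distribution" n] prob_space_std_normal
    by (simp add: gauss_def case_prod_unfold insert_absorb)
  have "(AE y in gauss. Q y) \<longleftrightarrow>
      (AE y in distr (std_normal_distribution \<Otimes>\<^sub>M gauss) gauss (\<lambda>p. (snd p)(n := fst p)). Q y)"
    unfolding D ..
  also have "\<dots> \<longleftrightarrow> (AE p in std_normal_distribution \<Otimes>\<^sub>M gauss. Q ((snd p)(n := fst p)))"
    by (rule AE_distr_iff[OF m], rule predE) (use assms in measurable)
  also have "\<dots> \<longleftrightarrow> (AE t in std_normal_distribution. AE y in gauss. Q (y(n := t)))"
    by (rule normal_gauss.AE_pair_iff[symmetric, OF mQ])
  also have "\<dots> \<longleftrightarrow> (AE y in gauss. AE t in std_normal_distribution. Q (y(n := t)))"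
    by (rule normal_gauss.AE_commute[OF mQ])
  finally show ?thesis .
qed

text \<open>The normal law has the same null sets as Lebesgue measure, and these are invariant under
  nondegenerate affine maps.\<close>

lemma AE_std_normal_affine:
  fixes R :: "real \<Rightarrow> bool"
  assumes [measurable]: "Measurable.pred borel R" and "\<sigma> \<noteq> 0"
    and "AE t in std_normal_distribution. R (c + \<sigma> * t)"
  shows "AE t in std_normal_distribution. R t"
proof -
  have iff: "(AE t in std_normal_distribution. P t) \<longleftrightarrow> (AE t in lborel. P t)" for P :: "real \<Rightarrow> bool"
    by (subst AE_density) (auto simp: std_normal_density_def)
  have "AE t in lborel. R (c + \<sigma> * t)" using assms(3) by (simp only: iff)
  then have "AE t in lborel. R (c + \<sigma> * (- c / \<sigma> + (1 / \<sigma>) * t))"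
    using assms(2) by (intro AE_borel_affine[where P="\<lambda>t. R (c + \<sigma> * t)"]) (simp_all, measurable)
  then show ?thesis using assms(2) by (simp add: iff field_simps)
qed

text \<open>Stages \<open>n\<close> and \<open>Suc n\<close> differ in coordinate \<open>n\<close>
  only: \<open>\<rho> * x n + \<sigma> * t\<close> against \<open>t\<close>, with everything else
  fixed. As \<open>\<sigma> \<noteq> 0\<close>, the laws of both have the null sets of Lebesgue
  measure.\<close>

lemma AE_mix_Suc:
  assumes [measurable]: "Measurable.pred (borel \<Otimes>\<^sub>M borel) (\<lambda>p. Q (fst p) (snd p))" and \<sigma>: "\<sigma> \<noteq> 0"
    and AE: "AE z in gauss2. Q (fst z) (mix \<rho> \<sigma> n z)"
  shows "AE z in gauss2. Q (fst z) (mix \<rho> \<sigma> (Suc n) z)"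
proof -
  have mQ [measurable]: "Measurable.pred M (\<lambda>x. Q (f x) (g x))"
    if [measurable]: "f \<in> borel_measurable M" "g \<in> borel_measurable M" for M :: "'c measure" and f g
    using measurable_compose[OF measurable_Pair[OF that] assms(1)] by simp
  have mm [measurable]: "(\<lambda>y. mix \<rho> \<sigma> m (x, y)) \<in> borel_measurable borel" for x m
    unfolding mix_def by (rule measurable_coordinatewise_then_product) measurable
  have split: "(AE z in gauss2. Q (fst z) (mix \<rho> \<sigma> m z)) \<longleftrightarrow>
    (AE x in gauss. AE y in gauss. AE t in std_normal_distribution. Q x (mix \<rho> \<sigma> m (x, y(n := t))))" for m
  proof -
    have "(AE z in gauss2. Q (fst z) (mix \<rho> \<sigma> m z)) \<longleftrightarrow> (AE x in gauss. AE y in gauss. Q x (mix \<rho> \<sigma> m (x, y)))"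
      by (subst gauss_pair.AE_pair_iff) (simp_all, measurable)
    also have "\<dots> \<longleftrightarrow> (AE x in gauss. AE y in gauss. AE t in std_normal_distribution. Q x (mix \<rho> \<sigma> m (x, y(n := t))))"
    proof -
      have "Measurable.pred borel (\<lambda>y. Q x (mix \<rho> \<sigma> m (x, y)))" for x
        by (rule mQ[OF measurable_const mm]) simp
      from AE_gauss_fun_upd[OF this, where n=n] show ?thesis by (simp only:)
    qed
    finally show ?thesis .
  qed
  have "AE t in std_normal_distribution. Q x (mix \<rho> \<sigma> (Suc n) (x, y(n := t)))"
    if "AE t in std_normal_distribution. Q x (mix \<rho> \<sigma> n (x, y(n := t)))" for x y
  proof -
    have e: "mix \<rho> \<sigma> (Suc n) (x, y(n := t)) = (mix \<rho> \<sigma> n (x, y))(n := t)"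
      "mix \<rho> \<sigma> n (x, y(n := t)) = (mix \<rho> \<sigma> n (x, y))(n := \<rho> * x n + \<sigma> * t)" for t
      by (auto simp: mix_def fun_eq_iff)
    have [measurable]: "(\<lambda>t. (mix \<rho> \<sigma> n (x, y))(n := t)) \<in> borel_measurable borel"
      unfolding fun_upd_def by (rule measurable_coordinatewise_then_product) measurable
    show ?thesis
      unfolding e
    proof (rule AE_std_normal_affine[OF _ \<sigma>])
      show "Measurable.pred borel (\<lambda>t. Q x ((mix \<rho> \<sigma> n (x, y))(n := t)))"
        by (rule mQ) measurable
      show "AE t in std_normal_distribution. Q x ((mix \<rho> \<sigma> n (x, y))(n := \<rho> * x n + \<sigma> * t))"
        using that unfolding e .
    qed
  qed
  note step = this
  show ?thesis
    using AE unfolding split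
    by (rule eventually_mono) (erule eventually_mono, erule step)
qed

text \<open>\<open>C\<close> is a superlevel set of a trigonometric polynomial close to the
  indicator of \<open>A\<close>; it inherits the dependence on finitely many coordinates, and the
  threshold \<open>1 / 2\<close> lies midway between the two values of the indicator.\<close>

lemma gauss_cylinder_approx:
  assumes A: "A \<in> sets borel" and e: "\<epsilon> > 0"
  shows "\<exists>n C. C \<in> sets borel \<and> (\<forall>x y. (\<forall>j<n. x j = y j) \<longrightarrow> (x \<in> C \<longleftrightarrow> y \<in> C)) \<and>
    measure gauss (sym_diff A C) < \<epsilon>"
proof -
  have fg: "finite_measure gauss" by (rule gauss.finite_measure_axioms)
  have apx: "trig_approx gauss (indicator A)" by (rule trig_poly_dense[OF fg sets_gauss A])
  obtain P where P: "trig_poly P" "L1_dist gauss (indicator A) P < \<epsilon> / 2"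
    using trig_approxD[OF apx half_gt_zero[OF e]] by blast
  define C where "C = {w. P w > 1 / 2}"
  have mP [measurable]: "P \<in> borel_measurable borel" by (rule trig_poly_measurable[OF P(1)])
  have C: "C \<in> sets borel" unfolding C_def by measurable
  obtain n L where L: "\<And>x y. \<bar>P x - P y\<bar> \<le> L * (\<Sum>j<n. \<bar>x j - y j\<bar>)"
    using trig_poly_lipschitz[OF P(1)] by blast
  have dep: "x \<in> C \<longleftrightarrow> y \<in> C" if "\<And>j. j < n \<Longrightarrow> x j = y j" for x y
    using L[of x y] that by (simp add: C_def)
  have "measure gauss (sym_diff A C) = (\<integral>w. indicator (sym_diff A C) w \<partial>gauss)"
    using A C by (simp add: sets_gauss)
  also have "\<dots> \<le> (\<integral>w. 2 * \<bar>indicator A w - P w\<bar> \<partial>gauss)"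
  proof (rule integral_mono)
    show "integrable gauss (indicator (sym_diff A C) :: _ \<Rightarrow> real)"
      using A C by (intro integrable_bounded_borel[OF fg sets_gauss, of _ 1]) auto
    show "integrable gauss (\<lambda>w. 2 * \<bar>indicator A w - P w\<bar>)"
      by (intro integrable_mult_right integrable_abs integrable_diff_trig_poly[OF fg sets_gauss apx P(1)])
    \<comment> \<open>Where \<open>A\<close> and \<open>C\<close> disagree, \<open>P\<close> is on
      the wrong side of \<open>1 / 2\<close>, at distance at least \<open>1 / 2\<close> from the
      indicator; hence the factor 2.\<close>
    show "indicator (sym_diff A C) w \<le> 2 * \<bar>indicator A w - P w\<bar>" for w
      by (auto simp: indicator_def C_def)
  qed
  also have "\<dots> < \<epsilon>" using P(2) by simp
  finally have small: "measure gauss (sym_diff A C) < \<epsilon>" .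
  show ?thesis using C dep small by blast
qed

text \<open>Changing finitely many coordinates of the coupling to independent ones preserves null sets,
  and for cylinders over these coordinates positivity is then evident.\<close>

proposition gauss_coupling_pos:
  assumes \<rho>\<sigma>: "\<rho>\<^sup>2 + \<sigma>\<^sup>2 = 1" "\<sigma> \<noteq> 0" and A: "A \<in> sets borel" and B: "B \<in> sets borel"
    and pos: "measure gauss A > 0" "measure gauss B > 0"
  shows "measure gauss2 {z. fst z \<in> A \<and> mix \<rho> \<sigma> 0 z \<in> B} > 0"
proof (rule ccontr)
  note [measurable] = A B
  define E where "E n = {z. fst z \<in> A \<and> mix \<rho> \<sigma> n z \<in> B}" for n
  have sp: "space gauss2 = UNIV" by (simp add: space_pair_measure)
  have E [measurable]: "E n \<in> sets gauss2" for n
  proof -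
    have "{z \<in> space gauss2. fst z \<in> A \<and> mix \<rho> \<sigma> n z \<in> B} \<in> sets gauss2" by measurable
    then show ?thesis by (simp add: sp E_def)
  qed
  assume "\<not> ?thesis"
  then have "measure gauss2 (E 0) = 0" by (simp add: E_def zero_less_measure_iff)
  have null: "AE z in gauss2. \<not> (fst z \<in> A \<and> mix \<rho> \<sigma> n z \<in> B)" for n
  proof (induction n)
    case 0
    have "E 0 \<in> null_sets gauss2"
      using \<open>measure gauss2 (E 0) = 0\<close> by (simp add: gauss_pair.P.emeasure_eq_measure null_sets_def)
    then show ?case by (auto simp: E_def dest: AE_not_in)
  next
    case (Suc n)
    show ?case
      by (rule AE_mix_Suc[where Q="\<lambda>x y. \<not> (x \<in> A \<and> y \<in> B)", OF _ \<rho>\<sigma>(2) Suc.IH]) measurable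
  qed
  \<comment> \<open>With this choice \<open>measure gauss A * (measure gauss B - \<epsilon>)\<close>
    is at least \<open>\<epsilon>\<close>, whereas the estimates below force it under
    \<open>\<epsilon>\<close>.\<close>
  define \<epsilon> where "\<epsilon> = measure gauss A * measure gauss B / 2"
  have e: "\<epsilon> > 0" using pos by (simp add: \<epsilon>_def)
  obtain n D where D: "D \<in> sets borel" "\<forall>x y. (\<forall>j<n. x j = y j) \<longrightarrow> (x \<in> D \<longleftrightarrow> y \<in> D)"
    and D': "measure gauss (sym_diff B D) < \<epsilon>"
    using gauss_cylinder_approx[OF B e] by blast
  note [measurable] = D(1)
  have "measure gauss B \<le> measure gauss (D \<union> sym_diff B D)"
    by (rule gauss.finite_measure_mono) auto
  also have "\<dots> \<le> measure gauss D + measure gauss (sym_diff B D)"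
    by (rule measure_Un_le) auto
  finally have Dge: "measure gauss B - \<epsilon> < measure gauss D" using D' by linarith
  have "measure gauss A * measure gauss D = measure gauss2 (A \<times> D)"
    using gauss.finite_measure_axioms
    by (simp add: measure_def gauss.emeasure_pair_measure_Times enn2real_mult sets_gauss A D)
  also have "\<dots> \<le> measure gauss2 (E n \<union> {z. mix \<rho> \<sigma> n z \<in> D - B})"
  proof (rule gauss_pair.P.finite_measure_mono)
    \<comment> \<open>Stage \<open>n\<close> copies the first \<open>n\<close> coordinates from
      \<open>snd z\<close>, and \<open>D\<close> sees no others. So \<open>A \<times> D\<close>,
      whose measure is a product, can be compared with \<open>E n\<close>.\<close>
    have "mix \<rho> \<sigma> n z \<in> D \<longleftrightarrow> snd z \<in> D" for z by (rule D(2)[rule_format]) (simp add: mix_def)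
    then show "A \<times> D \<subseteq> E n \<union> {z. mix \<rho> \<sigma> n z \<in> D - B}" by (auto simp: E_def)
    have "{z \<in> space gauss2. mix \<rho> \<sigma> n z \<in> D - B} \<in> sets gauss2" by measurable
    then show "E n \<union> {z. mix \<rho> \<sigma> n z \<in> D - B} \<in> sets gauss2" using E by (simp add: sp)
  qed
  also have "\<dots> \<le> measure gauss2 (E n) + measure gauss2 {z. mix \<rho> \<sigma> n z \<in> D - B}"
  proof (rule measure_Un_le[OF E])
    have "{z \<in> space gauss2. mix \<rho> \<sigma> n z \<in> D - B} \<in> sets gauss2" by measurable
    then show "{z. mix \<rho> \<sigma> n z \<in> D - B} \<in> sets gauss2" by (simp add: sp)
  qed
  also have "measure gauss2 (E n) = 0"
  proof -
    have "E n \<in> null_sets gauss2"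
      unfolding AE_iff_null_sets[OF E] using null[of n] by (simp add: E_def)
    then show ?thesis by (simp add: measure_eq_0_null_sets)
  qed
  also have "measure gauss2 {z. mix \<rho> \<sigma> n z \<in> D - B} = measure (distr gauss2 borel (mix \<rho> \<sigma> n)) (D - B)"
    by (subst measure_distr) (auto simp: sp vimage_def)
  also have "\<dots> = measure gauss (D - B)" by (simp add: distr_mix[OF \<rho>\<sigma>(1)])
  also have "\<dots> \<le> measure gauss (sym_diff B D)" by (rule gauss.finite_measure_mono) auto
  finally have le: "measure gauss A * measure gauss D < \<epsilon>" using D' by simp
  have "measure gauss A * (measure gauss B - \<epsilon>) \<le> measure gauss A * measure gauss D"
    using Dge pos by (intro mult_left_mono) auto
  moreover have "measure gauss A * \<epsilon> \<le> \<epsilon>" using e by (intro mult_left_le_one_le) auto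
  ultimately show False using le by (simp add: \<epsilon>_def right_diff_distrib)
qed

section \<open>The Gaussian space as an atomless standard Borel space\<close>

lemma std_normal_singleton: "measure std_normal_distribution {t} = 0"
proof -
  have "AE x in std_normal_distribution. x \<noteq> t"
    by (subst AE_density) (auto intro: AE_mp[OF AE_lborel_singleton[of t]])
  then have "{t} \<in> null_sets std_normal_distribution"
    by (subst AE_iff_null_sets) auto
  then show ?thesis by (rule measure_eq_0_null_sets)
qed

lemma gauss_component_eq: "measure gauss {w. w j = t} = 0"
proof -
  have d: "distr gauss std_normal_distribution (\<lambda>w. w j) = std_normal_distribution"
    unfolding gauss_def by (rule distr_PiM_component) (auto intro: prob_space_std_normal)
  have "measure gauss {w. w j = t} = measure (distr gauss std_normal_distribution (\<lambda>w. w j)) {t}"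
    by (subst measure_distr) (auto simp: vimage_def)
  then show ?thesis by (simp add: d std_normal_singleton)
qed

text \<open>The measure of the part of \<open>A\<close> where \<open>w 0 \<le> t\<close> varies
  continuously with \<open>t\<close>, because the hyperplanes \<open>w 0 = t\<close> are null, and
  it runs from 0 to the measure of \<open>A\<close>; some \<open>t\<close> cuts \<open>A\<close> in
  half.\<close>

lemma atomless_gauss: "atomless gauss"
  unfolding atomless_def
proof (intro ballI impI)
  fix A assume A [measurable]: "A \<in> sets gauss" and pos: "0 < measure gauss A"
  define \<nu> where "\<nu> = distr (density gauss (indicator A)) borel (\<lambda>w. w 0)"
  interpret R: finite_measure "density gauss (indicator A)"
    by (rule gauss.finite_measure_restricted[OF A])
  have m: "(\<lambda>w. w 0) \<in> borel_measurable (density gauss (indicator A))" by measurable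
  interpret \<nu>: finite_borel_measure \<nu>
    unfolding finite_borel_measure_def finite_borel_measure_axioms_def \<nu>_def
    using R.finite_measure_distr[OF m] by simp
  have \<nu>: "measure \<nu> B = measure gauss (A \<inter> {w. w 0 \<in> B})" if [measurable]: "B \<in> sets borel" for B
  proof -
    have "measure \<nu> B = measure (density gauss (indicator A)) {w. w 0 \<in> B}"
      unfolding \<nu>_def by (subst measure_distr[OF m that]) (simp add: vimage_def)
    moreover have "{w \<in> space gauss. w 0 \<in> B} \<in> sets gauss" by measurable
    ultimately show ?thesis by (simp add: measure_def emeasure_restricted)
  qed
  have "isCont (cdf \<nu>) t" for t
  proof -
    have "{w \<in> space gauss. w 0 = t} \<in> sets gauss" by measurable
    then have "measure \<nu> {t} \<le> measure gauss {w. w 0 = t}"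
      by (subst \<nu>) (auto intro!: gauss.finite_measure_mono)
    then show ?thesis
      by (simp add: \<nu>.isCont_cdf gauss_component_eq measure_le_0_iff)
  qed
  then have cont: "continuous_on UNIV (cdf \<nu>)" by (simp add: continuous_at_imp_continuous_on)
  have top: "measure \<nu> (space \<nu>) = measure gauss A"
    using \<nu>[of UNIV] by (simp add: \<nu>_def)
  have "eventually (\<lambda>t. cdf \<nu> t < measure gauss A / 2) at_bot"
    using \<nu>.cdf_lim_at_bot pos by (intro order_tendstoD(2)[where y=0]) auto
  then obtain a where a: "\<And>t. t \<le> a \<Longrightarrow> cdf \<nu> t < measure gauss A / 2"
    by (auto simp: eventually_at_bot_linorder)
  have "eventually (\<lambda>t. cdf \<nu> t > measure gauss A / 2) at_top"
    using \<nu>.cdf_lim_at_top pos unfolding top by (intro order_tendstoD(1)[where y="measure gauss A"]) auto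
  then obtain b where b: "\<And>t. t \<ge> b \<Longrightarrow> cdf \<nu> t > measure gauss A / 2"
    by (auto simp: eventually_at_top_linorder)
  \<comment> \<open>No order between \<open>a\<close> and \<open>b\<close> has been established; as
    the two bounds persist below \<open>a\<close> and above \<open>b\<close>, \<open>min\<close> and
    \<open>max\<close> are safe endpoints.\<close>
  have "\<exists>t. min a b \<le> t \<and> t \<le> max a b \<and> cdf \<nu> t = measure gauss A / 2"
    using a[of "min a b"] b[of "max a b"] by (intro IVT' continuous_on_subset[OF cont]) auto
  then obtain t where t: "cdf \<nu> t = measure gauss A / 2" by blast
  have "{w \<in> space gauss. w 0 \<le> t} \<in> sets gauss" by measurable
  then have "A \<inter> {w. w 0 \<le> t} \<in> sets gauss" using A by auto
  moreover have "measure gauss (A \<inter> {w. w 0 \<le> t}) = measure gauss A / 2"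
    using t \<nu>[of "{..t}"] by (simp add: cdf_def)
  ultimately show "\<exists>B\<in>sets gauss. B \<subseteq> A \<and> 0 < measure gauss B \<and> measure gauss B < measure gauss A"
    using pos by (intro bexI[of _ "A \<inter> {w. w 0 \<le> t}"]) auto
qed

lemma polish_space_on_euclidean: "polish_space_on (euclidean :: 'b::polish_space topology)"
proof -
  obtain D :: "'b set" where "countable D" and D: "\<And>X. open X \<Longrightarrow> X \<noteq> {} \<Longrightarrow> \<exists>d\<in>D. d \<in> X"
    using countable_dense_exists[where 'a='b] by blast
  have "closure D = UNIV"
  proof (rule ccontr)
    assume "closure D \<noteq> UNIV"
    then obtain d where "d \<in> D" "d \<in> - closure D" using D[of "- closure D"] by auto
    then show False using closure_subset by blast
  qed
  with \<open>countable D\<close> show ?thesis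
    unfolding polish_space_on_def separable_space_def
    using completely_metrizable_space_euclidean by auto
qed

lemma standard_borel_gauss: "standard_borel gauss"
  unfolding standard_borel_def
  by (intro exI[of _ euclidean])
    (simp add: polish_space_on_euclidean sets_gauss borel_def)

section \<open>Automorphisms of a measure algebra induced by point maps\<close>

definition measure_preserving :: "'b measure \<Rightarrow> ('b \<Rightarrow> 'b) \<Rightarrow> bool" where
  "measure_preserving N T \<longleftrightarrow> T \<in> measurable N N \<and> distr N N T = N"

text \<open>Preimages are measurable and commute with the set operations, which images need not do.
  The restriction to the algebra makes the map extensional, as \<open>Bij\<close> demands.\<close>

definition malg_map :: "'b measure \<Rightarrow> ('b \<Rightarrow> 'b) \<Rightarrow> 'b set set \<Rightarrow> 'b set set" where
  "malg_map N T = (\<lambda>a\<in>malg N. \<Union>A\<in>a. malg_class N (T -` A \<inter> space N))"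

lemma measure_preservingD:
  assumes "measure_preserving N T"
  shows "T \<in> measurable N N"
    and "A \<in> sets N \<Longrightarrow> T -` A \<inter> space N \<in> sets N"
    and "A \<in> sets N \<Longrightarrow> emeasure N (T -` A \<inter> space N) = emeasure N A"
    and "A \<in> sets N \<Longrightarrow> measure N (T -` A \<inter> space N) = measure N A"
proof -
  have T: "T \<in> measurable N N" and D: "distr N N T = N"
    using assms by (auto simp: measure_preserving_def)
  show "T \<in> measurable N N" by (rule T)
  show "A \<in> sets N \<Longrightarrow> T -` A \<inter> space N \<in> sets N" by (rule measurable_sets[OF T])
  show "A \<in> sets N \<Longrightarrow> emeasure N (T -` A \<inter> space N) = emeasure N A"
    using emeasure_distr[OF T, of A] by (simp add: D)
  show "A \<in> sets N \<Longrightarrow> measure N (T -` A \<inter> space N) = measure N A"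
    using measure_distr[OF T, of A] by (simp add: D)
qed

lemma measure_preserving_vimage_null_sets:
  assumes "measure_preserving N T" "S \<in> null_sets N"
  shows "T -` S \<inter> space N \<in> null_sets N"
  using assms measure_preservingD(2,3)[OF assms(1), of S] by (simp add: null_sets_def)

lemma measure_preserving_comp:
  assumes "measure_preserving N S" "measure_preserving N T"
  shows "measure_preserving N (\<lambda>x. S (T x))"
proof -
  have S: "S \<in> measurable N N" "distr N N S = N" and T: "T \<in> measurable N N" "distr N N T = N"
    using assms by (auto simp: measure_preserving_def)
  have "distr N N (S \<circ> T) = N"
    using distr_distr[OF S(1) T(1)] by (simp add: S T)
  then show ?thesis
    using measurable_compose[OF T(1) S(1)] by (simp add: measure_preserving_def o_def)
qed

lemma malg_map_class:
  assumes T: "measure_preserving N T" and A: "A \<in> sets N"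
  shows "malg_map N T (malg_class N A) = malg_class N (T -` A \<inter> space N)"
proof -
  have *: "malg_class N (T -` A' \<inter> space N) = malg_class N (T -` A \<inter> space N)" if "A' \<in> malg_class N A" for A'
  proof -
    note AA = malg_class_memD[OF that]
    have "sym_diff (T -` A' \<inter> space N) (T -` A \<inter> space N) = T -` (sym_diff A A') \<inter> space N" by blast
    then show ?thesis
      using measure_preserving_vimage_null_sets[OF T AA(3)]
      by (simp only: malg_class_eq_iff[OF measure_preservingD(2)[OF T AA(2)] measure_preservingD(2)[OF T A]])
  qed
  have "malg_class N A \<noteq> {}" using malg_class_self[OF A] by (metis empty_iff)
  then have "(\<Union>A'\<in>malg_class N A. malg_class N (T -` A' \<inter> space N)) = malg_class N (T -` A \<inter> space N)"
    using * by (rule UN_eq_const)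
  then show ?thesis
    unfolding malg_map_def using malg_class_in_malg[OF A] by (simp only: restrict_apply if_True)
qed

lemma malg_map_closed:
  assumes "measure_preserving N T" "a \<in> malg N"
  shows "malg_map N T a \<in> malg N"
proof -
  obtain A where "A \<in> sets N" "a = malg_class N A" using malgE[OF assms(2)] by blast
  then show ?thesis
    using assms(1) by (simp add: malg_map_class malg_class_in_malg measure_preservingD(2))
qed

text \<open>This is what admits point maps known only up to null sets: the induced map of the
  algebra does not see the choice.\<close>

lemma malg_map_cong_AE:
  assumes T: "measure_preserving N T" and S: "measure_preserving N S"
    and AE: "AE x in N. T x = S x"
  shows "malg_map N T = malg_map N S"
proof
  fix a
  show "malg_map N T a = malg_map N S a"
  proof (cases "a \<in> malg N")
    case True
    then obtain A where A: "A \<in> sets N" "a = malg_class N A" using malgE[OF True] by blast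
    let ?T = "T -` A \<inter> space N" and ?S = "S -` A \<inter> space N"
    have m: "?T \<in> sets N" "?S \<in> sets N"
      by (rule measure_preservingD(2)[OF T A(1)], rule measure_preservingD(2)[OF S A(1)])
    have "AE x in N. x \<notin> sym_diff ?T ?S"
      using AE by (rule eventually_mono) (simp add: vimage_def)
    moreover have "sym_diff ?T ?S \<in> sets N" using m by (intro sets.Un sets.Diff)
    ultimately have "sym_diff ?T ?S \<in> null_sets N" by (simp only: AE_iff_null_sets)
    then show ?thesis
      by (simp only: A(2) malg_map_class[OF T A(1)] malg_map_class[OF S A(1)] malg_class_eq_iff[OF m])
  qed (simp add: malg_map_def)
qed

lemma malg_map_comp:
  assumes "measure_preserving N T" "measure_preserving N S" "a \<in> malg N"
  shows "malg_map N T (malg_map N S a) = malg_map N (\<lambda>x. S (T x)) a"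
proof -
  obtain A where A: "A \<in> sets N" "a = malg_class N A" using malgE[OF assms(3)] by blast
  have "T -` (S -` A \<inter> space N) \<inter> space N = (\<lambda>x. S (T x)) -` A \<inter> space N"
    using measurable_space[OF measure_preservingD(1)[OF assms(1)]] by auto
  then show ?thesis
    by (simp only: A(2) malg_map_class[OF assms(2) A(1)] malg_map_class[OF assms(1) measure_preservingD(2)[OF assms(2) A(1)]]
        malg_map_class[OF measure_preserving_comp[OF assms(2,1)] A(1)])
qed

lemma malg_map_id:
  assumes "a \<in> malg N"
  shows "malg_map N (\<lambda>x. x) a = a"
proof -
  obtain A where A: "A \<in> sets N" "a = malg_class N A" using malgE[OF assms] by blast
  have "measure_preserving N (\<lambda>x. x)" by (simp add: measure_preserving_def distr_id2)
  then show ?thesis using A by (simp add: malg_map_class sets.Int_space_eq2)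
qed

text \<open>\<open>T\<close> may fail to be a bijection of points; a measure preserving inverse up
  to null sets already gives a two-sided inverse on classes.\<close>

lemma malg_map_auts:
  assumes T: "measure_preserving N T" and S: "measure_preserving N S"
    and ST: "AE x in N. S (T x) = x" and TS: "AE x in N. T (S x) = x"
  shows "malg_map N T \<in> malg_auts N"
proof -
  have id: "measure_preserving N (\<lambda>x. x)" by (simp add: measure_preserving_def distr_id2)
  have inv: "malg_map N T (malg_map N S a) = a" "malg_map N S (malg_map N T a) = a" if "a \<in> malg N" for a
    using malg_map_comp[OF T S that] malg_map_comp[OF S T that] malg_map_id[OF that]
      malg_map_cong_AE[OF measure_preserving_comp[OF S T] id ST]
      malg_map_cong_AE[OF measure_preserving_comp[OF T S] id TS] by simp_all
  have "bij_betw (malg_map N T) (malg N) (malg N)"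
    by (rule bij_betw_byWitness[where f'="malg_map N S"]) (auto simp: inv malg_map_closed[OF T] malg_map_closed[OF S])
  then have "malg_map N T \<in> Bij (malg N)" by (simp add: Bij_def malg_map_def)
  moreover have "malg_map N T (malg_inf N a b) = malg_inf N (malg_map N T a) (malg_map N T b)"
    "malg_map N T (malg_sup N a b) = malg_sup N (malg_map N T a) (malg_map N T b)"
    if ab: "a \<in> malg N" "b \<in> malg N" for a b
  proof -
    obtain A B where *: "A \<in> sets N" "a = malg_class N A" "B \<in> sets N" "b = malg_class N B"
      using malgE[OF ab(1)] malgE[OF ab(2)] by metis
    have "T -` (A \<inter> B) \<inter> space N = (T -` A \<inter> space N) \<inter> (T -` B \<inter> space N)"
      "T -` (A \<union> B) \<inter> space N = (T -` A \<inter> space N) \<union> (T -` B \<inter> space N)" by blast+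
    then show "malg_map N T (malg_inf N a b) = malg_inf N (malg_map N T a) (malg_map N T b)"
      "malg_map N T (malg_sup N a b) = malg_sup N (malg_map N T a) (malg_map N T b)"
      using * T measure_preservingD(2)[OF T]
      by (simp_all add: malg_map_class malg_inf_class malg_sup_class sets.Int sets.Un)
  qed
  moreover have "malg_map N T (malg_compl N a) = malg_compl N (malg_map N T a)"
    "malg_measure N (malg_map N T a) = malg_measure N a"
    if a: "a \<in> malg N" for a
  proof -
    obtain A where *: "A \<in> sets N" "a = malg_class N A" using malgE[OF a] by metis
    have "T -` (space N - A) \<inter> space N = space N - (T -` A \<inter> space N)"
      using measurable_space[OF measure_preservingD(1)[OF T]] by auto
    then show "malg_map N T (malg_compl N a) = malg_compl N (malg_map N T a)"
      "malg_measure N (malg_map N T a) = malg_measure N a"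
      using * T measure_preservingD[OF T]
      by (simp_all add: malg_map_class malg_compl_class malg_measure_class sets.compl_sets)
  qed
  ultimately show ?thesis by (simp add: malg_auts_def)
qed

text \<open>Pulling back along \<open>T\<close> reverses the order of composition, so the point maps must form a
  near action from the right.\<close>

lemma malg_map_hom:
  assumes G: "group G"
    and T: "\<And>g. g \<in> carrier G \<Longrightarrow> measure_preserving N (T g)"
    and mult: "\<And>g h. g \<in> carrier G \<Longrightarrow> h \<in> carrier G \<Longrightarrow> AE x in N. T h (T g x) = T (g \<otimes>\<^bsub>G\<^esub> h) x"
    and one: "AE x in N. T \<one>\<^bsub>G\<^esub> x = x"
  shows "(\<lambda>g. malg_map N (T g)) \<in> hom G (malg_Aut N)"
proof -
  interpret group G by (rule G)
  have auts: "malg_map N (T g) \<in> malg_auts N" if g: "g \<in> carrier G" for g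
  proof (rule malg_map_auts)
    have i: "inv\<^bsub>G\<^esub> g \<in> carrier G" using g by simp
    show "AE x in N. T (inv\<^bsub>G\<^esub> g) (T g x) = x" using mult[OF g i] one by eventually_elim (simp add: g)
    show "AE x in N. T g (T (inv\<^bsub>G\<^esub> g) x) = x" using mult[OF i g] one by eventually_elim (simp add: g)
  qed (use g in \<open>auto intro: T\<close>)
  show ?thesis
  proof (rule homI)
    fix g h assume g: "g \<in> carrier G" and h: "h \<in> carrier G"
    have gh: "malg_map N (T (g \<otimes>\<^bsub>G\<^esub> h)) = malg_map N (\<lambda>x. T h (T g x))"
      by (rule malg_map_cong_AE[OF measure_preserving_comp[OF T[OF h] T[OF g]] T[OF m_closed[OF g h]] mult[OF g h], symmetric])
    have "malg_map N (T (g \<otimes>\<^bsub>G\<^esub> h)) = compose (malg N) (malg_map N (T g)) (malg_map N (T h))"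
    proof
      fix a
      show "malg_map N (T (g \<otimes>\<^bsub>G\<^esub> h)) a = compose (malg N) (malg_map N (T g)) (malg_map N (T h)) a"
      proof (cases "a \<in> malg N")
        case True
        then show ?thesis
          by (simp only: compose_eq malg_map_comp[OF T[OF g] T[OF h]] gh)
      next
        case False
        then show ?thesis by (simp add: compose_def malg_map_def)
      qed
    qed
    moreover have "malg_map N (T g) \<in> Bij (malg N)" "malg_map N (T h) \<in> Bij (malg N)"
      using auts[OF g] auts[OF h] by (auto simp: malg_auts_def)
    ultimately show "malg_map N (T (g \<otimes>\<^bsub>G\<^esub> h)) = malg_map N (T g) \<otimes>\<^bsub>malg_Aut N\<^esub> malg_map N (T h)"
      by (simp add: malg_Aut_def BijGroup_def)
  qed (use auts in \<open>simp add: malg_Aut_def\<close>)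
qed

section \<open>Cantor sets in compact metric spaces\<close>

context Metric_space
begin

text \<open>Finitely many balls cover the compact space, and one of finitely many pieces of an
  uncountable set is uncountable.\<close>

lemma uncountable_Int_mcball:
  assumes cpt: "compact_space mtopology" and C: "uncountable C" "C \<subseteq> M" and r: "r > 0"
  shows "\<exists>x\<in>M. uncountable (C \<inter> mcball x r)"
proof (rule ccontr)
  assume "\<not> ?thesis"
  then have cnt: "countable (C \<inter> mcball x r)" if "x \<in> M" for x using that by blast
  have tb: "mtotally_bounded M"
    using cpt by (intro compactin_imp_mtotally_bounded) (simp add: compact_space_def)
  obtain K where K: "finite K" "K \<subseteq> M" "M \<subseteq> (\<Union>x\<in>K. mball x r)"
    using tb[unfolded mtotally_bounded_def, rule_format, OF r] by blast
  have "C \<subseteq> (\<Union>x\<in>K. C \<inter> mcball x r)"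
  proof
    fix z assume z: "z \<in> C"
    then obtain x where x: "x \<in> K" "z \<in> mball x r" using K(3) C(2) by blast
    then have "z \<in> C \<inter> mcball x r" using z subsetD[OF mball_subset_mcball] by simp
    then show "z \<in> (\<Union>x\<in>K. C \<inter> mcball x r)" by (rule UN_I[OF x(1)])
  qed
  moreover have "countable (\<Union>x\<in>K. C \<inter> mcball x r)"
    using K(2) by (intro countable_UN[OF countable_finite[OF K(1)]] cnt) blast
  ultimately show False using C(1) countable_subset by blast
qed

lemma mcball_dist_le:
  assumes "x \<in> mcball z r" "y \<in> mcball z r"
  shows "d x y \<le> 2 * r"
proof -
  have "z \<in> M" "x \<in> M" "y \<in> M" "d z x \<le> r" "d z y \<le> r" using assms by auto
  then show ?thesis using triangle[of x z y] commute[of x z] by linarith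
qed

text \<open>Otherwise, for every small \<open>r\<close>, all but countably many points of
  \<open>C\<close> lie in one ball of radius \<open>3 * r\<close>. Letting \<open>r\<close> tend to
  0 leaves at most one point besides countably many, so \<open>C\<close> would be countable. In this
  way no perfect kernel has to be extracted.\<close>

lemma uncountable_closed_split:
  assumes cpt: "compact_space mtopology" and C: "closedin mtopology C" "uncountable C" and e: "e > 0"
  shows "\<exists>A B. closedin mtopology A \<and> closedin mtopology B \<and> uncountable A \<and> uncountable B \<and>
    A \<subseteq> C \<and> B \<subseteq> C \<and> A \<inter> B = {} \<and> (\<forall>x\<in>A. \<forall>y\<in>A. d x y < e) \<and> (\<forall>x\<in>B. \<forall>y\<in>B. d x y < e)"
proof (rule ccontr)
  assume neg: "\<not> ?thesis"
  have CM: "C \<subseteq> M" using closedin_subset[OF C(1)] by simp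
  have key: "\<exists>x\<in>M. countable (C - mcball x (3 * r))" if r: "r > 0" "2 * r < e" for r
  proof -
    obtain x where x: "x \<in> M" "uncountable (C \<inter> mcball x r)"
      using uncountable_Int_mcball[OF cpt C(2) CM r(1)] by blast
    have "countable (C - mcball x (3 * r))"
    proof (rule ccontr)
      assume unc: "uncountable (C - mcball x (3 * r))"
      have "C - mcball x (3 * r) \<subseteq> M" using CM by blast
      then obtain y where y: "y \<in> M" "uncountable ((C - mcball x (3 * r)) \<inter> mcball y r)"
        using uncountable_Int_mcball[OF cpt unc _ r(1)] by blast
      then have "(C - mcball x (3 * r)) \<inter> mcball y r \<noteq> {}" by (metis countable_empty)
      then obtain z where z: "z \<in> C" "z \<notin> mcball x (3 * r)" "z \<in> mcball y r" by blast
      have uy: "uncountable (C \<inter> mcball y r)"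
        using y(2) by (rule contrapos_nn) (erule countable_subset[rotated], blast)
      \<comment> \<open>A common point would put \<open>z\<close> within \<open>r + 2 * r\<close> of
        \<open>x\<close>, but \<open>z\<close> lies outside the ball of radius \<open>3 * r\<close>;
        this is the origin of the factor 3.\<close>
      have disj: "mcball x r \<inter> mcball y r = {}"
      proof (rule ccontr)
        assume "mcball x r \<inter> mcball y r \<noteq> {}"
        then obtain w where w: "w \<in> mcball x r" "w \<in> mcball y r" by blast
        have "d x z \<le> d x w + d w z" using w z by (intro triangle) auto
        also have "d w z \<le> 2 * r" using mcball_dist_le[OF w(2) z(3)] .
        finally have "d x z \<le> 3 * r" using w by simp
        then show False using z x CM by auto
      qed
      have small: "\<forall>p\<in>C \<inter> mcball u r. \<forall>q\<in>C \<inter> mcball u r. d p q < e" for u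
        using mcball_dist_le[of _ u r] r(2) by fastforce
      have cl: "closedin mtopology (C \<inter> mcball u r)" for u
        by (rule closedin_Int[OF C(1) closedin_mcball])
      have "C \<inter> mcball x r \<inter> (C \<inter> mcball y r) = {}" using disj by blast
      then show False
        using neg cl[of x] cl[of y] x(2) uy small[of x] small[of y] by blast
    qed
    then show ?thesis using x(1) by blast
  qed
  \<comment> \<open>The radii tend to 0 and are at most \<open>e / 4\<close>, so that a ball of
    radius \<open>r n\<close> has diameter at most \<open>e / 2\<close>, below \<open>e\<close> as
    \<open>key\<close> requires.\<close>
  define r where "r n = e / 4 / real (Suc n)" for n
  have r: "r n > 0" "2 * r n < e" for n
  proof -
    show "r n > 0" using e by (simp add: r_def)
    have "r n \<le> e / 4" unfolding r_def using e by (simp add: field_simps)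
    then show "2 * r n < e" using e by linarith
  qed
  have "\<forall>n. \<exists>x. x \<in> M \<and> countable (C - mcball x (3 * r n))" using key[OF r] by blast
  then obtain x where x: "\<And>n. x n \<in> M" "\<And>n. countable (C - mcball (x n) (3 * r n))"
    unfolding choice_iff by blast
  let ?I = "\<Inter>n. mcball (x n) (3 * r n)"
  have single: "p = q" if "p \<in> ?I" "q \<in> ?I" for p q
  proof -
    have "d p q \<le> 2 * (3 * r n)" for n using that by (intro mcball_dist_le[of _ "x n"]) auto
    moreover have "2 * (3 * r n) = (6 * (e / 4)) * (1 / real (Suc n))" for n
      by (simp add: r_def divide_simps)
    ultimately have le: "d p q \<le> (6 * (e / 4)) * (1 / real (Suc n))" for n by (simp only:)
    have "(\<lambda>n. (6 * (e / 4)) * (1 / real (Suc n))) \<longlonglongrightarrow> (6 * (e / 4)) * 0"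
      by (intro tendsto_mult tendsto_const LIMSEQ_Suc[OF lim_1_over_n])
    then have "d p q \<le> (6 * (e / 4)) * 0" by (rule LIMSEQ_le_const) (use le in blast)
    moreover have "p \<in> M" "q \<in> M" using that by auto
    ultimately show ?thesis using zero[of p q] nonneg[of p q] by simp
  qed
  have "countable ?I"
  proof (cases "?I = {}")
    case False
    then obtain p where "p \<in> ?I" by blast
    then have "?I \<subseteq> {p}" using single by blast
    then show ?thesis by (rule countable_subset) simp
  qed simp
  moreover have "countable (\<Union>n. C - mcball (x n) (3 * r n))" using x(2) by (intro countable_UN) auto
  ultimately have "countable (?I \<union> (\<Union>n. C - mcball (x n) (3 * r n)))" by (rule countable_Un)
  moreover have "C \<subseteq> ?I \<union> (\<Union>n. C - mcball (x n) (3 * r n))" by blast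
  ultimately show False using C(2) countable_subset by blast
qed

text \<open>Bit strings are listed with the most recent bit first.\<close>

lemma cantor_scheme:
  assumes cpt: "compact_space mtopology" and unc: "uncountable M"
  shows "\<exists>F :: bool list \<Rightarrow> 'a set. (\<forall>s. closedin mtopology (F s)) \<and> (\<forall>s. F s \<noteq> {}) \<and>
    (\<forall>b s. F (b # s) \<subseteq> F s) \<and> (\<forall>s. F (True # s) \<inter> F (False # s) = {}) \<and>
    (\<forall>b s. \<forall>x\<in>F (b # s). \<forall>y\<in>F (b # s). d x y < 1 / real (Suc (length s)))"
proof -
  define good where "good C \<longleftrightarrow> closedin mtopology C \<and> uncountable C" for C
  define P where "P C e p \<longleftrightarrow> good (fst p) \<and> good (snd p) \<and> fst p \<subseteq> C \<and> snd p \<subseteq> C \<and> fst p \<inter> snd p = {} \<and>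
    (\<forall>x\<in>fst p. \<forall>y\<in>fst p. d x y < e) \<and> (\<forall>x\<in>snd p. \<forall>y\<in>snd p. d x y < e)" for C p and e :: real
  define S where "S C e = (SOME p. P C e p)" for C and e :: real
  have S: "P C e (S C e)" if C: "good C" "e > 0" for C e
  proof -
    obtain A B where "closedin mtopology A \<and> closedin mtopology B \<and> uncountable A \<and> uncountable B \<and>
      A \<subseteq> C \<and> B \<subseteq> C \<and> A \<inter> B = {} \<and> (\<forall>x\<in>A. \<forall>y\<in>A. d x y < e) \<and> (\<forall>x\<in>B. \<forall>y\<in>B. d x y < e)"
      using uncountable_closed_split[OF cpt C(1)[unfolded good_def, THEN conjunct1] C(1)[unfolded good_def, THEN conjunct2] C(2)]
      by (elim exE) (rule that)
    then have "P C e (A, B)" unfolding P_def good_def fst_conv snd_conv by (elim conjE) (intro conjI)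
    then show ?thesis unfolding S_def by (rule someI)
  qed
  \<comment> \<open>The newest bit of a string selects one half of the split of the set belonging to
    its tail. The mesh of the split tends to 0 with the level; the root is all of
    \<open>M\<close>.\<close>
  define F where "F = rec_list M (\<lambda>b s C. (if b then fst else snd) (S C (1 / real (Suc (length s)))))"
  have F0: "F [] = M" by (simp add: F_def)
  have FS: "F (b # s) = (if b then fst else snd) (S (F s) (1 / real (Suc (length s))))" for b s
    by (simp add: F_def)
  have gF: "good (F s)" for s
  proof (induction s)
    case Nil
    show ?case using unc closedin_topspace[of mtopology] by (simp add: F0 good_def)
  next
    case (Cons b s)
    have "P (F s) (1 / real (Suc (length s))) (S (F s) (1 / real (Suc (length s))))"
      by (rule S[OF Cons]) simp
    then show ?case unfolding P_def FS by (cases b) auto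
  qed
  have PF: "P (F s) (1 / real (Suc (length s))) (S (F s) (1 / real (Suc (length s))))" for s
    by (rule S[OF gF]) simp
  show ?thesis
  proof (intro exI[of _ F] conjI allI ballI)
    show "closedin mtopology (F s)" for s using gF by (simp add: good_def)
    show "F s \<noteq> {}" for s using gF[of s] by (auto simp: good_def)
    show "F (b # s) \<subseteq> F s" for b s using PF[of s] unfolding FS P_def by (cases b) auto
    show "F (True # s) \<inter> F (False # s) = {}" for s using PF[of s] unfolding FS P_def by simp
    show "d x y < 1 / real (Suc (length s))" if xy: "x \<in> F (b # s)" "y \<in> F (b # s)" for b s x y
      using PF[of s] xy unfolding FS P_def by (cases b) auto
  qed
qed

text \<open>\<open>\<kappa> x\<close> is a point in the nested intersection along the branch
  \<open>x\<close>. Of the embedding only two consequences are recorded: a modulus of continuity,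
  and continuous functions on all of \<open>M\<close> that recover the bits. Their range
  \<open>{-1..1}\<close> will keep the circle-valued maps built from them close to 1.\<close>

proposition cantor_embedding:
  assumes cpt: "compact_space mtopology" and unc: "uncountable M"
  shows "\<exists>(\<kappa> :: (nat \<Rightarrow> bool) \<Rightarrow> 'a) (h :: nat \<Rightarrow> 'a \<Rightarrow> real). (\<forall>x. \<kappa> x \<in> M) \<and>
    (\<forall>n x y. (\<forall>j<Suc n. x j = y j) \<longrightarrow> d (\<kappa> x) (\<kappa> y) < 1 / real (Suc n)) \<and>
    (\<forall>m. continuous_map mtopology (top_of_set {-1..1}) (h m)) \<and>
    (\<forall>m x. h m (\<kappa> x) = (if x m then 1 else -1))"
proof -
  obtain F :: "bool list \<Rightarrow> 'a set"
    where cl: "\<And>s. closedin mtopology (F s)" and ne: "\<And>s. F s \<noteq> {}"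
      and sub: "\<And>b s. F (b # s) \<subseteq> F s" and disj: "\<And>s. F (True # s) \<inter> F (False # s) = {}"
      and small: "\<And>b s x y. x \<in> F (b # s) \<Longrightarrow> y \<in> F (b # s) \<Longrightarrow> d x y < 1 / real (Suc (length s))"
    using cantor_scheme[OF cpt unc] by blast
  have disj': "s = t" if "length s = length t" "p \<in> F s" "p \<in> F t" for s t p
    using that
  proof (induction s t rule: list_induct2)
    case (Cons b s c t)
    have "s = t" using Cons.IH Cons.prems sub by blast
    moreover have "b = c" using disj[of s] Cons.prems \<open>s = t\<close> by (cases b; cases c) auto
    ultimately show ?case by simp
  qed simp
  define pre where "pre x n = rev (map x [0..<n])" for x :: "nat \<Rightarrow> bool" and n
  have pre_Suc: "pre x (Suc n) = x n # pre x n" for x n by (simp add: pre_def)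
  have len: "length (pre x n) = n" for x n by (simp add: pre_def)
  have "(\<Inter>n. F (pre x n)) \<noteq> {}" for x
  proof (rule compact_space_imp_nest[OF cpt cl ne])
    show "decseq (\<lambda>n. F (pre x n))" by (rule decseq_SucI) (simp add: pre_Suc sub)
  qed
  then have "\<forall>x. \<exists>p. p \<in> (\<Inter>n. F (pre x n))" by blast
  then obtain \<kappa> where "\<And>x. \<kappa> x \<in> (\<Inter>n. F (pre x n))" unfolding choice_iff by blast
  then have \<kappa>: "\<kappa> x \<in> F (pre x n)" for x n by blast
  \<comment> \<open>With the most recent bit first, the head of a string of length
    \<open>Suc m\<close> is bit number \<open>m\<close>. There are finitely many such strings, so
    both unions are closed, and Urysohn's lemma separates them.\<close>
  define U where "U b m = \<Union>(F ` {s. length s = Suc m \<and> hd s = b})" for b m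
  have fin: "finite {s :: bool list. length s = Suc m \<and> hd s = b}" for b m
    by (rule finite_subset[OF _ finite_lists_length_eq[of "UNIV :: bool set" "Suc m"]]) auto
  have clU: "closedin mtopology (U b m)" for b m
    unfolding U_def using fin cl by (intro closedin_Union) auto
  have disjU: "disjnt (U False m) (U True m)" for m
    unfolding disjnt_def
  proof (rule ccontr)
    assume "U False m \<inter> U True m \<noteq> {}"
    then obtain p s t where "length s = Suc m" "hd s = False" "p \<in> F s"
      "length t = Suc m" "hd t = True" "p \<in> F t"
      unfolding U_def by blast
    then show False using disj'[of s t p] by simp
  qed
  have \<kappa>U: "\<kappa> x \<in> U (x m) m" for x m
    unfolding U_def using \<kappa>[of x "Suc m"] by (intro UnionI[OF imageI]) (auto simp: pre_Suc len)
  have "\<forall>m. \<exists>h. continuous_map mtopology (top_of_set {-1..1::real}) h \<and> h ` U False m \<subseteq> {-1} \<and> h ` U True m \<subseteq> {1}"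
  proof
    fix m
    have "(-1::real) \<le> 1" by simp
    show "\<exists>h. continuous_map mtopology (top_of_set {-1..1::real}) h \<and> h ` U False m \<subseteq> {-1} \<and> h ` U True m \<subseteq> {1}"
    proof (rule Urysohn_lemma[OF normal_space_mtopology clU clU disjU \<open>(-1::real) \<le> 1\<close>])
      fix f assume "continuous_map mtopology (top_of_set {-1..1::real}) f" "f ` U False m \<subseteq> {-1}" "f ` U True m \<subseteq> {1}"
      then show ?thesis by blast
    qed
  qed
  from choice[OF this] obtain h where h': "\<forall>m. continuous_map mtopology (top_of_set {-1..1::real}) (h m) \<and>
    h m ` U False m \<subseteq> {-1} \<and> h m ` U True m \<subseteq> {1}" ..
  then have h: "\<And>m. continuous_map mtopology (top_of_set {-1..1::real}) (h m)"
    "\<And>m. h m ` U False m \<subseteq> {-1}" "\<And>m. h m ` U True m \<subseteq> {1}"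
    by (simp_all only:)
  show ?thesis
  proof (intro exI[of _ \<kappa>] exI[of _ h] conjI allI impI)
    show "\<kappa> x \<in> M" for x using \<kappa>[of x 0] closedin_subset[OF cl] by auto
    show "continuous_map mtopology (top_of_set {-1..1}) (h m)" for m by (rule h)
    show "h m (\<kappa> x) = (if x m then 1 else -1)" for m x
    proof (cases "x m")
      case True
      then show ?thesis using h(3)[of m] \<kappa>U[of x m] by auto
    next
      case False
      then show ?thesis using h(2)[of m] \<kappa>U[of x m] by auto
    qed
    \<comment> \<open>Agreement in \<open>Suc n\<close> bits puts both points into one set of level
      \<open>Suc n\<close>, and this level has mesh \<open>1 / Suc n\<close>.\<close>
    show "d (\<kappa> x) (\<kappa> y) < 1 / real (Suc n)" if agree: "\<forall>j<Suc n. x j = y j" for n x y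
    proof -
      have "map x [0..<Suc n] = map y [0..<Suc n]" by (rule map_cong[OF refl], rule agree[rule_format], simp only: set_upt atLeastLessThan_iff)
      then have "pre x (Suc n) = pre y (Suc n)" by (simp only: pre_def)
      then have "\<kappa> y \<in> F (x n # pre x n)" using \<kappa>[of y "Suc n"] by (simp add: pre_Suc)
      moreover have "\<kappa> x \<in> F (x n # pre x n)" using \<kappa>[of x "Suc n"] by (simp add: pre_Suc)
      ultimately show ?thesis using small[of "\<kappa> x" "x n" "pre x n" "\<kappa> y"] by (simp add: len)
    qed
  qed
qed

end

section \<open>The group of circle-valued maps\<close>

lemma mspace_circle_metric [simp]: "mspace circle_metric = sphere 0 1"
  and mdist_circle_metric [simp]: "mdist circle_metric = dist"
  by (simp_all add: circle_metric_def)

lemma mtopology_of_circle_metric: "mtopology_of circle_metric = top_of_set (sphere 0 1)"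
  by (simp add: circle_metric_def mtopology_of_submetric)

lemma circle_mapsD:
  assumes "f \<in> carrier (circle_maps X)"
  shows "f \<in> extensional (topspace X)" "x \<in> topspace X \<Longrightarrow> cmod (f x) = 1" "continuous_map X euclidean f"
  using assms unfolding carrier_circle_maps by auto

lemma circle_mapsI:
  assumes "f \<in> extensional (topspace X)" "\<And>x. x \<in> topspace X \<Longrightarrow> cmod (f x) = 1" "continuous_map X euclidean f"
  shows "f \<in> carrier (circle_maps X)"
  using assms unfolding carrier_circle_maps by auto

lemma carrier_circle_maps_mspace: "carrier (circle_maps X) = mspace (cfunspace X circle_metric)"
  by (simp add: circle_maps_def)

lemma circle_maps_mult: "mult (circle_maps X) f g = (\<lambda>x\<in>topspace X. f x * g x)"
  and circle_maps_one: "one (circle_maps X) = (\<lambda>x\<in>topspace X. 1)"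
  by (simp_all add: circle_maps_def)

lemma mdist_circle_maps_le:
  assumes "f \<in> carrier (circle_maps X)" "g \<in> carrier (circle_maps X)" "0 \<le> a"
  shows "mdist (cfunspace X circle_metric) f g \<le> a \<longleftrightarrow> (\<forall>x\<in>topspace X. cmod (f x - g x) \<le> a)"
proof
  assume "mdist (cfunspace X circle_metric) f g \<le> a"
  then show "\<forall>x\<in>topspace X. cmod (f x - g x) \<le> a"
    using mdist_cfunspace_imp_mdist_le[of f X circle_metric g a] assms(1,2)
    unfolding carrier_circle_maps_mspace by (simp only: mdist_circle_metric dist_norm) blast
next
  assume "\<forall>x\<in>topspace X. cmod (f x - g x) \<le> a"
  then show "mdist (cfunspace X circle_metric) f g \<le> a"
    by (intro mdist_cfunspace_le assms(3)) (simp add: dist_norm)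
qed

lemma continuous_map_norm_one_restrict:
  assumes "continuous_map X euclidean f" "\<And>x. x \<in> topspace X \<Longrightarrow> cmod (f x) = 1"
  shows "(\<lambda>x\<in>topspace X. f x) \<in> carrier (circle_maps X)"
proof (rule circle_mapsI)
  show "continuous_map X euclidean (\<lambda>x\<in>topspace X. f x)"
    by (rule continuous_map_eq[OF assms(1)]) simp
qed (use assms in auto)

lemma circle_maps_mult_closed:
  assumes "f \<in> carrier (circle_maps X)" "g \<in> carrier (circle_maps X)"
  shows "mult (circle_maps X) f g \<in> carrier (circle_maps X)"
  unfolding circle_maps_mult
proof (rule continuous_map_norm_one_restrict)
  have "continuous_map X (prod_topology euclidean euclidean) (\<lambda>x. (f x, g x))"
    by (intro continuous_map_pairedI circle_mapsD(3)[OF assms(1)] circle_mapsD(3)[OF assms(2)])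
  moreover have "continuous_map (prod_topology euclidean euclidean) euclidean (\<lambda>p :: complex \<times> complex. fst p * snd p)"
    by (simp add: euclidean_product_topology) (intro continuous_intros)
  ultimately have "continuous_map X euclidean ((\<lambda>p. fst p * snd p) \<circ> (\<lambda>x. (f x, g x)))"
    by (rule continuous_map_compose)
  then show "continuous_map X euclidean (\<lambda>x. f x * g x)" by (simp add: o_def)
qed (simp add: norm_mult circle_mapsD(2)[OF assms(1)] circle_mapsD(2)[OF assms(2)])

lemma circle_maps_cnj_closed:
  assumes "f \<in> carrier (circle_maps X)"
  shows "(\<lambda>x\<in>topspace X. cnj (f x)) \<in> carrier (circle_maps X)"
proof (rule continuous_map_norm_one_restrict)
  have "continuous_map X euclidean (cnj \<circ> f)"
    by (rule continuous_map_compose[OF circle_mapsD(3)[OF assms]]) (auto intro: continuous_intros)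
  then show "continuous_map X euclidean (\<lambda>x. cnj (f x))" by (simp add: o_def)
qed (use circle_mapsD[OF assms] in auto)

lemma circle_maps_one_closed: "one (circle_maps X) \<in> carrier (circle_maps X)"
  unfolding circle_maps_one by (rule continuous_map_norm_one_restrict) auto

lemma group_circle_maps: "group (circle_maps X)"
proof (rule groupI)
  fix f g h
  assume f: "f \<in> carrier (circle_maps X)"
  show "one (circle_maps X) \<otimes>\<^bsub>circle_maps X\<^esub> f = f"
    using circle_mapsD(1)[OF f] unfolding circle_maps_mult circle_maps_one
    by (intro extensionalityI[of _ "topspace X"]) auto
  show "\<exists>k\<in>carrier (circle_maps X). k \<otimes>\<^bsub>circle_maps X\<^esub> f = one (circle_maps X)"
  proof (rule bexI[OF _ circle_maps_cnj_closed[OF f]])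
    show "(\<lambda>x\<in>topspace X. cnj (f x)) \<otimes>\<^bsub>circle_maps X\<^esub> f = one (circle_maps X)"
      unfolding circle_maps_mult circle_maps_one
    proof (rule restrict_ext)
      fix x assume "x \<in> topspace X"
      then show "(\<lambda>x\<in>topspace X. cnj (f x)) x * f x = 1"
        using circle_mapsD(2)[OF f] complex_norm_square[of "f x"] by (simp add: mult.commute)
    qed
  qed
  assume g: "g \<in> carrier (circle_maps X)"
  show "f \<otimes>\<^bsub>circle_maps X\<^esub> g \<in> carrier (circle_maps X)" by (rule circle_maps_mult_closed[OF f g])
  show "f \<otimes>\<^bsub>circle_maps X\<^esub> g \<otimes>\<^bsub>circle_maps X\<^esub> h = f \<otimes>\<^bsub>circle_maps X\<^esub> (g \<otimes>\<^bsub>circle_maps X\<^esub> h)"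
    unfolding circle_maps_mult by (rule restrict_ext) (simp add: mult.assoc)
qed (rule circle_maps_one_closed)

lemma inv_circle_maps:
  assumes f: "f \<in> carrier (circle_maps X)"
  shows "inv\<^bsub>circle_maps X\<^esub> f = (\<lambda>x\<in>topspace X. cnj (f x))"
proof (rule group.inv_equality[OF group_circle_maps _ f circle_maps_cnj_closed[OF f]])
  show "(\<lambda>x\<in>topspace X. cnj (f x)) \<otimes>\<^bsub>circle_maps X\<^esub> f = one (circle_maps X)"
    unfolding circle_maps_mult circle_maps_one
  proof (rule restrict_ext)
    fix x assume "x \<in> topspace X"
    then show "(\<lambda>x\<in>topspace X. cnj (f x)) x * f x = 1"
      using circle_mapsD(2)[OF f] complex_norm_square[of "f x"] by (simp add: mult.commute)
  qed
qed

lemma topspace_uniform_topology: "topspace (uniform_topology X) = carrier (circle_maps X)"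
  by (simp add: uniform_topology_def carrier_circle_maps_mspace del: mspace_cfunspace)

lemma continuous_map_circle_maps_mult:
  "continuous_map (prod_topology (uniform_topology X) (uniform_topology X)) (uniform_topology X)
    (\<lambda>(f, g). f \<otimes>\<^bsub>circle_maps X\<^esub> g)"
proof -
  let ?C = "cfunspace X circle_metric"
  have car: "mspace ?C = carrier (circle_maps X)" by (rule carrier_circle_maps_mspace[symmetric])
  have "Lipschitz_continuous_map (prod_metric ?C ?C) ?C (\<lambda>(f, g). f \<otimes>\<^bsub>circle_maps X\<^esub> g)"
    unfolding Lipschitz_continuous_map_def mspace_prod_metric mdist_prod_metric car
  \<comment> \<open>As the values have modulus 1, two products are at distance at most
    \<open>a + b\<close>. The product metric is Euclidean, and
    \<open>a + b \<le> 2 * sqrt (a^2 + b^2)\<close> gives the constant 2.\<close>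
  proof (intro conjI exI[of _ 2] ballI)
    show "(\<lambda>(f, g). f \<otimes>\<^bsub>circle_maps X\<^esub> g) \<in> carrier (circle_maps X) \<times> carrier (circle_maps X) \<rightarrow> carrier (circle_maps X)"
      by (auto intro: circle_maps_mult_closed)
    fix p q assume "p \<in> carrier (circle_maps X) \<times> carrier (circle_maps X)" "q \<in> carrier (circle_maps X) \<times> carrier (circle_maps X)"
    then obtain f g f' g' where p: "p = (f, g)" "f \<in> carrier (circle_maps X)" "g \<in> carrier (circle_maps X)"
      and q: "q = (f', g')" "f' \<in> carrier (circle_maps X)" "g' \<in> carrier (circle_maps X)" by blast
    define a where "a = mdist ?C f f'"
    define b where "b = mdist ?C g g'"
    have ab: "0 \<le> a" "0 \<le> b" by (simp_all add: a_def b_def)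
    have le: "a \<le> sqrt (a\<^sup>2 + b\<^sup>2)" "b \<le> sqrt (a\<^sup>2 + b\<^sup>2)"
      using ab by (auto intro!: real_le_rsqrt)
    have "mdist ?C (f \<otimes>\<^bsub>circle_maps X\<^esub> g) (f' \<otimes>\<^bsub>circle_maps X\<^esub> g') \<le> a + b"
    proof (subst mdist_circle_maps_le)
      show "\<forall>x\<in>topspace X. cmod ((f \<otimes>\<^bsub>circle_maps X\<^esub> g) x - (f' \<otimes>\<^bsub>circle_maps X\<^esub> g') x) \<le> a + b"
      proof
        fix x assume x: "x \<in> topspace X"
        have "f x * g x - f' x * g' x = (f x - f' x) * g x + f' x * (g x - g' x)" by (simp add: algebra_simps)
        then have "cmod (f x * g x - f' x * g' x) \<le> cmod ((f x - f' x) * g x) + cmod (f' x * (g x - g' x))"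
          by (metis norm_triangle_ineq)
        also have "\<dots> = cmod (f x - f' x) + cmod (g x - g' x)"
          using circle_mapsD(2)[OF p(3) x] circle_mapsD(2)[OF q(2) x] by (simp add: norm_mult)
        also have "\<dots> \<le> a + b"
          using mdist_circle_maps_le[OF p(2) q(2) ab(1)] mdist_circle_maps_le[OF p(3) q(3) ab(2)] x
          by (intro add_mono) (auto simp: a_def b_def)
        finally show "cmod ((f \<otimes>\<^bsub>circle_maps X\<^esub> g) x - (f' \<otimes>\<^bsub>circle_maps X\<^esub> g') x) \<le> a + b"
          using x by (simp add: circle_maps_mult)
      qed
    qed (use p q ab in \<open>simp_all add: circle_maps_mult_closed\<close>)
    also have "\<dots> \<le> 2 * sqrt (a\<^sup>2 + b\<^sup>2)" using le by linarith
    finally show "mdist ?C ((\<lambda>(f, g). f \<otimes>\<^bsub>circle_maps X\<^esub> g) p) ((\<lambda>(f, g). f \<otimes>\<^bsub>circle_maps X\<^esub> g) q)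
        \<le> 2 * prod_dist (mdist ?C) (mdist ?C) p q"
      by (simp only: p(1) q(1) prod.case prod_dist_def a_def b_def)
  qed
  from Lipschitz_continuous_imp_continuous_map[OF this] show ?thesis
    unfolding uniform_topology_def mtopology_of_prod_metric .
qed

lemma continuous_map_circle_maps_inv:
  "continuous_map (uniform_topology X) (uniform_topology X) (\<lambda>f. inv\<^bsub>circle_maps X\<^esub> f)"
proof -
  let ?C = "cfunspace X circle_metric"
  have car: "mspace ?C = carrier (circle_maps X)" by (rule carrier_circle_maps_mspace[symmetric])
  have "Lipschitz_continuous_map ?C ?C (\<lambda>f. inv\<^bsub>circle_maps X\<^esub> f)"
    unfolding Lipschitz_continuous_map_def car
  proof (intro conjI exI[of _ 1] ballI)
    show "(\<lambda>f. inv\<^bsub>circle_maps X\<^esub> f) \<in> carrier (circle_maps X) \<rightarrow> carrier (circle_maps X)"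
      by (auto intro: group.inv_closed[OF group_circle_maps])
    fix f g assume f: "f \<in> carrier (circle_maps X)" and g: "g \<in> carrier (circle_maps X)"
    have "\<forall>x\<in>topspace X. cmod (f x - g x) \<le> mdist ?C f g"
      using mdist_circle_maps_le[OF f g, of "mdist ?C f g"] by simp
    moreover have "cmod (cnj z - cnj w) = cmod (z - w)" for z w
      by (metis complex_cnj_diff complex_mod_cnj)
    ultimately have "mdist ?C (inv\<^bsub>circle_maps X\<^esub> f) (inv\<^bsub>circle_maps X\<^esub> g) \<le> mdist ?C f g"
      by (subst mdist_circle_maps_le)
        (simp_all add: inv_circle_maps f g circle_maps_cnj_closed)
    then show "mdist ?C (inv\<^bsub>circle_maps X\<^esub> f) (inv\<^bsub>circle_maps X\<^esub> g) \<le> 1 * mdist ?C f g" by simp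
  qed
  from Lipschitz_continuous_imp_continuous_map[OF this] show ?thesis unfolding uniform_topology_def .
qed

section \<open>Completeness and separability of the uniform topology\<close>

lemma mcomplete_circle: "Metric_space.mcomplete (sphere (0::complex) 1) dist"
proof -
  interpret C: Metric_space "sphere (0::complex) 1" dist
    by unfold_locales (auto simp: dist_commute dist_triangle)
  have "C.mtopology = mtopology_of circle_metric" by (simp add: mtopology_of_def)
  then have "C.mtopology = top_of_set (sphere 0 1)" by (simp add: mtopology_of_circle_metric)
  then have "compact_space C.mtopology"
    by (simp add: compact_space_subtopology compactin_euclidean_iff)
  then show ?thesis by (rule C.compact_space_imp_mcomplete)
qed

lemma completely_metrizable_uniform_topology: "completely_metrizable_space (uniform_topology X)"
proof -
  interpret C: Metric_space "sphere (0::complex) 1" dist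
    by unfold_locales (auto simp: dist_commute dist_triangle)
  have "circle_metric = C.Self"
    using C.Metric_space_axioms unfolding C.Self_def circle_metric_def submetric_def by simp
  then have "mcomplete_of (cfunspace X circle_metric)"
    using C.mcomplete_cfunspace[OF mcomplete_circle] by simp
  then show ?thesis
    unfolding uniform_topology_def mtopology_of_def mcomplete_of_def
    by (rule Metric_space.completely_metrizable_space_mtopology[OF Metric_space_mspace_mdist])
qed

lemma circle_maps_uniformly_continuous:
  fixes m :: "'a metric"
  assumes cpt: "compact_space (mtopology_of m)" and f: "f \<in> carrier (circle_maps (mtopology_of m))" and e: "\<epsilon> > 0"
  shows "\<exists>\<delta>>0. \<forall>x\<in>mspace m. \<forall>y\<in>mspace m. mdist m x y < \<delta> \<longrightarrow> cmod (f x - f y) < \<epsilon>"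
proof -
  have "continuous_map (mtopology_of m) (mtopology_of euclidean_metric) f"
    using circle_mapsD(3)[OF f] by simp
  then have "uniformly_continuous_map m euclidean_metric f"
    using cpt by (intro continuous_imp_uniformly_continuous_map) simp
  then have "\<forall>\<epsilon>>0. \<exists>\<delta>>0. \<forall>x\<in>mspace m. \<forall>y\<in>mspace m. mdist m y x < \<delta> \<longrightarrow> dist (f y) (f x) < \<epsilon>"
    unfolding uniformly_continuous_map_def by simp
  then obtain \<delta> where "\<delta> > 0" "\<forall>x\<in>mspace m. \<forall>y\<in>mspace m. mdist m y x < \<delta> \<longrightarrow> dist (f y) (f x) < \<epsilon>"
    using e by blast
  then show ?thesis unfolding dist_norm by blast
qed

text \<open>Countably many data (mesh, precision, values on a finite net) suffice to locate a map up to
  a prescribed uniform error; one map is chosen for each realizable datum.\<close>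

lemma separable_uniform_topology:
  fixes m :: "'a metric"
  assumes cpt: "compact_space (mtopology_of m)"
  shows "separable_space (uniform_topology (mtopology_of m))"
proof -
  interpret M: Metric_space "mspace m" "mdist m" by (rule Metric_space_mspace_mdist)
  let ?X = "mtopology_of m"
  let ?C = "cfunspace ?X circle_metric"
  interpret C: Metric_space "mspace ?C" "mdist ?C" by (rule Metric_space_mspace_mdist)
  have topX: "topspace ?X = mspace m" by simp
  obtain D :: "complex set" where D: "countable D" "\<And>U. open U \<Longrightarrow> U \<noteq> {} \<Longrightarrow> \<exists>d\<in>D. d \<in> U"
    using countable_dense_exists[where 'a=complex] by blast
  have "M.mtotally_bounded (mspace m)"
    using cpt by (intro M.compactin_imp_mtotally_bounded) (simp add: compact_space_def mtopology_of_def)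
  then have "\<forall>k. \<exists>K. finite K \<and> K \<subseteq> mspace m \<and> mspace m \<subseteq> (\<Union>x\<in>K. M.mball x (1 / real (Suc k)))"
    unfolding M.mtotally_bounded_def by simp
  from choice[OF this] obtain K where K: "\<forall>k. finite (K k) \<and> K k \<subseteq> mspace m \<and> mspace m \<subseteq> (\<Union>x\<in>K k. M.mball x (1 / real (Suc k)))" ..
  define good where "good k n q g \<longleftrightarrow> g \<in> mspace ?C \<and> (\<forall>x\<in>K k. cmod (g x - q x) < 1 / real (Suc n)) \<and>
    (\<forall>x\<in>mspace m. \<forall>y\<in>mspace m. mdist m x y < 1 / real (Suc k) \<longrightarrow> cmod (g x - g y) < 1 / real (Suc n))" for k n q g
  \<comment> \<open>The values \<open>q\<close> come from a dense set of the plane and may lie off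
    the circle; only data met by an actual map are kept.\<close>
  define I where "I = {(k, n, q). q \<in> PiE (K k) (\<lambda>_. D) \<and> (\<exists>g. good k n q g)}"
  define G where "G = (\<lambda>(k, n, q). SOME g. good k n q g) ` I"
  have "countable (SIGMA k:UNIV. SIGMA n:(UNIV::nat set). PiE (K k) (\<lambda>_. D))"
    using K D(1) by (intro countable_SIGMA countable_PiE) auto
  then have "countable I" by (rule countable_subset[rotated]) (auto simp: I_def)
  then have cG: "countable G" unfolding G_def by (rule countable_image)
  have good: "good k n q (SOME g. good k n q g)" if "(k, n, q) \<in> I" for k n q
  proof -
    have "\<exists>g. good k n q g" using that by (simp add: I_def)
    then show ?thesis by (rule someI_ex)
  qed
  have GM: "G \<subseteq> mspace ?C" using good unfolding G_def good_def by fastforce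
  have "\<exists>g\<in>G. g \<in> C.mball f r" if f: "f \<in> mspace ?C" and r: "r > 0" for f r
  proof -
    have fc: "f \<in> carrier (circle_maps ?X)" using f by (simp only: carrier_circle_maps_mspace)
    \<comment> \<open>The final estimate passes from \<open>f y\<close> through \<open>f x\<close>,
      \<open>q x\<close> and \<open>g x\<close> to \<open>g y\<close>, in four steps of size below
      \<open>1 / Suc n\<close> each.\<close>
    obtain n where n: "4 / real (Suc n) < r"
    proof -
      obtain n where "1 / real (Suc n) < r / 4" using nat_approx_posE[of "r / 4"] r by auto
      then show thesis using that[of n] by simp
    qed
    have pos: "0 < 1 / real (Suc n)" by simp
    obtain \<delta> where \<delta>: "\<delta> > 0" "\<forall>x\<in>mspace m. \<forall>y\<in>mspace m. mdist m x y < \<delta> \<longrightarrow> cmod (f x - f y) < 1 / real (Suc n)"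
      using circle_maps_uniformly_continuous[OF cpt fc pos] by blast
    obtain k where k: "1 / real (Suc k) < \<delta>" using nat_approx_posE[OF \<delta>(1)] by auto
    have "\<forall>x. \<exists>z. z \<in> D \<and> cmod (f x - z) < 1 / real (Suc n)"
    proof
      fix x
      have "\<exists>z\<in>D. z \<in> ball (f x) (1 / real (Suc n))" by (rule D(2)) (use pos in auto)
      then show "\<exists>z. z \<in> D \<and> cmod (f x - z) < 1 / real (Suc n)" by (auto simp: dist_norm)
    qed
    from choice[OF this] obtain z where z: "\<forall>x. z x \<in> D \<and> cmod (f x - z x) < 1 / real (Suc n)" ..
    define q where "q = restrict z (K k)"
    have gf: "good k n q f"
      unfolding good_def q_def using f z \<delta>(2) k by auto
    then have I: "(k, n, q) \<in> I" using z unfolding I_def q_def by auto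
    define g where "g = (SOME g. good k n q g)"
    have gg: "good k n q g" unfolding g_def by (rule good[OF I])
    have gC: "g \<in> mspace ?C" using gg by (simp only: good_def)
    have gc: "g \<in> carrier (circle_maps ?X)" using gC by (simp only: carrier_circle_maps_mspace)
    have "\<forall>y\<in>topspace ?X. cmod (f y - g y) \<le> 4 / real (Suc n)"
    proof
      fix y assume "y \<in> topspace ?X"
      then have y: "y \<in> mspace m" by simp
      then obtain x where x: "x \<in> K k" "y \<in> M.mball x (1 / real (Suc k))" using K by blast
      then have xm: "x \<in> mspace m" "mdist m x y < 1 / real (Suc k)" by auto
      have "cmod (f x - f y) < 1 / real (Suc n)" "cmod (g x - g y) < 1 / real (Suc n)"
        "cmod (f x - q x) < 1 / real (Suc n)" "cmod (g x - q x) < 1 / real (Suc n)"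
        using gf gg x(1) xm y unfolding good_def by blast+
      moreover have "f y - g y = - (f x - f y) + (f x - q x) - (g x - q x) + (g x - g y)" by simp
      then have "cmod (f y - g y) \<le> cmod (f x - f y) + cmod (f x - q x) + cmod (g x - q x) + cmod (g x - g y)"
        by (smt (verit) norm_minus_cancel norm_triangle_ineq norm_triangle_ineq4)
      ultimately show "cmod (f y - g y) \<le> 4 / real (Suc n)"
        by (simp add: add_divide_distrib[symmetric])
    qed
    then have "mdist ?C f g \<le> 4 / real (Suc n)"
      using mdist_circle_maps_le[OF fc gc, of "4 / real (Suc n)"] by simp
    then have "g \<in> C.mball f r" unfolding C.in_mball using n f gC by linarith
    moreover have "g \<in> G" unfolding G_def g_def using I by (intro image_eqI[OF _ I]) simp
    ultimately show ?thesis by blast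
  qed
  then have "C.mtopology closure_of G = topspace C.mtopology"
    unfolding C.metric_closure_of C.topspace_mtopology by blast
  moreover have "G \<subseteq> topspace C.mtopology" using GM by (simp only: C.topspace_mtopology)
  moreover have "uniform_topology ?X = C.mtopology"
    unfolding uniform_topology_def by (simp only: mtopology_of_def)
  ultimately show ?thesis
    unfolding separable_space_def using cG by metis
qed

proposition polish_group_circle_maps:
  fixes m :: "'a metric"
  assumes "compact_space (mtopology_of m)"
  shows "polish_group (circle_maps (mtopology_of m)) (uniform_topology (mtopology_of m))"
  unfolding polish_group_def polish_space_on_def
  using group_circle_maps topspace_uniform_topology continuous_map_circle_maps_mult continuous_map_circle_maps_inv
    completely_metrizable_uniform_topology separable_uniform_topology[OF assms] by blast

section \<open>Walsh functions\<close>

definition rad :: "nat \<Rightarrow> (nat \<Rightarrow> bool) \<Rightarrow> real" where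
  "rad k x = (if x k then 1 else -1)"

text \<open>The binary digits of \<open>m\<close> code a finite set of bits, so the natural numbers
  enumerate the characters of the Cantor group.\<close>

definition walsh :: "nat \<Rightarrow> (nat \<Rightarrow> bool) \<Rightarrow> real" where
  "walsh m x = (\<Prod>k\<in>set_decode m. rad k x)"

text \<open>The complex functions are regarded as a real Hilbert space, since Gaussian coordinates
  are real: each Walsh function occurs twice, at \<open>2 * m\<close> and, multiplied by
  \<open>\<i>\<close>, at \<open>2 * m + 1\<close>.\<close>

definition wbase :: "nat \<Rightarrow> (nat \<Rightarrow> bool) \<Rightarrow> complex" where
  "wbase j x = (if even j then 1 else \<i>) * complex_of_real (walsh (j div 2) x)"

definition coin :: "(nat \<Rightarrow> bool) measure" where
  "coin = PiM UNIV (\<lambda>_. measure_pmf (bernoulli_pmf (1/2)))"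

interpretation coin: prob_space coin
  unfolding coin_def by (rule prob_space_PiM) (rule prob_space_measure_pmf)

lemma rad_square: "rad k x * rad k x = 1"
  by (simp add: rad_def)

lemma abs_walsh: "\<bar>walsh m x\<bar> = 1"
  unfolding walsh_def abs_prod by (rule prod.neutral) (simp add: rad_def)

lemma norm_wbase: "cmod (wbase j x) = 1"
  by (simp add: wbase_def norm_mult abs_walsh)

lemma measurable_rad [measurable]: "rad k \<in> borel_measurable coin"
proof -
  have "(\<lambda>x. x k) \<in> measurable coin (measure_pmf (bernoulli_pmf (1/2)))"
    unfolding coin_def by (rule measurable_component_singleton) simp
  from measurable_compose[OF this, of "\<lambda>b. if b then 1 else -1 :: real" borel]
  show ?thesis by (simp add: rad_def[abs_def])
qed

lemma measurable_walsh [measurable]: "walsh m \<in> borel_measurable coin"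
  unfolding walsh_def[abs_def] by measurable

lemma measurable_wbase [measurable]: "wbase j \<in> borel_measurable coin"
  unfolding wbase_def[abs_def] by measurable

lemma borel_measurable_cnj [measurable]:
  "f \<in> borel_measurable M \<Longrightarrow> (\<lambda>x. cnj (f x)) \<in> borel_measurable M"
  by (rule measurable_compose[OF _ borel_measurable_continuous_onI[OF continuous_on_cnj[OF continuous_on_id]]])

lemma finite_set_decode_Un: "finite (set_decode m \<union> set_decode n)"
  by (simp add: finite_set_decode)

text \<open>The bits are independent, and an odd power of a fair sign has mean 0.\<close>

lemma coin_integral_rad_prod:
  assumes F: "finite F" and k: "k \<in> F" "odd (e k)"
  shows "(\<integral>x. (\<Prod>k\<in>F. rad k x ^ e k) \<partial>coin) = 0"
proof -
  let ?B = "measure_pmf (bernoulli_pmf (1/2))"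
  have "(\<integral>x. (\<Prod>k\<in>F. (if x k then 1 else -1 :: real) ^ e k) \<partial>coin) =
    (\<Prod>k\<in>F. \<integral>b. (if b then 1 else -1 :: real) ^ e k \<partial>?B)"
    unfolding coin_def
    by (rule integral_PiM_prod[OF prob_space_measure_pmf F, where g="\<lambda>k b. (if b then 1 else -1 :: real) ^ e k"])
      (rule integrable_measure_pmf_finite, simp)
  moreover have "(\<integral>b. (if b then 1 else -1 :: real) ^ e k \<partial>?B) = 0"
    using k(2) by (subst integral_bernoulli_pmf) auto
  ultimately show ?thesis
    unfolding rad_def using F k(1) by (simp add: prod_zero_iff) blast
qed

text \<open>Exponents record membership of an index in the two bit sets.\<close>

lemma walsh_mult:
  "walsh m x * walsh n x =
    (\<Prod>k\<in>set_decode m \<union> set_decode n. rad k x ^ (of_bool (k \<in> set_decode m) + of_bool (k \<in> set_decode n)))"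
proof -
  let ?F = "set_decode m \<union> set_decode n"
  have w: "walsh l x = (\<Prod>k\<in>?F. rad k x ^ of_bool (k \<in> set_decode l))" if "set_decode l \<subseteq> ?F" for l
    unfolding walsh_def using that
    by (intro prod.mono_neutral_cong_left finite_set_decode_Un) auto
  show ?thesis by (simp only: w[of m, OF Un_upper1] w[of n, OF Un_upper2] prod.distrib[symmetric] power_add)
qed

lemma coin_walsh_orthonormal:
  "(\<integral>x. walsh m x * walsh n x \<partial>coin) = (if m = n then 1 else 0)"
proof (cases "m = n")
  case True
  have "walsh n x * walsh n x = 1" for x
    using abs_walsh[of n x] by (metis abs_mult_self_eq mult_1)
  then show ?thesis using True coin.prob_space by simp
next
  case False
  then have "set_decode m \<noteq> set_decode n" by (metis set_decode_inverse)
  then obtain k where "k \<in> set_decode m \<union> set_decode n" "(k \<in> set_decode m) \<noteq> (k \<in> set_decode n)" by blast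
  then show ?thesis using False unfolding walsh_mult
    by (simp only: if_False) (rule coin_integral_rad_prod[OF finite_set_decode_Un, of k], auto)
qed

text \<open>The bit \<open>k\<close> occurs in neither Walsh function, so in the product it keeps
  the exponent 1.\<close>

lemma rad_walsh_orthogonal:
  assumes "k \<notin> set_decode m" "k \<notin> set_decode n"
  shows "(\<integral>x. rad k x * (walsh m x * walsh n x) \<partial>coin) = 0"
proof -
  let ?F = "insert k (set_decode m \<union> set_decode n)"
  let ?e = "\<lambda>l. if l = k then 1 else of_bool (l \<in> set_decode m) + of_bool (l \<in> set_decode n) :: nat"
  have "rad k x * (walsh m x * walsh n x) = (\<Prod>l\<in>?F. rad l x ^ ?e l)" for x
    unfolding walsh_mult using assms finite_set_decode_Un[of m n]
    by (subst prod.insert) (auto intro!: prod.cong)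
  then show ?thesis
    by (simp only:) (rule coin_integral_rad_prod[of ?F k], auto simp: finite_set_decode)
qed

lemma coin_integrable_bounded:
  fixes f :: "(nat \<Rightarrow> bool) \<Rightarrow> 'c::{banach, second_countable_topology}"
  assumes "f \<in> borel_measurable coin" "\<And>x. norm (f x) \<le> B"
  shows "integrable coin f"
  using assms by (intro coin.integrable_const_bound[of _ B]) auto

text \<open>The integral of the real part is the inner product of the underlying real space. For
  indices of different parity the product is purely imaginary and the integrand vanishes
  identically.\<close>

lemma coin_wbase_orthonormal:
  "(\<integral>x. Re (wbase i x * cnj (wbase j x)) \<partial>coin) = (if i = j then 1 else 0)"
proof (cases "even i = even j")
  case True
  then have "Re (wbase i x * cnj (wbase j x)) = walsh (i div 2) x * walsh (j div 2) x" for x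
    by (cases "even i") (simp_all add: wbase_def)
  moreover have "i div 2 = j div 2 \<longleftrightarrow> i = j" using True
    by (metis dvd_mult_div_cancel odd_two_times_div_two_succ)
  ultimately show ?thesis by (simp add: coin_walsh_orthonormal)
next
  case False
  then have "Re (wbase i x * cnj (wbase j x)) = 0" for x
    by (cases "even i") (simp_all add: wbase_def)
  moreover have "i \<noteq> j" using False by blast
  ultimately show ?thesis by simp
qed

text \<open>Multiplication by a bit of high order moves a Walsh function out of the span of those of
  low order; the factor \<open>\<i>\<close> is immaterial here.\<close>

lemma coin_wbase_rad_orthogonal:
  assumes "k \<notin> set_decode (i div 2)" "k \<notin> set_decode (j div 2)"
  shows "(\<integral>x. Re (wbase i x * cnj (\<i> * rad k x * wbase j x)) \<partial>coin) = 0"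
proof -
  have "\<exists>c. \<forall>x. Re (wbase i x * cnj (\<i> * rad k x * wbase j x)) =
      c * (rad k x * (walsh (i div 2) x * walsh (j div 2) x))"
    by (cases "even i"; cases "even j"; rule exI[of _ "if even i \<longleftrightarrow> even j then 0 else if even i then -1 else 1"])
      (simp_all add: wbase_def)
  then obtain c where c: "\<And>x. Re (wbase i x * cnj (\<i> * rad k x * wbase j x)) =
      c * (rad k x * (walsh (i div 2) x * walsh (j div 2) x))" by blast
  show ?thesis unfolding c by (simp add: rad_walsh_orthogonal[OF assms])
qed

text \<open>Signs square to 1, so multiplying by one of them toggles membership of \<open>k\<close>
  in the index set; the parity of \<open>j\<close>, which records the factor \<open>\<i>\<close>,
  stays. Sign multiplications thus map the basis into itself.\<close>

lemma rad_wbase: "\<exists>j'. \<forall>x. complex_of_real (rad k x) * wbase j x = wbase j' x"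
proof -
  define S where "S = (if k \<in> set_decode (j div 2) then set_decode (j div 2) - {k} else insert k (set_decode (j div 2)))"
  have fS: "finite S" by (simp add: S_def finite_set_decode)
  have ws: "walsh (set_encode S) x = (\<Prod>l\<in>S. rad l x)" for x
    unfolding walsh_def set_encode_inverse[OF fS] ..
  have w: "rad k x * walsh (j div 2) x = walsh (set_encode S) x" for x
  proof (cases "k \<in> set_decode (j div 2)")
    case True
    have "walsh (j div 2) x = rad k x * (\<Prod>l\<in>set_decode (j div 2) - {k}. rad l x)"
      unfolding walsh_def using True by (rule prod.remove[OF finite_set_decode])
    then show ?thesis
      using True unfolding ws by (simp add: S_def mult.assoc[symmetric] rad_square)
  next
    case False
    then have "(\<Prod>l\<in>S. rad l x) = rad k x * (\<Prod>l\<in>set_decode (j div 2). rad l x)"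
      unfolding S_def by (simp only: if_False) (rule prod.insert[OF finite_set_decode])
    then show ?thesis unfolding ws by (simp only: walsh_def)
  qed
  have "complex_of_real (rad k x) * wbase j x = wbase (2 * set_encode S + j mod 2) x" for x
  proof -
    have "(2 * set_encode S + j mod 2) div 2 = set_encode S" by simp
    then show ?thesis by (simp add: wbase_def w[symmetric])
  qed
  then show ?thesis by blast
qed

section \<open>The isonormal process\<close>

abbreviation wsum :: "nat \<Rightarrow> (nat \<Rightarrow> real) \<Rightarrow> (nat \<Rightarrow> bool) \<Rightarrow> complex" where
  "wsum n c x \<equiv> \<Sum>j<n. complex_of_real (c j) * wbase j x"

text \<open>The isonormal Gaussian process on the span of the basis: a function and a linear form
  with the same coefficients. Written as a relation, its closure under linear operations is shown by
  exhibiting coefficients, and none have to be extracted from a function.\<close>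

definition isonormal :: "((nat \<Rightarrow> bool) \<Rightarrow> complex) \<Rightarrow> ((nat \<Rightarrow> real) \<Rightarrow> real) \<Rightarrow> bool" where
  "isonormal p l \<longleftrightarrow> (\<exists>n c. p = (\<lambda>x. \<Sum>j<n. complex_of_real (c j) * wbase j x) \<and> l = (\<lambda>w. \<Sum>j<n. c j * w j))"

lemma isonormal_wbase: "isonormal (wbase j) (\<lambda>w. w j)"
  unfolding isonormal_def
  by (rule exI[of _ "Suc j"], rule exI[of _ "\<lambda>k. if k = j then 1 else 0"]) (auto simp: fun_eq_iff)

lemma isonormal_scale:
  assumes "isonormal p l"
  shows "isonormal (\<lambda>x. complex_of_real a * p x) (\<lambda>w. a * l w)"
proof -
  obtain n c where "p = (\<lambda>x. \<Sum>j<n. complex_of_real (c j) * wbase j x)" "l = (\<lambda>w. \<Sum>j<n. c j * w j)"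
    using assms unfolding isonormal_def by blast
  then show ?thesis unfolding isonormal_def
    by (intro exI[of _ n] exI[of _ "\<lambda>j. a * c j"]) (simp add: sum_distrib_left mult.assoc)
qed

lemma isonormal_add:
  assumes "isonormal p l" "isonormal q k"
  shows "isonormal (\<lambda>x. p x + q x) (\<lambda>w. l w + k w)"
proof -
  obtain n c where 1: "p = (\<lambda>x. \<Sum>j<n. complex_of_real (c j) * wbase j x)" "l = (\<lambda>w. \<Sum>j<n. c j * w j)"
    using assms(1) unfolding isonormal_def by blast
  obtain m b where 2: "q = (\<lambda>x. \<Sum>j<m. complex_of_real (b j) * wbase j x)" "k = (\<lambda>w. \<Sum>j<m. b j * w j)"
    using assms(2) unfolding isonormal_def by blast
  let ?N = "max n m" and ?e = "\<lambda>j. (if j < n then c j else 0) + (if j < m then b j else 0)"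
  have pad: "(\<Sum>j<n'. complex_of_real (c' j) * wbase j x) = (\<Sum>j<?N. complex_of_real (if j < n' then c' j else 0) * wbase j x)"
    if "n' \<le> ?N" for n' c' x
    using that by (intro sum.mono_neutral_cong_left) auto
  have "p x + q x = (\<Sum>j<?N. complex_of_real (?e j) * wbase j x)" for x
    unfolding 1 2 by (simp only: pad[OF max.cobounded1] pad[OF max.cobounded2] of_real_add distrib_right sum.distrib)
  moreover have "l w + k w = lin ?e ?N w" for w
    unfolding 1 2 by (simp only: sum_lessThan_pad[OF max.cobounded1, of _ w n m]
        sum_lessThan_pad[OF max.cobounded2, of _ w m n] distrib_right sum.distrib)
  ultimately show ?thesis unfolding isonormal_def by (intro exI[of _ ?N] exI[of _ ?e]) simp
qed

lemma isonormal_diff: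
  assumes "isonormal p l" "isonormal q k"
  shows "isonormal (\<lambda>x. p x - q x) (\<lambda>w. l w - k w)"
  using isonormal_add[OF assms(1) isonormal_scale[OF assms(2), of "-1"]] by simp

lemma isonormal_sum:
  fixes n :: nat
  assumes "\<And>j. j < n \<Longrightarrow> isonormal (p j) (l j)"
  shows "isonormal (\<lambda>x. \<Sum>j<n. complex_of_real (c j) * p j x) (\<lambda>w. \<Sum>j<n. c j * l j w)"
  using assms
proof (induction n)
  case 0
  show ?case unfolding isonormal_def by (rule exI[of _ 0]) simp
next
  case (Suc n)
  then have "isonormal (\<lambda>x. (\<Sum>j<n. complex_of_real (c j) * p j x) + complex_of_real (c n) * p n x)
    (\<lambda>w. (\<Sum>j<n. c j * l j w) + c n * l n w)"
    by (intro isonormal_add isonormal_scale) auto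
  then show ?case by simp
qed

lemma isonormal_bounded:
  assumes "isonormal p l"
  shows "\<exists>B. \<forall>x. cmod (p x) \<le> B"
proof -
  obtain n c where p: "p = (\<lambda>x. \<Sum>j<n. complex_of_real (c j) * wbase j x)"
    using assms unfolding isonormal_def by blast
  have "cmod (p x) \<le> (\<Sum>j<n. \<bar>c j\<bar>)" for x
    unfolding p by (rule sum_norm_le) (simp add: norm_mult norm_wbase)
  then show ?thesis by blast
qed

lemma isonormal_measurable:
  assumes "isonormal p l"
  shows "p \<in> borel_measurable coin" "l \<in> borel_measurable borel" "integrable gauss l"
proof -
  obtain n c where pl: "p = (\<lambda>x. \<Sum>j<n. complex_of_real (c j) * wbase j x)" "l = (\<lambda>w. \<Sum>j<n. c j * w j)"
    using assms unfolding isonormal_def by blast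
  show "p \<in> borel_measurable coin" unfolding pl by measurable
  show "l \<in> borel_measurable borel" unfolding pl by measurable
  show "integrable gauss l" unfolding pl by (rule gauss_linear_abs)
qed

text \<open>Bilinearity with a weight \<open>g\<close> kept inside: \<open>g = 1\<close> gives the
  Parseval identity, and a circle-valued \<open>g\<close> gives the matrix of multiplication by
  it.\<close>

lemma coin_inner_sum:
  assumes g [measurable]: "g \<in> borel_measurable coin" and B: "\<And>x. cmod (g x) \<le> B"
  shows "(\<integral>x. Re ((\<Sum>i<n. complex_of_real (a i) * wbase i x) * cnj (g x * wsum m b x)) \<partial>coin) =
    (\<Sum>i<n. \<Sum>j<m. a i * b j * (\<integral>x. Re (wbase i x * cnj (g x * wbase j x)) \<partial>coin))"
proof -
  have int: "integrable coin (\<lambda>x. Re (wbase i x * cnj (g x * wbase j x)))" for i j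
  proof (rule coin_integrable_bounded[where B=B])
    show "(\<lambda>x. Re (wbase i x * cnj (g x * wbase j x))) \<in> borel_measurable coin" by measurable
    show "norm (Re (wbase i x * cnj (g x * wbase j x))) \<le> B" for x
      using abs_Re_le_cmod[of "wbase i x * cnj (g x * wbase j x)"] B[of x] by (simp add: norm_mult norm_wbase)
  qed
  have "Re ((\<Sum>i<n. complex_of_real (a i) * wbase i x) * cnj (g x * wsum m b x)) =
    (\<Sum>i<n. \<Sum>j<m. a i * b j * Re (wbase i x * cnj (g x * wbase j x)))" for x
  proof -
    have "cnj (g x * wsum m b x) =
      (\<Sum>j<m. complex_of_real (b j) * cnj (g x * wbase j x))"
      by (simp add: sum_distrib_left mult_ac)
    then have "(\<Sum>i<n. complex_of_real (a i) * wbase i x) * cnj (g x * wsum m b x) =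
      (\<Sum>i<n. \<Sum>j<m. complex_of_real (a i * b j) * (wbase i x * cnj (g x * wbase j x)))"
      by (simp only: sum_product) (intro sum.cong refl, simp only: of_real_mult mult_ac)
    moreover have "Re (complex_of_real r * z) = r * Re z" for r z by simp
    ultimately show ?thesis by (simp only: Re_sum)
  qed
  then show ?thesis
    by (simp only: Bochner_Integration.integral_sum Bochner_Integration.integrable_sum integrable_mult_right int integral_mult_right_zero)
qed

lemma coin_norm_sum:
  "(\<integral>x. (cmod (wsum n c x))\<^sup>2 \<partial>coin) = (\<Sum>j<n. (c j)\<^sup>2)"
proof -
  have "(cmod z)\<^sup>2 = Re (z * cnj (1 * z))" for z
    unfolding cmod_power2 by (simp add: power2_eq_square)
  then have "(\<integral>x. (cmod (wsum n c x))\<^sup>2 \<partial>coin) =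
    (\<Sum>i<n. \<Sum>j<n. c i * c j * (\<integral>x. Re (wbase i x * cnj (1 * wbase j x)) \<partial>coin))"
    by (simp only:) (rule coin_inner_sum[where g="\<lambda>_. 1" and B=1], simp_all)
  also have "\<dots> = (\<Sum>j<n. (c j)\<^sup>2)"
    unfolding mult_1 coin_wbase_orthonormal by (simp add: if_distrib power2_eq_square cong: if_cong)
  finally show ?thesis .
qed

text \<open>The sup norm dominates the \<open>L\<^sup>2\<close> norm on the Cantor set; this is the
  standard deviation of \<open>l\<close>, which dominates its mean absolute value. The sup norm is
  the one that matches the uniform topology of the group.\<close>

lemma isonormal_abs:
  assumes "isonormal p l" and p: "\<And>x. cmod (p x) \<le> \<delta>"
  shows "(\<integral>w. \<bar>l w\<bar> \<partial>gauss) \<le> \<delta>"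
proof -
  obtain n c where pl: "p = (\<lambda>x. \<Sum>j<n. complex_of_real (c j) * wbase j x)" "l = (\<lambda>w. \<Sum>j<n. c j * w j)"
    using assms unfolding isonormal_def by blast
  have d0: "\<delta> \<ge> 0" using p[of undefined] norm_ge_zero order_trans by blast
  have m: "p \<in> borel_measurable coin" by (rule isonormal_measurable[OF assms(1)])
  have b: "(cmod (p x))\<^sup>2 \<le> \<delta>\<^sup>2" for x using p[of x] by (intro power_mono) auto
  have "(\<Sum>j<n. (c j)\<^sup>2) = (\<integral>x. (cmod (p x))\<^sup>2 \<partial>coin)" unfolding pl coin_norm_sum ..
  also have "\<dots> \<le> (\<integral>x. \<delta>\<^sup>2 \<partial>coin)"
  proof (rule integral_mono)
    show "integrable coin (\<lambda>x. (cmod (p x))\<^sup>2)"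
      by (rule coin_integrable_bounded[where B="\<delta>\<^sup>2"]) (use m b in auto)
  qed (use b in auto)
  also have "\<dots> = \<delta>\<^sup>2" using coin.prob_space by simp
  finally have "sqrt (\<Sum>j<n. (c j)\<^sup>2) \<le> \<delta>" using d0 by (rule real_le_lsqrt[rotated])
  then show ?thesis using gauss_linear_abs(2)[of c n] unfolding pl by linarith
qed

lemma isonormal_cos:
  assumes "isonormal p l"
  shows "(\<integral>w. cos (l w + b) \<partial>gauss) = cos b * exp (- (\<integral>x. (cmod (p x))\<^sup>2 \<partial>coin) / 2)"
proof -
  obtain n c where pl: "p = (\<lambda>x. \<Sum>j<n. complex_of_real (c j) * wbase j x)" "l = (\<lambda>w. \<Sum>j<n. c j * w j)"
    using assms unfolding isonormal_def by blast
  show ?thesis unfolding pl coin_norm_sum by (rule gauss_cos_linear)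
qed

lemma isonormal_rad:
  assumes "isonormal p l"
  shows "\<exists>k. isonormal (\<lambda>x. complex_of_real (rad m x) * p x) k"
proof -
  obtain n c where pl: "p = (\<lambda>x. \<Sum>j<n. complex_of_real (c j) * wbase j x)"
    using assms unfolding isonormal_def by blast
  have "\<forall>j. \<exists>j'. \<forall>x. complex_of_real (rad m x) * wbase j x = wbase j' x" using rad_wbase by blast
  then obtain J where J: "\<And>j x. complex_of_real (rad m x) * wbase j x = wbase (J j) x"
    unfolding choice_iff by blast
  have "isonormal (\<lambda>x. \<Sum>j<n. complex_of_real (c j) * wbase (J j) x) (\<lambda>w. \<Sum>j<n. c j * w (J j))"
    by (rule isonormal_sum[OF isonormal_wbase])
  moreover have "complex_of_real (rad m x) * p x = (\<Sum>j<n. complex_of_real (c j) * wbase (J j) x)" for x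
    unfolding pl J[symmetric] by (simp add: sum_distrib_left mult_ac)
  ultimately show ?thesis by (simp only:) blast
qed

lemma isonormal_const: "\<exists>l. isonormal (\<lambda>_. z) l"
proof -
  have "wbase 0 x = 1" "wbase 1 x = \<i>" for x by (simp_all add: wbase_def walsh_def)
  then have z: "complex_of_real (Re z) * wbase 0 x + complex_of_real (Im z) * wbase 1 x = z" for x
    by (simp add: complex_eq_iff)
  have "isonormal (\<lambda>x. complex_of_real (Re z) * wbase 0 x + complex_of_real (Im z) * wbase 1 x)
      (\<lambda>w. Re z * w 0 + Im z * w 1)"
    by (rule isonormal_add[OF isonormal_scale[OF isonormal_wbase] isonormal_scale[OF isonormal_wbase]])
  then show ?thesis unfolding z by blast
qed

text \<open>Induction on the number of bits: \<open>h\<close> is half the sum of \<open>s\<close>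
  and \<open>rad m * t\<close>, where \<open>s\<close> and \<open>t\<close> are the sum and the
  difference of its two restrictions in bit \<open>m\<close>. These depend on fewer bits, and
  multiplication by \<open>rad m\<close> stays in the span. So the basis spans all cylinder
  functions.\<close>

lemma isonormal_cylinder:
  assumes "\<And>x y. (\<forall>j<m. x j = y j) \<Longrightarrow> h x = h y"
  shows "\<exists>l. isonormal h l"
  using assms
proof (induction m arbitrary: h)
  case 0
  then have "h = (\<lambda>_. h undefined)" by (intro ext) simp
  then show ?case using isonormal_const[of "h undefined"] by simp
next
  case (Suc m)
  have "\<exists>l. isonormal (\<lambda>x. h (x(m := b))) l" for b
  proof (rule Suc.IH, rule Suc.prems)
    fix x y :: "nat \<Rightarrow> bool" assume "\<forall>j<m. x j = y j"
    then show "\<forall>j<Suc m. (x(m := b)) j = (y(m := b)) j" by (simp add: less_Suc_eq)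
  qed
  then obtain l1 l0 where l: "isonormal (\<lambda>x. h (x(m := True))) l1" "isonormal (\<lambda>x. h (x(m := False))) l0" by blast
  define s where "s x = h (x(m := True)) + h (x(m := False))" for x
  define t where "t x = h (x(m := True)) - h (x(m := False))" for x
  have "isonormal s (\<lambda>w. l1 w + l0 w)" unfolding s_def[abs_def] by (rule isonormal_add[OF l])
  moreover have "isonormal t (\<lambda>w. l1 w - l0 w)" unfolding t_def[abs_def] by (rule isonormal_diff[OF l])
  then obtain k where "isonormal (\<lambda>x. complex_of_real (rad m x) * t x) k" using isonormal_rad by blast
  ultimately have "isonormal (\<lambda>x. complex_of_real (1/2) * (s x + complex_of_real (rad m x) * t x))
      (\<lambda>w. (1/2) * (l1 w + l0 w + k w))"
    by (intro isonormal_scale isonormal_add)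
  moreover have "complex_of_real (1/2) * (s x + complex_of_real (rad m x) * t x) = h x" for x
  proof (cases "x m")
    case True
    then have "x(m := True) = x" using fun_upd_triv[of x m] by simp
    then show ?thesis using True by (simp add: s_def t_def rad_def)
  next
    case False
    then have "x(m := False) = x" using fun_upd_triv[of x m] by simp
    then show ?thesis using False by (simp add: s_def t_def rad_def)
  qed
  ultimately show ?case by auto
qed

text \<open>Uniform continuity for the product topology, expressed by bits; by compactness it is
  plain continuity. In this form it directly yields approximation by cylinder functions.\<close>

definition cantor_cont :: "((nat \<Rightarrow> bool) \<Rightarrow> complex) \<Rightarrow> bool" where
  "cantor_cont h \<longleftrightarrow> (\<forall>\<epsilon>>0. \<exists>m. \<forall>x y. (\<forall>j<m. x j = y j) \<longrightarrow> cmod (h x - h y) \<le> \<epsilon>)"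

lemma cantor_cont_approx:
  assumes h: "cantor_cont h" and e: "\<epsilon> > 0"
  shows "\<exists>p l. isonormal p l \<and> (\<forall>x. cmod (h x - p x) \<le> \<epsilon>)"
proof -
  obtain m where m: "\<And>x y. (\<forall>j<m. x j = y j) \<Longrightarrow> cmod (h x - h y) \<le> \<epsilon>"
    using h e unfolding cantor_cont_def by blast
  \<comment> \<open>All bits from \<open>m\<close> on are set to \<open>False\<close>; this gives a
    cylinder function and leaves the bits below \<open>m\<close> alone.\<close>
  define p where "p x = h (\<lambda>j. j < m \<and> x j)" for x
  have "\<exists>l. isonormal p l"
  proof (rule isonormal_cylinder[of m])
    fix x y :: "nat \<Rightarrow> bool" assume "\<forall>j<m. x j = y j"
    then have "(\<lambda>j. j < m \<and> x j) = (\<lambda>j. j < m \<and> y j)" by auto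
    then show "p x = p y" by (simp add: p_def)
  qed
  moreover have "cmod (h x - p x) \<le> \<epsilon>" for x unfolding p_def by (rule m) simp
  ultimately show ?thesis by blast
qed

lemma cantor_cont_approx_seq:
  assumes h: "cantor_cont h" and e: "\<And>k. \<epsilon> k > 0"
  shows "\<exists>p l. \<forall>k. isonormal (p k) (l k) \<and> (\<forall>x. cmod (h x - p k x) \<le> \<epsilon> k)"
proof -
  have "\<forall>k. \<exists>p l. isonormal p l \<and> (\<forall>x. cmod (h x - p x) \<le> \<epsilon> k)"
    using cantor_cont_approx[OF h e] by blast
  then show ?thesis by (simp only: choice_iff)
qed

lemma cantor_cont_wbase: "cantor_cont (wbase j)"
proof -
  obtain m where m: "set_decode (j div 2) \<subseteq> {..<m}"
    using finite_set_decode[of "j div 2"] finite_nat_iff_bounded by blast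
  have eq: "wbase j x = wbase j y" if "\<forall>k<m. x k = y k" for x y
  proof -
    have "walsh (j div 2) x = walsh (j div 2) y"
      unfolding walsh_def using m that by (intro prod.cong refl) (auto simp: rad_def)
    then show ?thesis by (simp add: wbase_def)
  qed
  show ?thesis
    unfolding cantor_cont_def
  proof (intro allI impI exI[of _ m])
    fix \<epsilon> :: real and x y :: "nat \<Rightarrow> bool" assume "\<epsilon> > 0" "\<forall>k<m. x k = y k"
    then show "cmod (wbase j x - wbase j y) \<le> \<epsilon>" using eq[of x y] by simp
  qed
qed

lemma cantor_cont_bounded:
  assumes "cantor_cont h"
  shows "\<exists>B. \<forall>x. cmod (h x) \<le> B"
proof -
  obtain p l where p: "isonormal p l" "\<And>x. cmod (h x - p x) \<le> 1"
    using cantor_cont_approx[OF assms, of 1] by auto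
  obtain B where B: "\<And>x. cmod (p x) \<le> B" using isonormal_bounded[OF p(1)] by blast
  have "cmod (h x) \<le> 1 + B" for x
    using norm_triangle_ineq[of "h x - p x" "p x"] p(2)[of x] B[of x] by simp
  then show ?thesis by blast
qed

lemma cantor_cont_mult:
  assumes g: "cantor_cont g" and h: "cantor_cont h"
  shows "cantor_cont (\<lambda>x. g x * h x)"
  unfolding cantor_cont_def
proof (intro allI impI)
  fix \<epsilon> :: real assume e: "\<epsilon> > 0"
  obtain B where B: "\<And>x. cmod (g x) \<le> B" using cantor_cont_bounded[OF g] by blast
  obtain C where C: "\<And>x. cmod (h x) \<le> C" using cantor_cont_bounded[OF h] by blast
  have B0: "B \<ge> 0" and C0: "C \<ge> 0"
    using B[of undefined] C[of undefined] norm_ge_zero order_trans by blast+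
  have "\<epsilon> / 2 / (C + 1) > 0" "\<epsilon> / 2 / (B + 1) > 0" using e B0 C0 by simp_all
  note pos = this
  obtain m where m: "\<And>x y. (\<forall>j<m. x j = y j) \<Longrightarrow> cmod (g x - g y) \<le> \<epsilon> / 2 / (C + 1)"
    using g[unfolded cantor_cont_def, rule_format, OF pos(1)] by blast
  obtain n where n: "\<And>x y. (\<forall>j<n. x j = y j) \<Longrightarrow> cmod (h x - h y) \<le> \<epsilon> / 2 / (B + 1)"
    using h[unfolded cantor_cont_def, rule_format, OF pos(2)] by blast
  have "cmod (g x * h x - g y * h y) \<le> \<epsilon>" if xy: "\<forall>j<max m n. x j = y j" for x y
  proof -
    have "g x * h x - g y * h y = (g x - g y) * h x + g y * (h x - h y)" by (simp add: algebra_simps)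
    then have "cmod (g x * h x - g y * h y) \<le> cmod (g x - g y) * cmod (h x) + cmod (g y) * cmod (h x - h y)"
      by (metis norm_mult norm_triangle_ineq)
    also have "\<dots> \<le> (\<epsilon> / 2 / (C + 1)) * (C + 1) + (B + 1) * (\<epsilon> / 2 / (B + 1))"
    proof (intro add_mono mult_mono)
      show "cmod (g x - g y) \<le> \<epsilon> / 2 / (C + 1)" by (rule m) (use xy in simp)
      show "cmod (h x - h y) \<le> \<epsilon> / 2 / (B + 1)" by (rule n) (use xy in simp)
      show "cmod (h x) \<le> C + 1" "cmod (g y) \<le> B + 1" using C[of x] B[of y] by simp_all
    qed (use e B0 C0 in simp_all)
    also have "\<dots> = \<epsilon>"
    proof -
      have "(a / c) * c = a" "c * (a / c) = a" if "c \<noteq> 0" for a c :: real using that by simp_all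
      from this(1)[of "C + 1" "\<epsilon> / 2"] this(2)[of "B + 1" "\<epsilon> / 2"] show ?thesis
        using B0 C0 by linarith
    qed
    finally show ?thesis .
  qed
  then show "\<exists>m. \<forall>x y. (\<forall>j<m. x j = y j) \<longrightarrow> cmod (g x * h x - g y * h y) \<le> \<epsilon>" by blast
qed

lemma cantor_cont_add:
  assumes g: "cantor_cont g" and h: "cantor_cont h"
  shows "cantor_cont (\<lambda>x. g x + h x)"
  unfolding cantor_cont_def
proof (intro allI impI)
  fix \<epsilon> :: real assume e: "\<epsilon> > 0"
  obtain m where m: "\<And>x y. (\<forall>j<m. x j = y j) \<Longrightarrow> cmod (g x - g y) \<le> \<epsilon> / 2"
    using g[unfolded cantor_cont_def, rule_format, OF half_gt_zero[OF e]] by blast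
  obtain n where n: "\<And>x y. (\<forall>j<n. x j = y j) \<Longrightarrow> cmod (h x - h y) \<le> \<epsilon> / 2"
    using h[unfolded cantor_cont_def, rule_format, OF half_gt_zero[OF e]] by blast
  have "cmod (g x + h x - (g y + h y)) \<le> \<epsilon>" if xy: "\<forall>j<max m n. x j = y j" for x y
  proof -
    have "cmod (g x - g y) \<le> \<epsilon> / 2" by (rule m) (use xy in simp)
    moreover have "cmod (h x - h y) \<le> \<epsilon> / 2" by (rule n) (use xy in simp)
    ultimately show ?thesis using norm_diff_triangle_ineq[of "g x" "h x" "g y" "h y"] by linarith
  qed
  then show "\<exists>m. \<forall>x y. (\<forall>j<m. x j = y j) \<longrightarrow> cmod (g x + h x - (g y + h y)) \<le> \<epsilon>" by blast
qed

lemma cantor_cont_const: "cantor_cont (\<lambda>_. z)"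
  unfolding cantor_cont_def by simp

lemma cantor_cont_isonormal:
  assumes "isonormal p l"
  shows "cantor_cont p"
proof -
  obtain n c where p: "p = (\<lambda>x. \<Sum>j<n. complex_of_real (c j) * wbase j x)"
    using assms unfolding isonormal_def by blast
  show ?thesis unfolding p
  proof (induction n)
    case 0
    show ?case using cantor_cont_const[of 0] by simp
  next
    case (Suc n)
    show ?case
      using cantor_cont_add[OF Suc cantor_cont_mult[OF cantor_cont_const cantor_cont_wbase]] by simp
  qed
qed

section \<open>Extension of the process to continuous functions by limits in mean\<close>

lemma L1_summable_limit:
  fixes f :: "nat \<Rightarrow> 'b \<Rightarrow> real"
  assumes int: "\<And>k. integrable M (f k)" and sm: "summable (\<lambda>k. \<integral>x. \<bar>f k x\<bar> \<partial>M)"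
  shows "\<exists>g. integrable M g \<and> (\<lambda>n. \<integral>x. \<bar>g x - (\<Sum>k<n. f k x)\<bar> \<partial>M) \<longlonglongrightarrow> 0"
proof -
  have mf [measurable]: "f k \<in> borel_measurable M" for k using int by auto
  have nn: "0 \<le> (\<integral>x. \<bar>f k x\<bar> \<partial>M)" for k by simp
  have "(\<integral>\<^sup>+x. (\<Sum>k. ennreal \<bar>f k x\<bar>) \<partial>M) = (\<Sum>k. \<integral>\<^sup>+x. ennreal \<bar>f k x\<bar> \<partial>M)"
    by (rule nn_integral_suminf) measurable
  also have "\<dots> = (\<Sum>k. ennreal (\<integral>x. \<bar>f k x\<bar> \<partial>M))"
    by (intro suminf_cong nn_integral_eq_integral integrable_abs int) auto
  also have "\<dots> = ennreal (\<Sum>k. \<integral>x. \<bar>f k x\<bar> \<partial>M)" by (rule suminf_ennreal2[OF nn sm])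
  finally have "(\<integral>\<^sup>+x. (\<Sum>k. ennreal \<bar>f k x\<bar>) \<partial>M) \<noteq> \<infinity>" by simp
  then have "AE x in M. (\<Sum>k. ennreal \<bar>f k x\<bar>) \<noteq> \<infinity>"
    by (intro nn_integral_PInf_AE) measurable
  then have AEs: "AE x in M. summable (\<lambda>k. \<bar>f k x\<bar>)"
    by (rule eventually_mono) (rule summable_suminf_not_top, simp_all)
  let ?g = "\<lambda>x. \<Sum>k. f k x" and ?H = "\<lambda>x. \<Sum>k. \<bar>f k x\<bar>"
  have ig: "integrable M ?g"
    by (rule integrable_suminf[OF int]) (use AEs sm in \<open>simp_all add: real_norm_def\<close>)
  have iH: "integrable M ?H"
    by (rule integrable_suminf[OF integrable_abs[OF int]]) (use AEs sm in \<open>simp_all add: real_norm_def\<close>)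
  have "(\<lambda>n. \<integral>x. \<bar>?g x - (\<Sum>k<n. f k x)\<bar> \<partial>M) \<longlonglongrightarrow> (\<integral>x. 0 \<partial>M)"
  proof (rule integral_dominated_convergence[where w="\<lambda>x. 2 * ?H x"])
    show "integrable M (\<lambda>x. 2 * ?H x)" by (rule integrable_mult_right[OF iH])
    show "AE x in M. (\<lambda>n. \<bar>?g x - (\<Sum>k<n. f k x)\<bar>) \<longlonglongrightarrow> 0"
      using AEs
    proof (rule eventually_mono)
      fix x assume "summable (\<lambda>k. \<bar>f k x\<bar>)"
      then have "(\<lambda>n. \<Sum>k<n. f k x) \<longlonglongrightarrow> ?g x" by (rule summable_LIMSEQ[OF summable_rabs_cancel])
      from tendsto_rabs[OF tendsto_diff[OF tendsto_const[of "?g x"] this]]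
      show "(\<lambda>n. \<bar>?g x - (\<Sum>k<n. f k x)\<bar>) \<longlonglongrightarrow> 0" by simp
    qed
    show "AE x in M. norm \<bar>?g x - (\<Sum>k<n. f k x)\<bar> \<le> 2 * ?H x" for n
      using AEs
    proof (rule eventually_mono)
      fix x assume s: "summable (\<lambda>k. \<bar>f k x\<bar>)"
      have "\<bar>?g x\<bar> \<le> ?H x" by (rule summable_rabs[OF s])
      moreover have "\<bar>\<Sum>k<n. f k x\<bar> \<le> (\<Sum>k<n. \<bar>f k x\<bar>)" by (rule sum_abs)
      moreover have "(\<Sum>k<n. \<bar>f k x\<bar>) \<le> ?H x" by (rule sum_le_suminf[OF s]) auto
      ultimately show "norm \<bar>?g x - (\<Sum>k<n. f k x)\<bar> \<le> 2 * ?H x"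
        unfolding real_norm_def abs_idempotent by linarith
    qed
    show "(\<lambda>x. \<bar>?g x - (\<Sum>k<n. f k x)\<bar>) \<in> borel_measurable M" for n by measurable
  qed simp
  then have "(\<lambda>n. \<integral>x. \<bar>?g x - (\<Sum>k<n. f k x)\<bar> \<partial>M) \<longlonglongrightarrow> 0" by simp
  with ig show ?thesis by blast
qed

lemma L1_triangle:
  fixes a b c :: "'b \<Rightarrow> real"
  assumes "integrable M a" "integrable M b" "integrable M c"
  shows "(\<integral>x. \<bar>a x - c x\<bar> \<partial>M) \<le> (\<integral>x. \<bar>a x - b x\<bar> \<partial>M) + (\<integral>x. \<bar>b x - c x\<bar> \<partial>M)"
proof -
  have "(\<integral>x. \<bar>a x - c x\<bar> \<partial>M) \<le> (\<integral>x. \<bar>a x - b x\<bar> + \<bar>b x - c x\<bar> \<partial>M)"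
  proof (rule integral_mono)
    show "integrable M (\<lambda>x. \<bar>a x - c x\<bar>)" "integrable M (\<lambda>x. \<bar>a x - b x\<bar> + \<bar>b x - c x\<bar>)"
      using assms by auto
  qed linarith
  also have "\<dots> = (\<integral>x. \<bar>a x - b x\<bar> \<partial>M) + (\<integral>x. \<bar>b x - c x\<bar> \<partial>M)"
    using assms by (intro Bochner_Integration.integral_add integrable_abs Bochner_Integration.integrable_diff)
  finally show ?thesis .
qed

lemma AE_eq_of_L1:
  fixes a b :: "'b \<Rightarrow> real"
  assumes "integrable M a" "integrable M b" "\<And>\<epsilon>. \<epsilon> > 0 \<Longrightarrow> (\<integral>x. \<bar>a x - b x\<bar> \<partial>M) \<le> \<epsilon>"
  shows "AE x in M. a x = b x"
proof -
  have i: "integrable M (\<lambda>x. \<bar>a x - b x\<bar>)" using assms(1,2) by auto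
  have "(\<integral>x. \<bar>a x - b x\<bar> \<partial>M) \<le> 0" by (rule field_le_epsilon) (use assms(3) in simp)
  then have "(\<integral>x. \<bar>a x - b x\<bar> \<partial>M) = 0" by (simp add: order_antisym)
  then have "AE x in M. \<bar>a x - b x\<bar> = 0" using integral_nonneg_eq_0_iff_AE[OF i] by simp
  then show ?thesis by (rule eventually_mono) simp
qed

text \<open>Extension by continuity: linear forms belonging to uniformly close functions are close
  in mean. The estimate is asserted for all approximants and all errors, so it determines the limit
  up to null sets.\<close>

lemma W_exists:
  assumes h: "cantor_cont h"
  shows "\<exists>v. integrable gauss v \<and>
    (\<forall>p l \<delta>. isonormal p l \<longrightarrow> (\<forall>x. cmod (h x - p x) \<le> \<delta>) \<longrightarrow> L1_dist gauss v l \<le> \<delta>)"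
proof -
  \<comment> \<open>Geometric errors make the series of successive differences absolutely summable
    in mean.\<close>
  obtain p l where iso: "\<And>k. isonormal (p k) (l k)" and close: "\<And>k x. cmod (h x - p k x) \<le> (1/2)^k"
    using cantor_cont_approx_seq[OF h, of "\<lambda>k. (1/2)^k"] by auto
  have il: "integrable gauss (l k)" for k by (rule isonormal_measurable[OF iso])
  have dist: "L1_dist gauss (l k) l' \<le> (1/2)^k + \<delta>"
    if iso': "isonormal p' l'" and c: "\<And>x. cmod (h x - p' x) \<le> \<delta>" for k p' l' \<delta>
  proof (rule isonormal_abs[OF isonormal_diff[OF iso iso']])
    fix x
    have "cmod (p k x - p' x) \<le> cmod (h x - p k x) + cmod (h x - p' x)"
      using norm_triangle_ineq4[of "h x - p' x" "h x - p k x"] by simp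
    then show "cmod (p k x - p' x) \<le> (1/2)^k + \<delta>" using close[of x k] c[of x] by linarith
  qed
  \<comment> \<open>Successive differences, headed by \<open>l 0\<close>, so that the partial sum of
    length \<open>Suc n\<close> is \<open>l n\<close>.\<close>
  define f where "f k = (case k of 0 \<Rightarrow> l 0 | Suc j \<Rightarrow> (\<lambda>w. l (Suc j) w - l j w))" for k
  have if_: "integrable gauss (f k)" for k
    unfolding f_def using il by (cases k) auto
  have Sf: "(\<Sum>k<Suc n. f k w) = l n w" for n w
    by (induction n) (simp_all add: f_def)
  have "summable (\<lambda>k. \<integral>w. \<bar>f (Suc k) w\<bar> \<partial>gauss)"
  proof (rule summable_comparison_test')
    show "summable (\<lambda>k. 2 * (1/2)^k :: real)" by (intro summable_mult summable_geometric) simp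
    fix k :: nat assume "0 \<le> k"
    have "(\<integral>w. \<bar>l (Suc k) w - l k w\<bar> \<partial>gauss) \<le> (1/2)^(Suc k) + (1/2)^k" by (rule dist[OF iso close])
    also have "\<dots> \<le> 2 * (1/2)^k" by simp
    finally show "norm (\<integral>w. \<bar>f (Suc k) w\<bar> \<partial>gauss) \<le> 2 * (1/2)^k" by (simp add: f_def)
  qed
  then have sm: "summable (\<lambda>k. \<integral>w. \<bar>f k w\<bar> \<partial>gauss)" by (subst (asm) summable_Suc_iff)
  obtain v where iw: "integrable gauss v" and v: "(\<lambda>n. \<integral>w. \<bar>v w - (\<Sum>k<n. f k w)\<bar> \<partial>gauss) \<longlonglongrightarrow> 0"
    using L1_summable_limit[OF if_ sm] by blast
  have lim: "(\<lambda>n. \<integral>w. \<bar>v w - l n w\<bar> \<partial>gauss) \<longlonglongrightarrow> 0"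
    using LIMSEQ_Suc[OF v] by (simp only: Sf)
  have "L1_dist gauss v l' \<le> \<delta>"
    if iso': "isonormal p' l'" and c: "\<forall>x. cmod (h x - p' x) \<le> \<delta>" for p' l' \<delta>
  proof (rule LIMSEQ_le_const)
    have "(\<lambda>n. L1_dist gauss v (l n) + ((1/2)^n + \<delta>)) \<longlonglongrightarrow> 0 + (0 + \<delta>)"
      by (intro tendsto_add lim tendsto_const LIMSEQ_realpow_zero) auto
    then show "(\<lambda>n. L1_dist gauss v (l n) + ((1/2)^n + \<delta>)) \<longlonglongrightarrow> \<delta>" by simp
    have "L1_dist gauss v l' \<le> L1_dist gauss v (l n) + ((1/2)^n + \<delta>)" for n
      using L1_triangle[OF iw il[of n] isonormal_measurable(3)[OF iso']] dist[OF iso' c[rule_format], of n] by linarith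
    then show "\<exists>N. \<forall>n\<ge>N. L1_dist gauss v l' \<le> L1_dist gauss v (l n) + ((1/2)^n + \<delta>)" by blast
  qed
  with iw show ?thesis by blast
qed

text \<open>An \<open>L\<^sup>1\<close> limit, hence determined only almost everywhere (and arbitrary if the
  argument is not continuous).\<close>

definition W :: "((nat \<Rightarrow> bool) \<Rightarrow> complex) \<Rightarrow> (nat \<Rightarrow> real) \<Rightarrow> real" where
  "W h = (SOME v. integrable gauss v \<and>
    (\<forall>p l \<delta>. isonormal p l \<longrightarrow> (\<forall>x. cmod (h x - p x) \<le> \<delta>) \<longrightarrow> L1_dist gauss v l \<le> \<delta>))"

lemma
  assumes "cantor_cont h"
  shows W_integrable: "integrable gauss (W h)"
    and W_close: "isonormal p l \<Longrightarrow> (\<And>x. cmod (h x - p x) \<le> \<delta>) \<Longrightarrow> L1_dist gauss (W h) l \<le> \<delta>"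
  using someI_ex[OF W_exists[OF assms]] unfolding W_def[symmetric] by blast+

lemma W_measurable: "cantor_cont h \<Longrightarrow> W h \<in> borel_measurable borel"
  using borel_measurable_integrable[OF W_integrable] unfolding measurable_cong_sets[OF sets_gauss refl] .

lemma W_isonormal:
  assumes "isonormal p l"
  shows "AE w in gauss. W p w = l w"
proof (rule AE_eq_of_L1[OF W_integrable[OF cantor_cont_isonormal[OF assms]] isonormal_measurable(3)[OF assms]])
  fix \<epsilon> :: real assume "\<epsilon> > 0"
  then show "L1_dist gauss (W p) l \<le> \<epsilon>"
    by (intro W_close[OF cantor_cont_isonormal[OF assms] assms]) simp
qed

lemma W_L1_le:
  assumes h: "cantor_cont h" and g: "cantor_cont g" and d: "\<And>x. cmod (h x - g x) \<le> \<delta>"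
  shows "L1_dist gauss (W h) (W g) \<le> \<delta>"
proof (rule field_le_epsilon)
  fix \<epsilon> :: real assume e: "\<epsilon> > 0"
  obtain p l where pl: "isonormal p l" "\<forall>x. cmod (h x - p x) \<le> \<epsilon> / 2"
    using cantor_cont_approx[OF h half_gt_zero[OF e]] by blast
  have "cmod (g x - p x) \<le> \<delta> + \<epsilon> / 2" for x
    using norm_triangle_ineq4[of "h x - p x" "h x - g x"] pl(2)[rule_format, of x] d[of x] by simp
  from W_close[OF g pl(1) this] have "L1_dist gauss l (W g) \<le> \<delta> + \<epsilon> / 2"
    by (simp only: abs_minus_commute)
  moreover have "L1_dist gauss (W h) l \<le> \<epsilon> / 2" by (rule W_close[OF h pl(1) pl(2)[rule_format]])
  ultimately show "L1_dist gauss (W h) (W g) \<le> \<delta> + \<epsilon>"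
    using L1_triangle[OF W_integrable[OF h] isonormal_measurable(3)[OF pl(1)] W_integrable[OF g]] by linarith
qed

text \<open>\<open>W\<close> is an arbitrary choice of limits, so linearity holds almost everywhere
  only, with an exceptional set depending on the functions. It follows by comparing both sides with
  sums of finite approximants.\<close>

lemma W_add:
  assumes h: "cantor_cont h" and g: "cantor_cont g"
  shows "AE w in gauss. W (\<lambda>x. h x + g x) w = W h w + W g w"
proof (rule AE_eq_of_L1)
  note hg = cantor_cont_add[OF h g]
  show i: "integrable gauss (W (\<lambda>x. h x + g x))" "integrable gauss (\<lambda>w. W h w + W g w)"
    using W_integrable[OF hg] W_integrable[OF h] W_integrable[OF g] by auto
  fix \<epsilon> :: real assume e: "\<epsilon> > 0"
  then have e4: "\<epsilon> / 4 > 0" by simp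
  obtain p l where p: "isonormal p l" "\<forall>x. cmod (h x - p x) \<le> \<epsilon> / 4"
    using cantor_cont_approx[OF h e4] by blast
  obtain q k where q: "isonormal q k" "\<forall>x. cmod (g x - q x) \<le> \<epsilon> / 4"
    using cantor_cont_approx[OF g e4] by blast
  note pq = isonormal_add[OF p(1) q(1)]
  have "cmod (h x + g x - (p x + q x)) \<le> \<epsilon> / 4 + \<epsilon> / 4" for x
    using norm_diff_triangle_ineq[of "h x" "g x" "p x" "q x"] p(2)[rule_format, of x] q(2)[rule_format, of x] by linarith
  then have 1: "(\<integral>w. \<bar>W (\<lambda>x. h x + g x) w - (l w + k w)\<bar> \<partial>gauss) \<le> \<epsilon> / 4 + \<epsilon> / 4"
    by (rule W_close[OF hg pq])
  have il: "integrable gauss l" "integrable gauss k" "integrable gauss (\<lambda>w. l w + k w)"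
    using isonormal_measurable(3) p(1) q(1) pq by blast+
  have "(\<integral>w. \<bar>(l w + k w) - (W h w + W g w)\<bar> \<partial>gauss) \<le> (\<integral>w. \<bar>W h w - l w\<bar> + \<bar>W g w - k w\<bar> \<partial>gauss)"
    using i il W_integrable[OF h] W_integrable[OF g] by (intro integral_mono) auto
  also have "\<dots> = L1_dist gauss (W h) l + L1_dist gauss (W g) k"
    using il W_integrable[OF h] W_integrable[OF g] by (intro Bochner_Integration.integral_add) auto
  also have "\<dots> \<le> \<epsilon> / 4 + \<epsilon> / 4"
    by (intro add_mono W_close[OF h p(1)] W_close[OF g q(1)] p(2)[rule_format] q(2)[rule_format])
  finally have 2: "(\<integral>w. \<bar>(l w + k w) - (W h w + W g w)\<bar> \<partial>gauss) \<le> \<epsilon> / 4 + \<epsilon> / 4" .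
  show "(\<integral>w. \<bar>W (\<lambda>x. h x + g x) w - (W h w + W g w)\<bar> \<partial>gauss) \<le> \<epsilon>"
    using L1_triangle[OF i(1) il(3) i(2)] 1 2 by linarith
qed

lemma W_scale:
  assumes h: "cantor_cont h"
  shows "AE w in gauss. W (\<lambda>x. complex_of_real a * h x) w = a * W h w"
proof (rule AE_eq_of_L1)
  note ah = cantor_cont_mult[OF cantor_cont_const[of "complex_of_real a"] h]
  show i: "integrable gauss (W (\<lambda>x. complex_of_real a * h x))" "integrable gauss (\<lambda>w. a * W h w)"
    using W_integrable[OF ah] W_integrable[OF h] by auto
  fix \<epsilon> :: real assume e: "\<epsilon> > 0"
  \<comment> \<open>Both sides deviate from the scaled approximant by at most
    \<open>\<bar>a\<bar> * \<eta>\<close>, hence the factor 2; adding 1 covers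
    \<open>a = 0\<close>.\<close>
  define \<eta> where "\<eta> = \<epsilon> / (2 * (\<bar>a\<bar> + 1))"
  have eta: "\<eta> > 0" using e by (simp add: \<eta>_def)
  have "\<bar>a\<bar> * \<eta> \<le> (\<bar>a\<bar> + 1) * \<eta>" using eta by (intro mult_right_mono) auto
  also have "(\<bar>a\<bar> + 1) * \<eta> = \<epsilon> / 2" by (simp add: \<eta>_def divide_simps)
  finally have le: "\<bar>a\<bar> * \<eta> \<le> \<epsilon> / 2" .
  obtain p l where p: "isonormal p l" "\<forall>x. cmod (h x - p x) \<le> \<eta>"
    using cantor_cont_approx[OF h eta] by blast
  note ap = isonormal_scale[OF p(1), of a]
  have il: "integrable gauss (\<lambda>w. a * l w)" by (rule isonormal_measurable[OF ap])
  have "cmod (complex_of_real a * h x - complex_of_real a * p x) \<le> \<bar>a\<bar> * \<eta>" for x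
  proof -
    have "cmod (complex_of_real a * h x - complex_of_real a * p x) = \<bar>a\<bar> * cmod (h x - p x)"
      by (metis norm_mult norm_of_real right_diff_distrib)
    also have "\<dots> \<le> \<bar>a\<bar> * \<eta>" using p(2) by (intro mult_left_mono) auto
    finally show ?thesis .
  qed
  then have 1: "(\<integral>w. \<bar>W (\<lambda>x. complex_of_real a * h x) w - a * l w\<bar> \<partial>gauss) \<le> \<bar>a\<bar> * \<eta>"
    by (rule W_close[OF ah ap])
  have "\<bar>a * l w - a * W h w\<bar> = \<bar>a\<bar> * \<bar>W h w - l w\<bar>" for w
    by (metis abs_minus_commute abs_mult right_diff_distrib)
  then have "(\<integral>w. \<bar>a * l w - a * W h w\<bar> \<partial>gauss) = \<bar>a\<bar> * L1_dist gauss (W h) l" by simp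
  also have "\<dots> \<le> \<bar>a\<bar> * \<eta>"
    by (intro mult_left_mono W_close[OF h p(1)] p(2)[rule_format]) auto
  finally have 2: "(\<integral>w. \<bar>a * l w - a * W h w\<bar> \<partial>gauss) \<le> \<bar>a\<bar> * \<eta>" .
  show "(\<integral>w. \<bar>W (\<lambda>x. complex_of_real a * h x) w - a * W h w\<bar> \<partial>gauss) \<le> \<epsilon>"
    using L1_triangle[OF i(1) il i(2)] 1 2 le by linarith
qed

text \<open>Continuity of the partial sum is carried in the conclusion because \<open>W_add\<close>
  asks for it in the induction step.\<close>

lemma W_sum:
  fixes n :: nat
  assumes h: "\<And>j. cantor_cont (h j)"
  shows "cantor_cont (\<lambda>x. \<Sum>j<n. complex_of_real (c j) * h j x) \<and>
    (AE w in gauss. W (\<lambda>x. \<Sum>j<n. complex_of_real (c j) * h j x) w = (\<Sum>j<n. c j * W (h j) w))"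
proof (induction n)
  case 0
  have "isonormal (\<lambda>x. 0) (\<lambda>w. 0)" using isonormal_sum[of 0] by simp
  from W_isonormal[OF this] show ?case by (simp add: cantor_cont_const)
next
  case (Suc n)
  note s = cantor_cont_mult[OF cantor_cont_const[of "complex_of_real (c n)"] h[of n]]
  note IH1 = Suc.IH[THEN conjunct1] and IH2 = Suc.IH[THEN conjunct2]
  have "AE w in gauss. W (\<lambda>x. (\<Sum>j<n. complex_of_real (c j) * h j x) + complex_of_real (c n) * h n x) w =
      (\<Sum>j<n. c j * W (h j) w) + c n * W (h n) w"
    using W_add[OF IH1 s] IH2 W_scale[OF h[of n], of "c n"] by eventually_elim simp
  then show ?case using cantor_cont_add[OF IH1 s] by simp
qed

lemma cantor_cont_coin:
  assumes h: "cantor_cont h"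
  shows "h \<in> borel_measurable coin" "integrable coin (\<lambda>x. (cmod (h x))\<^sup>2)"
proof -
  obtain p l where p: "\<And>k. isonormal (p k) (l k)" "\<And>k x. cmod (h x - p k x) \<le> 1 / real (Suc k)"
    using cantor_cont_approx_seq[OF h, of "\<lambda>k. 1 / real (Suc k)"] by auto
  have lim: "(\<lambda>n. p n x) \<longlonglongrightarrow> h x" for x
  proof (rule LIM_zero_cancel, rule Lim_null_comparison)
    show "\<forall>\<^sub>F n in sequentially. norm (p n x - h x) \<le> 1 / real (Suc n)"
      using p(2) by (simp add: norm_minus_commute)
    show "(\<lambda>n. 1 / real (Suc n)) \<longlonglongrightarrow> 0" by (rule LIMSEQ_Suc[OF lim_1_over_n])
  qed
  show m: "h \<in> borel_measurable coin"
    by (rule borel_measurable_LIMSEQ_metric[OF isonormal_measurable(1)[OF p(1)] lim])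
  obtain B where B: "\<And>x. cmod (h x) \<le> B" using cantor_cont_bounded[OF h] by blast
  show "integrable coin (\<lambda>x. (cmod (h x))\<^sup>2)"
  proof (rule coin_integrable_bounded[where B="B\<^sup>2"])
    show "(\<lambda>x. (cmod (h x))\<^sup>2) \<in> borel_measurable coin" using m by measurable
    show "norm ((cmod (h x))\<^sup>2) \<le> B\<^sup>2" for x using B[of x] by (simp add: power_mono)
  qed
qed

lemma cmod_square_diff_le:
  assumes "cmod (h - p) \<le> \<delta>" "cmod h \<le> B" "\<delta> \<le> 1"
  shows "\<bar>(cmod p)\<^sup>2 - (cmod h)\<^sup>2\<bar> \<le> \<delta> * (2 * B + 1)"
proof -
  have p: "cmod p \<le> B + 1" using norm_triangle_ineq2[of p h] assms by (simp add: norm_minus_commute)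
  have "\<bar>(cmod p)\<^sup>2 - (cmod h)\<^sup>2\<bar> = \<bar>cmod p - cmod h\<bar> * (cmod p + cmod h)"
    by (simp add: power2_eq_square square_diff_square_factored abs_mult)
  also have "\<dots> \<le> \<delta> * (2 * B + 1)"
  proof (intro mult_mono)
    show "\<bar>cmod p - cmod h\<bar> \<le> \<delta>" using norm_triangle_ineq3[of p h] assms(1) by (simp add: norm_minus_commute)
    show "cmod p + cmod h \<le> 2 * B + 1" using p assms(2) by linarith
    show "0 \<le> \<delta>" using assms(1) norm_ge_zero order_trans by blast
  qed simp
  finally show ?thesis .
qed

text \<open>\<open>W h\<close> is thus a centred Gaussian variable whose variance is the squared
  norm of \<open>h\<close>. Both sides are limits over approximants: on the left the linear forms
  converge in mean and the cosine is 1-Lipschitz, on the right the squared norms converge by uniform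
  convergence.\<close>

lemma W_cos:
  assumes h: "cantor_cont h"
  shows "(\<integral>w. cos (W h w + b) \<partial>gauss) = cos b * exp (- (\<integral>x. (cmod (h x))\<^sup>2 \<partial>coin) / 2)"
proof -
  obtain p l where iso: "\<And>k. isonormal (p k) (l k)" and close: "\<And>k x. cmod (h x - p k x) \<le> 1 / real (Suc k)"
    using cantor_cont_approx_seq[OF h, of "\<lambda>k. 1 / real (Suc k)"] by auto
  have z: "(\<lambda>k. 1 / real (Suc k)) \<longlonglongrightarrow> 0" by (rule LIMSEQ_Suc[OF lim_1_over_n])
  have icos: "integrable gauss (\<lambda>w. cos (v w + b))" if "integrable gauss v" for v
    using that by (intro gauss.integrable_const_bound[of _ 1]) auto
  have 1: "(\<lambda>k. \<integral>w. cos (l k w + b) \<partial>gauss) \<longlonglongrightarrow> (\<integral>w. cos (W h w + b) \<partial>gauss)"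
  proof (rule LIM_zero_cancel, rule Lim_null_comparison[OF _ z], rule always_eventually, rule allI)
    fix k
    have il: "integrable gauss (l k)" by (rule isonormal_measurable[OF iso])
    note iW = W_integrable[OF h]
    have "(\<integral>w. cos (l k w + b) \<partial>gauss) - (\<integral>w. cos (W h w + b) \<partial>gauss) =
        (\<integral>w. cos (l k w + b) - cos (W h w + b) \<partial>gauss)"
      by (rule Bochner_Integration.integral_diff[symmetric, OF icos[OF il] icos[OF iW]])
    also have "\<bar>\<dots>\<bar> \<le> (\<integral>w. \<bar>cos (l k w + b) - cos (W h w + b)\<bar> \<partial>gauss)" by (rule integral_abs_bound)
    also have "\<dots> \<le> L1_dist gauss (W h) (l k)"
    proof (rule integral_mono)
      show "integrable gauss (\<lambda>w. \<bar>cos (l k w + b) - cos (W h w + b)\<bar>)"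
        by (intro integrable_abs Bochner_Integration.integrable_diff icos il iW)
      show "integrable gauss (\<lambda>w. \<bar>W h w - l k w\<bar>)"
        by (intro integrable_abs Bochner_Integration.integrable_diff il iW)
      show "\<bar>cos (l k w + b) - cos (W h w + b)\<bar> \<le> \<bar>W h w - l k w\<bar>" for w
        using abs_cos_diff_le[of "l k w + b" "W h w + b"] by (simp add: abs_minus_commute)
    qed
    also have "\<dots> \<le> 1 / real (Suc k)" by (rule W_close[OF h iso close])
    finally show "norm ((\<integral>w. cos (l k w + b) \<partial>gauss) - (\<integral>w. cos (W h w + b) \<partial>gauss)) \<le> 1 / real (Suc k)"
      by (simp only: real_norm_def)
  qed
  obtain B where B: "\<And>x. cmod (h x) \<le> B" using cantor_cont_bounded[OF h] by blast
  have z': "(\<lambda>k. 1 / real (Suc k) * (2 * B + 1)) \<longlonglongrightarrow> 0"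
    using tendsto_mult_right[OF z, of "2 * B + 1"] by simp
  have 2: "(\<lambda>k. \<integral>x. (cmod (p k x))\<^sup>2 \<partial>coin) \<longlonglongrightarrow> (\<integral>x. (cmod (h x))\<^sup>2 \<partial>coin)"
  proof (rule LIM_zero_cancel, rule Lim_null_comparison[OF _ z'], rule always_eventually, rule allI)
    fix k
    note ip = cantor_cont_coin(2)[OF cantor_cont_isonormal[OF iso[of k]]] and ih = cantor_cont_coin(2)[OF h]
    have "(\<integral>x. (cmod (p k x))\<^sup>2 \<partial>coin) - (\<integral>x. (cmod (h x))\<^sup>2 \<partial>coin) = (\<integral>x. (cmod (p k x))\<^sup>2 - (cmod (h x))\<^sup>2 \<partial>coin)"
      by (rule Bochner_Integration.integral_diff[symmetric, OF ip ih])
    also have "\<bar>\<dots>\<bar> \<le> (\<integral>x. \<bar>(cmod (p k x))\<^sup>2 - (cmod (h x))\<^sup>2\<bar> \<partial>coin)" by (rule integral_abs_bound)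
    also have "\<dots> \<le> (\<integral>x. 1 / real (Suc k) * (2 * B + 1) \<partial>coin)"
    proof (rule integral_mono)
      show "integrable coin (\<lambda>x. \<bar>(cmod (p k x))\<^sup>2 - (cmod (h x))\<^sup>2\<bar>)"
        by (intro integrable_abs Bochner_Integration.integrable_diff ip ih)
      show "\<bar>(cmod (p k x))\<^sup>2 - (cmod (h x))\<^sup>2\<bar> \<le> 1 / real (Suc k) * (2 * B + 1)" for x
        by (rule cmod_square_diff_le[OF close B]) simp
    qed simp
    also have "\<dots> = 1 / real (Suc k) * (2 * B + 1)" using coin.prob_space by simp
    finally show "norm ((\<integral>x. (cmod (p k x))\<^sup>2 \<partial>coin) - (\<integral>x. (cmod (h x))\<^sup>2 \<partial>coin)) \<le> 1 / real (Suc k) * (2 * B + 1)"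
      by (simp only: real_norm_def)
  qed
  have "(\<lambda>k. cos b * exp (- (\<integral>x. (cmod (p k x))\<^sup>2 \<partial>coin) / 2)) \<longlonglongrightarrow> cos b * exp (- (\<integral>x. (cmod (h x))\<^sup>2 \<partial>coin) / 2)"
    by (intro tendsto_intros 2) simp
  then have "(\<lambda>k. \<integral>w. cos (l k w + b) \<partial>gauss) \<longlonglongrightarrow> cos b * exp (- (\<integral>x. (cmod (h x))\<^sup>2 \<partial>coin) / 2)"
    by (simp only: isonormal_cos[OF iso])
  then show ?thesis using 1 LIMSEQ_unique by blast
qed

section \<open>The action on the Gaussian measure\<close>

definition circular :: "((nat \<Rightarrow> bool) \<Rightarrow> complex) \<Rightarrow> bool" where
  "circular f \<longleftrightarrow> cantor_cont f \<and> (\<forall>x. cmod (f x) = 1)"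

text \<open>A point \<open>w\<close> is read as the list of values of the process at the basis; the
  new point lists its values at \<open>f\<close> times the basis. This precomposes the process with
  the multiplication operator, and \<open>W\<close> supplies the limits.\<close>

definition twist :: "((nat \<Rightarrow> bool) \<Rightarrow> complex) \<Rightarrow> (nat \<Rightarrow> real) \<Rightarrow> nat \<Rightarrow> real" where
  "twist f w = (\<lambda>j. W (\<lambda>x. f x * wbase j x) w)"

lemma circular_cont: "circular f \<Longrightarrow> cantor_cont f"
  and circular_norm: "circular f \<Longrightarrow> cmod (f x) = 1"
  by (simp_all add: circular_def)

lemma circular_mult_cont: "circular f \<Longrightarrow> cantor_cont h \<Longrightarrow> cantor_cont (\<lambda>x. f x * h x)"
  by (rule cantor_cont_mult[OF circular_cont])

lemma twist_measurable:
  assumes "circular f"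
  shows "twist f \<in> borel_measurable borel"
  unfolding twist_def
  by (rule measurable_coordinatewise_then_product)
    (rule W_measurable[OF circular_mult_cont[OF assms cantor_cont_wbase]])

lemma twist_measurable_gauss: "circular f \<Longrightarrow> twist f \<in> measurable gauss gauss"
  using twist_measurable unfolding measurable_cong_sets[OF sets_gauss sets_gauss] .

lemma twist_isonormal:
  assumes f: "circular f" and pl: "isonormal p l"
  shows "AE w in gauss. l (twist f w) = W (\<lambda>x. f x * p x) w"
proof -
  obtain n c where p: "p = (\<lambda>x. \<Sum>j<n. complex_of_real (c j) * wbase j x)" and l: "l = (\<lambda>w. \<Sum>j<n. c j * w j)"
    using pl unfolding isonormal_def by blast
  have "f x * p x = (\<Sum>j<n. complex_of_real (c j) * (f x * wbase j x))" for x
    unfolding p by (simp add: sum_distrib_left mult_ac)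
  moreover have "AE w in gauss. W (\<lambda>x. \<Sum>j<n. complex_of_real (c j) * (f x * wbase j x)) w =
      (\<Sum>j<n. c j * W (\<lambda>x. f x * wbase j x) w)"
    using W_sum[where h="\<lambda>j x. f x * wbase j x", where n=n and c=c, OF circular_mult_cont[OF f cantor_cont_wbase]] by blast
  ultimately show ?thesis by (simp only: l twist_def eq_commute)
qed

lemma coin_norm_circular:
  assumes "circular f"
  shows "(\<integral>x. (cmod (f x * p x))\<^sup>2 \<partial>coin) = (\<integral>x. (cmod (p x))\<^sup>2 \<partial>coin)"
  by (simp add: norm_mult circular_norm[OF assms])

text \<open>Multiplication by a circle-valued function preserves the norm, and the law of a finite
  linear combination of coordinates depends on the norm alone; so the cosine integrals that
  determine a law are unchanged.\<close>

lemma twist_measure_preserving: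
  assumes f: "circular f"
  shows "measure_preserving gauss (twist f)"
proof -
  note T = twist_measurable_gauss[OF f]
  have Tb: "twist f \<in> borel_measurable gauss" using T unfolding measurable_cong_sets[OF refl sets_gauss] .
  have "distr gauss borel (twist f) = gauss"
  proof (rule borel_measure_eqI_cos)
    show "finite_measure (distr gauss borel (twist f))"
      by (rule gauss.finite_measure_distr[OF Tb])
    show "finite_measure gauss" by (rule gauss.finite_measure_axioms)
    fix n :: nat and a :: "nat \<Rightarrow> real" and b :: real
    define p where "p x = wsum n a x" for x
    define l where "l w = lin a n w" for w :: "nat \<Rightarrow> real"
    have pl: "isonormal p l" unfolding isonormal_def p_def[abs_def] l_def[abs_def] by blast
    have ml: "l \<in> borel_measurable borel" by (rule isonormal_measurable[OF pl])
    have "(\<integral>w. cos (l w + b) \<partial>distr gauss borel (twist f)) = (\<integral>w. cos (l (twist f w) + b) \<partial>gauss)"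
      by (rule integral_distr[OF Tb]) (use ml in measurable)
    also have "\<dots> = (\<integral>w. cos (W (\<lambda>x. f x * p x) w + b) \<partial>gauss)"
    proof (rule integral_cong_AE)
      show "(\<lambda>w. cos (l (twist f w) + b)) \<in> borel_measurable gauss"
        using measurable_compose[OF Tb ml] by measurable
      show "(\<lambda>w. cos (W (\<lambda>x. f x * p x) w + b)) \<in> borel_measurable gauss"
        using W_integrable[OF circular_mult_cont[OF f cantor_cont_isonormal[OF pl]]] by measurable
      show "AE w in gauss. cos (l (twist f w) + b) = cos (W (\<lambda>x. f x * p x) w + b)"
        using twist_isonormal[OF f pl] by (rule eventually_mono) simp
    qed
    also have "\<dots> = (\<integral>w. cos (l w + b) \<partial>gauss)"
      unfolding W_cos[OF circular_mult_cont[OF f cantor_cont_isonormal[OF pl]]] isonormal_cos[OF pl]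
        coin_norm_circular[OF f] ..
    finally show "(\<integral>w. cos (lin a n w + b) \<partial>distr gauss borel (twist f)) =
      (\<integral>w. cos (lin a n w + b) \<partial>gauss)" by (simp only: l_def)
  qed (simp_all add: sets_gauss)
  moreover have "distr gauss gauss (twist f) = distr gauss borel (twist f)"
    by (rule distr_cong) (simp_all add: sets_gauss)
  ultimately show ?thesis using T by (simp add: measure_preserving_def)
qed

lemma integral_measure_preserving:
  fixes F :: "'b \<Rightarrow> real"
  assumes T: "measure_preserving N T" and F: "F \<in> borel_measurable N"
  shows "(\<integral>x. F (T x) \<partial>N) = (\<integral>x. F x \<partial>N)"
  using integral_distr[OF measure_preservingD(1)[OF T] F] T by (simp add: measure_preserving_def)

lemma integrable_measure_preserving:
  fixes F :: "'b \<Rightarrow> real"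
  assumes T: "measure_preserving N T" and F: "integrable N F"
  shows "integrable N (\<lambda>x. F (T x))"
  using integrable_distr_eq[OF measure_preservingD(1)[OF T] borel_measurable_integrable[OF F]] T F
  by (simp add: measure_preserving_def)

text \<open>The relation known on the span extends to continuous functions: as the map preserves the
  measure, composing with it does not enlarge errors in mean.\<close>

lemma twist_W:
  assumes g: "circular g" and h: "cantor_cont h"
  shows "AE w in gauss. W h (twist g w) = W (\<lambda>x. g x * h x) w"
proof (rule AE_eq_of_L1)
  note mp = twist_measure_preserving[OF g] and gh = circular_mult_cont[OF g h]
  show i: "integrable gauss (\<lambda>w. W h (twist g w))" "integrable gauss (W (\<lambda>x. g x * h x))"
    by (rule integrable_measure_preserving[OF mp W_integrable[OF h]], rule W_integrable[OF gh])
  fix \<epsilon> :: real assume e: "\<epsilon> > 0"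
  obtain p l where pl: "isonormal p l" "\<forall>x. cmod (h x - p x) \<le> \<epsilon> / 2"
    using cantor_cont_approx[OF h half_gt_zero[OF e]] by blast
  note gp = circular_mult_cont[OF g cantor_cont_isonormal[OF pl(1)]]
  have il: "integrable gauss (\<lambda>w. l (twist g w))"
    by (rule integrable_measure_preserving[OF mp isonormal_measurable(3)[OF pl(1)]])
  have "(\<integral>w. \<bar>W h (twist g w) - l (twist g w)\<bar> \<partial>gauss) = L1_dist gauss (W h) l"
    by (rule integral_measure_preserving[OF mp])
      (intro borel_measurable_integrable integrable_abs Bochner_Integration.integrable_diff W_integrable[OF h] isonormal_measurable(3)[OF pl(1)])
  also have "\<dots> \<le> \<epsilon> / 2" by (rule W_close[OF h pl(1) pl(2)[rule_format]])
  finally have 1: "(\<integral>w. \<bar>W h (twist g w) - l (twist g w)\<bar> \<partial>gauss) \<le> \<epsilon> / 2" .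
  have "(\<integral>w. \<bar>l (twist g w) - W (\<lambda>x. g x * h x) w\<bar> \<partial>gauss) =
      (\<integral>w. \<bar>W (\<lambda>x. g x * p x) w - W (\<lambda>x. g x * h x) w\<bar> \<partial>gauss)"
  proof (rule integral_cong_AE)
    show "(\<lambda>w. \<bar>l (twist g w) - W (\<lambda>x. g x * h x) w\<bar>) \<in> borel_measurable gauss"
      by (intro borel_measurable_integrable integrable_abs Bochner_Integration.integrable_diff il i(2))
    show "(\<lambda>w. \<bar>W (\<lambda>x. g x * p x) w - W (\<lambda>x. g x * h x) w\<bar>) \<in> borel_measurable gauss"
      by (intro borel_measurable_integrable integrable_abs Bochner_Integration.integrable_diff W_integrable[OF gp] i(2))
    show "AE w in gauss. \<bar>l (twist g w) - W (\<lambda>x. g x * h x) w\<bar> = \<bar>W (\<lambda>x. g x * p x) w - W (\<lambda>x. g x * h x) w\<bar>"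
      using twist_isonormal[OF g pl(1)] by (rule eventually_mono) simp
  qed
  also have "\<dots> \<le> \<epsilon> / 2"
  proof (rule W_L1_le[OF gp gh])
    fix x
    have "cmod (g x * p x - g x * h x) = cmod (h x - p x)"
      by (metis circular_norm[OF g] mult_1 norm_minus_commute norm_mult right_diff_distrib)
    then show "cmod (g x * p x - g x * h x) \<le> \<epsilon> / 2" using pl(2) by simp
  qed
  finally have 2: "(\<integral>w. \<bar>l (twist g w) - W (\<lambda>x. g x * h x) w\<bar> \<partial>gauss) \<le> \<epsilon> / 2" .
  show "(\<integral>w. \<bar>W h (twist g w) - W (\<lambda>x. g x * h x) w\<bar> \<partial>gauss) \<le> \<epsilon>"
    using L1_triangle[OF i(1) il i(2)] 1 2 by linarith
qed

text \<open>The process at \<open>f\<close> times the basis, evaluated at \<open>twist g w\<close>,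
  is the process at \<open>g * f\<close> times the basis, evaluated at \<open>w\<close>. There are
  countably many coordinates, so their exceptional sets unite to a null set.\<close>

lemma twist_comp:
  assumes f: "circular f" and g: "circular g"
  shows "AE w in gauss. twist f (twist g w) = twist (\<lambda>x. g x * f x) w"
proof -
  have "AE w in gauss. \<forall>j. W (\<lambda>x. f x * wbase j x) (twist g w) = W (\<lambda>x. g x * (f x * wbase j x)) w"
    unfolding AE_all_countable
    by (intro allI twist_W[OF g circular_mult_cont[OF f cantor_cont_wbase]])
  then show ?thesis by (rule eventually_mono) (simp add: twist_def mult.assoc)
qed

lemma twist_one: "AE w in gauss. twist (\<lambda>_. 1) w = w"
proof -
  have "AE w in gauss. \<forall>j. W (wbase j) w = w j"
    unfolding AE_all_countable by (intro allI W_isonormal[OF isonormal_wbase])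
  then show ?thesis by (rule eventually_mono) (simp add: twist_def fun_eq_iff)
qed

lemma twist_component_integrable:
  "circular f \<Longrightarrow> integrable gauss (\<lambda>w. twist f w j)"
  unfolding twist_def by (rule W_integrable[OF circular_mult_cont[OF _ cantor_cont_wbase]])

lemma twist_L1_le:
  assumes f: "circular f" and g: "circular g" and d: "\<And>x. cmod (f x - g x) \<le> \<delta>"
  shows "(\<integral>w. \<bar>twist f w j - twist g w j\<bar> \<partial>gauss) \<le> \<delta>"
  unfolding twist_def
proof (rule W_L1_le[OF circular_mult_cont[OF f cantor_cont_wbase] circular_mult_cont[OF g cantor_cont_wbase]])
  fix x
  have "cmod (f x * wbase j x - g x * wbase j x) = cmod (f x - g x)"
    by (metis left_diff_distrib mult.right_neutral norm_mult norm_wbase)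
  then show "cmod (f x * wbase j x - g x * wbase j x) \<le> \<delta>" using d[of x] by simp
qed

text \<open>Approximating the indicator of \<open>A\<close> by a Lipschitz trigonometric polynomial reduces
  continuity of the action to the mean displacement of finitely many coordinates.\<close>

lemma twist_continuous:
  assumes A: "A \<in> sets borel" and e: "\<epsilon> > 0"
  shows "\<exists>\<delta>>0. \<forall>f g. circular f \<longrightarrow> circular g \<longrightarrow> (\<forall>x. cmod (f x - g x) \<le> \<delta>) \<longrightarrow>
    measure gauss (sym_diff (twist f -` A) (twist g -` A)) < \<epsilon>"
proof -
  note fg = gauss.finite_measure_axioms
  have apx: "trig_approx gauss (indicator A)" by (rule trig_poly_dense[OF fg sets_gauss A])
  have "\<epsilon> / 4 > 0" using e by simp
  then obtain P where P: "trig_poly P" "L1_dist gauss (indicator A) P < \<epsilon> / 4"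
    using trig_approxD[OF apx] by blast
  obtain n L where L0: "0 \<le> L" and L: "\<And>x y. \<bar>P x - P y\<bar> \<le> L * (\<Sum>j<n. \<bar>x j - y j\<bar>)"
    using trig_poly_lipschitz[OF P(1)] by blast
  \<comment> \<open>Chosen so that \<open>L * (n * \<delta>) \<le> \<epsilon> / 4\<close>, with 1
    added against a zero divisor. Two approximation errors below \<open>\<epsilon> / 4\<close> join
    this one.\<close>
  define \<delta> where "\<delta> = \<epsilon> / 4 / (L * real n + 1)"
  have Ln: "L * real n + 1 > 0" using L0 by (simp add: add_nonneg_pos)
  have d0: "\<delta> > 0" using e Ln by (simp add: \<delta>_def)
  have "L * (real n * \<delta>) \<le> (L * real n + 1) * \<delta>" using d0 by (simp add: algebra_simps)
  also have "\<dots> = \<epsilon> / 4"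
  proof -
    have "c * (a / c) = a" if "c \<noteq> 0" for a c :: real using that by simp
    from this[of "L * real n + 1" "\<epsilon> / 4"] show ?thesis using Ln unfolding \<delta>_def by linarith
  qed
  finally have Ld: "L * (real n * \<delta>) \<le> \<epsilon> / 4" .
  have mI: "(indicator A :: _ \<Rightarrow> real) \<in> borel_measurable gauss"
    using A by (simp add: sets_gauss)
  have mD: "(\<lambda>w. \<bar>indicator A w - P w\<bar>) \<in> borel_measurable gauss"
    using borel_measurable_integrable[OF integrable_abs[OF integrable_diff_trig_poly[OF fg sets_gauss apx P(1)]]] .
  have iP: "integrable gauss P" by (rule integrable_trig_poly[OF fg sets_gauss P(1)])
  have iI: "integrable gauss (indicator A :: _ \<Rightarrow> real)"
    using A by (intro integrable_bounded_borel[OF fg sets_gauss, of _ 1]) auto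
  have "measure gauss (sym_diff (twist f -` A) (twist g -` A)) < \<epsilon>"
    if f: "circular f" and g: "circular g" and d: "\<forall>x. cmod (f x - g x) \<le> \<delta>" for f g
  proof -
    note mf = twist_measure_preserving[OF f] and mg = twist_measure_preserving[OF g]
    let ?I = "\<lambda>w. indicator A w :: real"
    have S: "sym_diff (twist f -` A) (twist g -` A) \<in> sets gauss"
      using measure_preservingD(2)[OF mf, of A] measure_preservingD(2)[OF mg, of A] A by (simp add: sets_gauss)
    have if1: "integrable gauss (\<lambda>w. ?I (twist f w))" and ig1: "integrable gauss (\<lambda>w. ?I (twist g w))"
      by (rule integrable_measure_preserving[OF mf iI], rule integrable_measure_preserving[OF mg iI])
    have if2: "integrable gauss (\<lambda>w. P (twist f w))" and ig2: "integrable gauss (\<lambda>w. P (twist g w))"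
      by (rule integrable_measure_preserving[OF mf iP], rule integrable_measure_preserving[OF mg iP])
    have "measure gauss (sym_diff (twist f -` A) (twist g -` A)) = (\<integral>w. \<bar>?I (twist f w) - ?I (twist g w)\<bar> \<partial>gauss)"
    proof -
      have "measure gauss (sym_diff (twist f -` A) (twist g -` A)) =
          (\<integral>w. indicator (sym_diff (twist f -` A) (twist g -` A)) w \<partial>gauss)"
        using S by simp
      also have "\<dots> = (\<integral>w. \<bar>?I (twist f w) - ?I (twist g w)\<bar> \<partial>gauss)"
        by (rule Bochner_Integration.integral_cong) (simp_all add: indicator_def)
      finally show ?thesis .
    qed
    also have "\<dots> \<le> (\<integral>w. \<bar>?I (twist f w) - P (twist f w)\<bar> \<partial>gauss) + (\<integral>w. \<bar>P (twist f w) - ?I (twist g w)\<bar> \<partial>gauss)"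
      by (rule L1_triangle[OF if1 if2 ig1])
    also have "(\<integral>w. \<bar>?I (twist f w) - P (twist f w)\<bar> \<partial>gauss) = (\<integral>w. \<bar>?I w - P w\<bar> \<partial>gauss)"
      by (rule integral_measure_preserving[OF mf mD])
    finally have 1: "measure gauss (sym_diff (twist f -` A) (twist g -` A)) \<le>
      (\<integral>w. \<bar>?I w - P w\<bar> \<partial>gauss) + (\<integral>w. \<bar>P (twist f w) - ?I (twist g w)\<bar> \<partial>gauss)" .
    have "(\<integral>w. \<bar>P (twist g w) - ?I (twist g w)\<bar> \<partial>gauss) = (\<integral>w. \<bar>?I w - P w\<bar> \<partial>gauss)"
      using integral_measure_preserving[OF mg mD] by (simp only: abs_minus_commute)
    then have 2: "(\<integral>w. \<bar>P (twist f w) - ?I (twist g w)\<bar> \<partial>gauss) \<le>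
      (\<integral>w. \<bar>P (twist f w) - P (twist g w)\<bar> \<partial>gauss) + (\<integral>w. \<bar>?I w - P w\<bar> \<partial>gauss)"
      using L1_triangle[OF if2 ig2 ig1] by linarith
    have it: "integrable gauss (\<lambda>w. \<bar>twist f w j - twist g w j\<bar>)" for j
      by (intro integrable_abs Bochner_Integration.integrable_diff twist_component_integrable f g)
    have "(\<integral>w. \<bar>P (twist f w) - P (twist g w)\<bar> \<partial>gauss) \<le> (\<integral>w. L * (\<Sum>j<n. \<bar>twist f w j - twist g w j\<bar>) \<partial>gauss)"
      by (rule integral_mono[OF integrable_abs[OF Bochner_Integration.integrable_diff[OF if2 ig2]] _ L])
        (intro integrable_mult_right Bochner_Integration.integrable_sum it)
    also have "\<dots> = L * (\<Sum>j<n. \<integral>w. \<bar>twist f w j - twist g w j\<bar> \<partial>gauss)"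
      by (simp only: integral_mult_right_zero Bochner_Integration.integral_sum it)
    also have "\<dots> \<le> L * (\<Sum>j<n. \<delta>)"
      by (intro mult_left_mono sum_mono twist_L1_le[OF f g] d[rule_format] L0)
    also have "\<dots> = L * (real n * \<delta>)" by simp
    finally have 3: "(\<integral>w. \<bar>P (twist f w) - P (twist g w)\<bar> \<partial>gauss) \<le> \<epsilon> / 4" using Ld by linarith
    show ?thesis using 1 2 3 P(2) e by linarith
  qed
  then show ?thesis using d0 by blast
qed

section \<open>The oscillating functions and their weak limit\<close>

definition flicker :: "real \<Rightarrow> real \<Rightarrow> nat \<Rightarrow> (nat \<Rightarrow> bool) \<Rightarrow> complex" where
  "flicker \<rho> \<sigma> m x = complex_of_real \<rho> + complex_of_real \<sigma> * (\<i> * complex_of_real (rad m x))"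

lemma circular_flicker:
  assumes "\<rho>\<^sup>2 + \<sigma>\<^sup>2 = 1"
  shows "circular (flicker \<rho> \<sigma> m)"
  unfolding circular_def cantor_cont_def
proof (intro conjI allI impI exI[of _ "Suc m"])
  fix \<epsilon> :: real and x y :: "nat \<Rightarrow> bool"
  assume "\<epsilon> > 0" "\<forall>j<Suc m. x j = y j"
  then show "cmod (flicker \<rho> \<sigma> m x - flicker \<rho> \<sigma> m y) \<le> \<epsilon>" by (simp add: flicker_def rad_def)
next
  fix x
  have "(cmod (flicker \<rho> \<sigma> m x))\<^sup>2 = 1"
    unfolding cmod_power2 using assms by (simp add: flicker_def rad_def)
  then show "cmod (flicker \<rho> \<sigma> m x) = 1" by (simp add: power2_eq_1_iff) (use norm_ge_zero[of "flicker \<rho> \<sigma> m x"] in linarith)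
qed

lemma not_in_set_decode: "n < 2 ^ k \<Longrightarrow> k \<notin> set_decode n"
  by (simp add: set_decode_def)

text \<open>On the first \<open>N\<close> basis vectors multiplication has exactly the matrix
  \<open>\<rho>\<close> times the identity as soon as \<open>m\<close> reaches \<open>N\<close>: the
  oscillating part sends these vectors to vectors orthogonal to all of them.\<close>

lemma coin_flicker:
  assumes "i < N" "j < N" "N \<le> m"
  shows "(\<integral>x. Re (wbase i x * cnj (flicker \<rho> \<sigma> m x * wbase j x)) \<partial>coin) = (if i = j then \<rho> else 0)"
proof -
  \<comment> \<open>The crude bound \<open>k div 2 \<le> k < m < 2 ^ m\<close> shows that binary
    digit \<open>m\<close> of the Walsh index is 0.\<close>
  have nin: "m \<notin> set_decode (k div 2)" if "k < N" for k
  proof (rule not_in_set_decode)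
    have "k div 2 \<le> k" by simp
    also have "k < m" using that assms(3) by simp
    also have "m < 2 ^ m" by simp
    finally show "k div 2 < 2 ^ m" .
  qed
  have int: "integrable coin (\<lambda>x. Re (wbase i x * cnj (g x * wbase j x)))"
    if g: "g \<in> borel_measurable coin" "\<And>x. cmod (g x) = 1" for g
  proof (rule coin_integrable_bounded[where B=1])
    show "(\<lambda>x. Re (wbase i x * cnj (g x * wbase j x))) \<in> borel_measurable coin" using g(1) by measurable
    show "norm (Re (wbase i x * cnj (g x * wbase j x))) \<le> 1" for x
      using abs_Re_le_cmod[of "wbase i x * cnj (g x * wbase j x)"] g(2)[of x] by (simp add: norm_mult norm_wbase)
  qed
  have i1: "integrable coin (\<lambda>x. Re (wbase i x * cnj (1 * wbase j x)))"
    by (rule int[of "\<lambda>_. 1"]) auto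
  have i2: "integrable coin (\<lambda>x. Re (wbase i x * cnj (\<i> * rad m x * wbase j x)))"
    by (rule int[of "\<lambda>x. \<i> * rad m x"]) (measurable, simp add: norm_mult rad_def)
  have "Re (wbase i x * cnj (flicker \<rho> \<sigma> m x * wbase j x)) =
    \<rho> * Re (wbase i x * cnj (1 * wbase j x)) + \<sigma> * Re (wbase i x * cnj (\<i> * rad m x * wbase j x))" for x
    by (simp add: flicker_def algebra_simps)
  then have "(\<integral>x. Re (wbase i x * cnj (flicker \<rho> \<sigma> m x * wbase j x)) \<partial>coin) =
    \<rho> * (\<integral>x. Re (wbase i x * cnj (1 * wbase j x)) \<partial>coin) + \<sigma> * (\<integral>x. Re (wbase i x * cnj (\<i> * rad m x * wbase j x)) \<partial>coin)"
    using i1 i2 by (simp only: Bochner_Integration.integral_add integrable_mult_right integral_mult_right_zero)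
  then show ?thesis
    by (simp only: mult_1 coin_wbase_orthonormal coin_wbase_rad_orthogonal[OF nin[OF assms(1)] nin[OF assms(2)]]) simp
qed

text \<open>Both integrals are determined by a variance. On the left it is the squared norm of
  \<open>p + f * q\<close>, with \<open>f\<close> the oscillating function; for
  \<open>m \<ge> n\<close> its cross term is \<open>2 * \<rho>\<close> times the inner product of
  the coefficient vectors. This is the variance under the coupling, so no limit is taken.\<close>

lemma twist_flicker_cos:
  assumes \<rho>\<sigma>: "\<rho>\<^sup>2 + \<sigma>\<^sup>2 = 1" and m: "n \<le> m"
  shows "(\<integral>w. cos (lin a n w + (\<Sum>j<n. b j * twist (flicker \<rho> \<sigma> m) w j) + c) \<partial>gauss) =
    (\<integral>z. cos (lin a n (fst z) + lin b n (mix \<rho> \<sigma> 0 z) + c) \<partial>gauss2)"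
proof -
  let ?f = "flicker \<rho> \<sigma> m"
  note f = circular_flicker[OF \<rho>\<sigma>, of m]
  define p where "p x = wsum n a x" for x
  define q where "q x = wsum n b x" for x
  define k where "k w = lin a n w" for w :: "nat \<Rightarrow> real"
  define l where "l w = lin b n w" for w :: "nat \<Rightarrow> real"
  have pk: "isonormal p k" unfolding isonormal_def p_def[abs_def] k_def[abs_def] by blast
  have ql: "isonormal q l" unfolding isonormal_def q_def[abs_def] l_def[abs_def] by blast
  note cp = cantor_cont_isonormal[OF pk] and cq = cantor_cont_isonormal[OF ql]
  note cfq = circular_mult_cont[OF f cq]
  note cs = cantor_cont_add[OF cp cfq]
  have AE: "AE w in gauss. k w + l (twist ?f w) = W (\<lambda>x. p x + ?f x * q x) w"
    using W_isonormal[OF pk] twist_isonormal[OF f ql] W_add[OF cp cfq] by eventually_elim simp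
  have ml: "(\<lambda>w. l (twist ?f w)) \<in> borel_measurable gauss"
    using borel_measurable_integrable[OF integrable_measure_preserving[OF twist_measure_preserving[OF f] isonormal_measurable(3)[OF ql]]] .
  have mk: "k \<in> borel_measurable gauss" using borel_measurable_integrable[OF isonormal_measurable(3)[OF pk]] .
  have "(\<integral>w. cos (k w + l (twist ?f w) + c) \<partial>gauss) = (\<integral>w. cos (W (\<lambda>x. p x + ?f x * q x) w + c) \<partial>gauss)"
  proof (rule integral_cong_AE)
    show "(\<lambda>w. cos (k w + l (twist ?f w) + c)) \<in> borel_measurable gauss" using ml mk by measurable
    show "(\<lambda>w. cos (W (\<lambda>x. p x + ?f x * q x) w + c)) \<in> borel_measurable gauss"
      using borel_measurable_integrable[OF W_integrable[OF cs]] by measurable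
    show "AE w in gauss. cos (k w + l (twist ?f w) + c) = cos (W (\<lambda>x. p x + ?f x * q x) w + c)"
      using AE by (rule eventually_mono) simp
  qed
  also have "\<dots> = cos c * exp (- (\<integral>x. (cmod (p x + ?f x * q x))\<^sup>2 \<partial>coin) / 2)" by (rule W_cos[OF cs])
  also have "(\<integral>x. (cmod (p x + ?f x * q x))\<^sup>2 \<partial>coin) = (\<Sum>j<n. (a j)\<^sup>2 + (b j)\<^sup>2 + 2 * \<rho> * a j * b j)"
  proof -
    have e: "(cmod (p x + ?f x * q x))\<^sup>2 = (cmod (p x))\<^sup>2 + (cmod (?f x * q x))\<^sup>2 + 2 * Re (p x * cnj (?f x * q x))" for x
      unfolding cmod_power2 by (simp add: power2_eq_square algebra_simps)
    have ir: "integrable coin (\<lambda>x. Re (p x * cnj (?f x * q x)))"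
    proof -
      obtain B where B: "\<And>x. cmod (p x) \<le> B" using isonormal_bounded[OF pk] by blast
      obtain C where C: "\<And>x. cmod (q x) \<le> C" using isonormal_bounded[OF ql] by blast
      show ?thesis
      proof (rule coin_integrable_bounded[where B="B * C"])
        show "(\<lambda>x. Re (p x * cnj (?f x * q x))) \<in> borel_measurable coin"
          using cantor_cont_coin(1)[OF cp] cantor_cont_coin(1)[OF cfq] by measurable
        fix x
        have "norm (Re (p x * cnj (?f x * q x))) \<le> cmod (p x * cnj (?f x * q x))"
          unfolding real_norm_def by (rule abs_Re_le_cmod)
        also have "\<dots> = cmod (p x) * cmod (q x)" by (simp add: norm_mult circular_norm[OF f])
        also have "\<dots> \<le> B * C"
          using B[of x] C[of x] order_trans[OF norm_ge_zero B[of x]] by (intro mult_mono) auto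
        finally show "norm (Re (p x * cnj (?f x * q x))) \<le> B * C" .
      qed
    qed
    note i1 = cantor_cont_coin(2)[OF cp] and i2 = cantor_cont_coin(2)[OF cfq]
    have "(\<integral>x. (cmod (p x + ?f x * q x))\<^sup>2 \<partial>coin) =
      (\<integral>x. (cmod (p x))\<^sup>2 \<partial>coin) + (\<integral>x. (cmod (?f x * q x))\<^sup>2 \<partial>coin) + 2 * (\<integral>x. Re (p x * cnj (?f x * q x)) \<partial>coin)"
      unfolding e using i1 i2 ir
      by (simp only: Bochner_Integration.integral_add Bochner_Integration.integrable_add integrable_mult_right integral_mult_right_zero)
    also have "(\<integral>x. (cmod (?f x * q x))\<^sup>2 \<partial>coin) = (\<integral>x. (cmod (q x))\<^sup>2 \<partial>coin)" by (rule coin_norm_circular[OF f])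
    also have "(\<integral>x. Re (p x * cnj (?f x * q x)) \<partial>coin) =
      (\<Sum>i<n. \<Sum>j<n. a i * b j * (\<integral>x. Re (wbase i x * cnj (?f x * wbase j x)) \<partial>coin))"
      unfolding p_def q_def
      by (rule coin_inner_sum[OF cantor_cont_coin(1)[OF circular_cont[OF f]], of 1]) (simp add: circular_norm[OF f])
    also have "\<dots> = (\<Sum>i<n. \<Sum>j<n. a i * b j * (if i = j then \<rho> else 0))"
      by (intro sum.cong refl) (simp only: lessThan_iff coin_flicker[OF _ _ m])
    also have "\<dots> = (\<Sum>j<n. a j * b j * \<rho>)" by (simp add: if_distrib cong: if_cong)
    finally show ?thesis
      unfolding p_def q_def coin_norm_sum by (simp add: sum.distrib sum_distrib_left mult_ac)
  qed
  also have "cos c * exp (- (\<Sum>j<n. (a j)\<^sup>2 + (b j)\<^sup>2 + 2 * \<rho> * a j * b j) / 2) =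
      (\<integral>z. cos (lin a n (fst z) + lin b n (mix \<rho> \<sigma> 0 z) + c) \<partial>gauss2)"
    by (rule gauss2_mix_cos[OF \<rho>\<sigma>, symmetric])
  finally show ?thesis by (simp only: k_def l_def)
qed

lemma integrable_trig_poly_pair:
  assumes R: "finite_measure R" and P: "trig_poly P" and Q: "trig_poly Q"
    and X: "X \<in> borel_measurable R" and Y: "Y \<in> borel_measurable R"
  shows "integrable R (\<lambda>w. P (X w) * Q (Y w))"
proof -
  obtain B where B: "\<And>w. \<bar>P w\<bar> \<le> B" using trig_poly_bounded[OF P] by blast
  obtain C where C: "\<And>w. \<bar>Q w\<bar> \<le> C" using trig_poly_bounded[OF Q] by blast
  have m: "(\<lambda>w. P (X w)) \<in> borel_measurable R" "(\<lambda>w. Q (Y w)) \<in> borel_measurable R"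
    by (rule measurable_compose[OF X trig_poly_measurable[OF P]], rule measurable_compose[OF Y trig_poly_measurable[OF Q]])
  have "norm (P (X w) * Q (Y w)) \<le> B * C" for w
    unfolding real_norm_def abs_mult using order_trans[OF abs_ge_zero B] by (intro mult_mono B C) auto
  then show ?thesis
    by (intro finite_measure.integrable_const_bound[OF R, of _ "B * C"] AE_I2 borel_measurable_times m)
qed

text \<open>Equality from some \<open>m\<close> on, and not just convergence, lets finite
  combinations pass without error terms.\<close>

lemma twist_flicker_trig_poly:
  assumes \<rho>\<sigma>: "\<rho>\<^sup>2 + \<sigma>\<^sup>2 = 1" and P: "trig_poly P" and Q: "trig_poly Q"
  shows "\<forall>\<^sub>F m in sequentially.
    (\<integral>w. P w * Q (twist (flicker \<rho> \<sigma> m) w) \<partial>gauss) = (\<integral>z. P (fst z) * Q (mix \<rho> \<sigma> 0 z) \<partial>gauss2)"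
proof -
  let ?T = "\<lambda>m. twist (flicker \<rho> \<sigma> m)" and ?Z = "mix \<rho> \<sigma> 0"
  have X: "(\<lambda>w. w) \<in> borel_measurable gauss" "?T m \<in> borel_measurable gauss" for m
    using twist_measurable[OF circular_flicker[OF \<rho>\<sigma>]] unfolding measurable_cong_sets[OF sets_gauss refl] by auto
  have Z: "fst \<in> borel_measurable gauss2" "?Z \<in> borel_measurable gauss2" by measurable
  note iX = integrable_trig_poly_pair[OF gauss.finite_measure_axioms _ _ X]
  note iZ = integrable_trig_poly_pair[OF gauss_pair.P.finite_measure_axioms _ _ Z]
  show ?thesis using P
  proof (induction P rule: trig_poly.induct)
    case (cos a n b)
    note c = trig_poly.cos[where a=a and n=n and b=b]
    from Q show ?case
    proof (induction Q rule: trig_poly.induct)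
      case (cos a' n' b')
      let ?N = "max n n'"
      let ?p = "\<lambda>j. if j < n then a j else 0" and ?q = "\<lambda>j. if j < n' then a' j else 0"
      have e: "cos (lin a n x + b) * cos (lin a' n' y + b') =
        (1/2) * cos (lin ?p ?N x + (\<Sum>j<?N. - ?q j * y j) + (b - b')) +
        (1/2) * cos (lin ?p ?N x + lin ?q ?N y + (b + b'))" for x y :: "nat \<Rightarrow> real"
      proof -
        have "lin a n x = lin ?p ?N x" "lin a' n' y = lin ?q ?N y"
          by (rule sum_lessThan_pad, simp)+
        then show ?thesis
          by (simp only: cos_times_cos mult_minus_left sum_negf) (simp add: algebra_simps)
      qed
      have int: "integrable M (\<lambda>w. cos (lin c ?N (U w) + lin d ?N (V w) + s))"
        if M: "finite_measure M" and U: "U \<in> borel_measurable M" and V: "V \<in> borel_measurable M"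
        for M :: "'c measure" and U V :: "'c \<Rightarrow> nat \<Rightarrow> real" and c d s
      proof (rule finite_measure.integrable_const_bound[OF M, of _ 1])
        have [measurable]: "(\<lambda>w. U w j) \<in> borel_measurable M" "(\<lambda>w. V w j) \<in> borel_measurable M" for j
          by (rule measurable_compose[OF U measurable_component_borel], rule measurable_compose[OF V measurable_component_borel])
        show "(\<lambda>w. cos (lin c ?N (U w) + lin d ?N (V w) + s)) \<in> borel_measurable M" by measurable
      qed simp
      note intX = int[OF gauss.finite_measure_axioms X] and intZ = int[OF gauss_pair.P.finite_measure_axioms Z]
      show ?case
        using eventually_ge_at_top[of ?N] unfolding e
        by (rule eventually_mono) (simp only: Bochner_Integration.integral_add integrable_mult_right intX intZ
            integral_mult_right_zero twist_flicker_cos[OF \<rho>\<sigma>])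
    next
      case (scale Q c)
      show ?case
        using scale.IH by (rule eventually_mono) (simp only: mult.left_commute[of _ c] integral_mult_right_zero)
    next
      case (add Q1 Q2)
      show ?case
        using add.IH unfolding distrib_left
        by eventually_elim (simp only: Bochner_Integration.integral_add iX[OF c add.hyps(1)] iX[OF c add.hyps(2)]
            iZ[OF c add.hyps(1)] iZ[OF c add.hyps(2)])
    qed
  next
    case (scale P c)
    show ?case
      using scale.IH by (rule eventually_mono) (simp only: mult.assoc integral_mult_right_zero)
  next
    case (add P1 P2)
    show ?case
      using add.IH unfolding distrib_right
      by eventually_elim (simp only: Bochner_Integration.integral_add iX[OF add.hyps(1) Q] iX[OF add.hyps(2) Q]
          iZ[OF add.hyps(1) Q] iZ[OF add.hyps(2) Q])
  qed
qed

text \<open>The error is measured in the two marginals, which are the same for all couplings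
  considered. Hence one choice of \<open>P\<close> and \<open>Q\<close> serves for every
  \<open>m\<close> and for the limit law, and the convergence extends from trigonometric polynomials
  to measurable rectangles.\<close>

lemma indicator_trig_poly_pair_approx:
  assumes R: "finite_measure R" and X: "X \<in> borel_measurable R" "distr R borel X = gauss"
    and Y: "Y \<in> borel_measurable R" "distr R borel Y = gauss"
    and A: "A \<in> sets borel" and B: "B \<in> sets borel" and P: "trig_poly P" and Q: "trig_poly Q"
    and D: "\<And>w. \<bar>P w\<bar> \<le> D"
    and PA: "L1_dist gauss (indicator A) P \<le> \<epsilon>" and QB: "L1_dist gauss (indicator B) Q \<le> \<eta>"
  shows "\<bar>measure R {w\<in>space R. X w \<in> A \<and> Y w \<in> B} - (\<integral>w. P (X w) * Q (Y w) \<partial>R)\<bar> \<le> \<epsilon> + D * \<eta>"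
proof -
  interpret finite_measure R by (rule R)
  have D0: "0 \<le> D" by (rule order_trans[OF abs_ge_zero D])
  have mP: "P \<in> borel_measurable borel" and mQ: "Q \<in> borel_measurable borel"
    by (rule trig_poly_measurable[OF P], rule trig_poly_measurable[OF Q])
  let ?A = "\<lambda>w. indicator A w :: real" and ?B = "\<lambda>w. indicator B w :: real"
  have mA: "?A \<in> borel_measurable borel" and mB: "?B \<in> borel_measurable borel" using A B by auto
  have S: "{w\<in>space R. X w \<in> A \<and> Y w \<in> B} \<in> sets R"
  proof -
    have "{w\<in>space R. X w \<in> A \<and> Y w \<in> B} = (X -` A \<inter> space R) \<inter> (Y -` B \<inter> space R)" by blast
    then show ?thesis using measurable_sets[OF X(1) A] measurable_sets[OF Y(1) B] by simp
  qed
  have mes: "measure R {w\<in>space R. X w \<in> A \<and> Y w \<in> B} = (\<integral>w. ?A (X w) * ?B (Y w) \<partial>R)"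
  proof -
    have "measure R {w\<in>space R. X w \<in> A \<and> Y w \<in> B} = (\<integral>w. indicator {w\<in>space R. X w \<in> A \<and> Y w \<in> B} w \<partial>R)"
      using S sets.sets_into_space[OF S] by (simp add: Int_absorb2)
    also have "\<dots> = (\<integral>w. ?A (X w) * ?B (Y w) \<partial>R)"
      by (rule Bochner_Integration.integral_cong) (auto simp: indicator_def)
    finally show ?thesis .
  qed
  have mX: "(\<lambda>w. F (X w)) \<in> borel_measurable R" "(\<lambda>w. F (Y w)) \<in> borel_measurable R"
    if "F \<in> borel_measurable borel" for F :: "(nat \<Rightarrow> real) \<Rightarrow> real"
    by (rule measurable_compose[OF X(1) that], rule measurable_compose[OF Y(1) that])
  have iAB: "integrable R (\<lambda>w. ?A (X w) * ?B (Y w))"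
    by (rule integrable_const_bound[OF _ borel_measurable_times[OF mX(1)[OF mA] mX(2)[OF mB]], of 1])
      (rule AE_I2, simp add: indicator_def)
  have iPQ: "integrable R (\<lambda>w. P (X w) * Q (Y w))" by (rule integrable_trig_poly_pair[OF R P Q X(1) Y(1)])
  have apx: "trig_approx gauss ?A" "trig_approx gauss ?B"
    by (rule trig_poly_dense[OF gauss.finite_measure_axioms sets_gauss A],
        rule trig_poly_dense[OF gauss.finite_measure_axioms sets_gauss B])
  have mD: "(\<lambda>w. \<bar>?A w - P w\<bar>) \<in> borel_measurable borel" "(\<lambda>w. \<bar>?B w - Q w\<bar>) \<in> borel_measurable borel"
    using mA mB mP mQ by measurable
  have iD: "integrable gauss (\<lambda>w. \<bar>?A w - P w\<bar>)" "integrable gauss (\<lambda>w. \<bar>?B w - Q w\<bar>)"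
    by (intro integrable_abs integrable_diff_trig_poly[OF gauss.finite_measure_axioms sets_gauss] apx P Q)+
  have i1: "integrable R (\<lambda>w. \<bar>?A (X w) - P (X w)\<bar>)"
    using integrable_distr_eq[OF X(1) mD(1)] iD(1) unfolding X(2) by simp
  have i2: "integrable R (\<lambda>w. \<bar>?B (Y w) - Q (Y w)\<bar>)"
    using integrable_distr_eq[OF Y(1) mD(2)] iD(2) unfolding Y(2) by simp
  have e1: "(\<integral>w. \<bar>?A (X w) - P (X w)\<bar> \<partial>R) \<le> \<epsilon>"
    using integral_distr[OF X(1) mD(1)] PA unfolding X(2) by simp
  have e2: "(\<integral>w. \<bar>?B (Y w) - Q (Y w)\<bar> \<partial>R) \<le> \<eta>"
    using integral_distr[OF Y(1) mD(2)] QB unfolding Y(2) by simp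
  have "measure R {w\<in>space R. X w \<in> A \<and> Y w \<in> B} - (\<integral>w. P (X w) * Q (Y w) \<partial>R) =
    (\<integral>w. ?A (X w) * ?B (Y w) - P (X w) * Q (Y w) \<partial>R)"
    unfolding mes by (rule Bochner_Integration.integral_diff[symmetric, OF iAB iPQ])
  also have "\<bar>\<dots>\<bar> \<le> (\<integral>w. \<bar>?A (X w) * ?B (Y w) - P (X w) * Q (Y w)\<bar> \<partial>R)" by (rule integral_abs_bound)
  also have "\<dots> \<le> (\<integral>w. \<bar>?A (X w) - P (X w)\<bar> + D * \<bar>?B (Y w) - Q (Y w)\<bar> \<partial>R)"
  proof (rule integral_mono)
    show "integrable R (\<lambda>w. \<bar>?A (X w) * ?B (Y w) - P (X w) * Q (Y w)\<bar>)"
      by (rule integrable_abs[OF Bochner_Integration.integrable_diff[OF iAB iPQ]])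
    show "integrable R (\<lambda>w. \<bar>?A (X w) - P (X w)\<bar> + D * \<bar>?B (Y w) - Q (Y w)\<bar>)"
      by (rule Bochner_Integration.integrable_add[OF i1 integrable_mult_right[OF i2]])
    fix w
    have "?A (X w) * ?B (Y w) - P (X w) * Q (Y w) = (?A (X w) - P (X w)) * ?B (Y w) + P (X w) * (?B (Y w) - Q (Y w))"
      by (simp only: left_diff_distrib right_diff_distrib)
    also have "\<bar>\<dots>\<bar> \<le> \<bar>?A (X w) - P (X w)\<bar> * \<bar>?B (Y w)\<bar> + \<bar>P (X w)\<bar> * \<bar>?B (Y w) - Q (Y w)\<bar>"
      by (rule order_trans[OF abs_triangle_ineq]) (simp only: abs_mult order_refl)
    also have "\<dots> \<le> \<bar>?A (X w) - P (X w)\<bar> * 1 + D * \<bar>?B (Y w) - Q (Y w)\<bar>"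
      by (intro add_mono mult_left_mono mult_right_mono D) (auto simp: indicator_def)
    finally show "\<bar>?A (X w) * ?B (Y w) - P (X w) * Q (Y w)\<bar> \<le> \<bar>?A (X w) - P (X w)\<bar> + D * \<bar>?B (Y w) - Q (Y w)\<bar>"
      by simp
  qed
  also have "\<dots> = (\<integral>w. \<bar>?A (X w) - P (X w)\<bar> \<partial>R) + D * (\<integral>w. \<bar>?B (Y w) - Q (Y w)\<bar> \<partial>R)"
    using i1 i2 by (simp only: Bochner_Integration.integral_add integrable_mult_right integral_mult_right_zero)
  also have "\<dots> \<le> \<epsilon> + D * \<eta>" by (intro add_mono e1 mult_left_mono e2 D0)
  finally show ?thesis .
qed

proposition twist_flicker_whirly:
  assumes \<rho>\<sigma>: "\<rho>\<^sup>2 + \<sigma>\<^sup>2 = 1" "\<sigma> \<noteq> 0" and A: "A \<in> sets borel" and B: "B \<in> sets borel"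
    and pos: "measure gauss A > 0" "measure gauss B > 0"
  shows "\<exists>m. measure gauss (A \<inter> twist (flicker \<rho> \<sigma> m) -` B) > 0"
proof -
  define \<theta> where "\<theta> = measure gauss2 {z. fst z \<in> A \<and> mix \<rho> \<sigma> 0 z \<in> B}"
  have th: "\<theta> > 0" unfolding \<theta>_def by (rule gauss_coupling_pos[OF \<rho>\<sigma> A B pos])
  \<comment> \<open>Passing to polynomials costs at most \<open>2 * \<epsilon>\<close>, and it is
    done twice, once for each law; the total \<open>\<theta> / 2\<close> leaves a positive
    remainder.\<close>
  define \<epsilon> where "\<epsilon> = \<theta> / 8"
  have e: "\<epsilon> > 0" using th by (simp add: \<epsilon>_def)
  note fg = gauss.finite_measure_axioms
  obtain P where P: "trig_poly P" "L1_dist gauss (indicator A) P < \<epsilon>"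
    using trig_approxD[OF trig_poly_dense[OF fg sets_gauss A] e] by blast
  obtain D where D: "\<And>w. \<bar>P w\<bar> \<le> D" using trig_poly_bounded[OF P(1)] by blast
  have D0: "0 \<le> D" by (rule order_trans[OF abs_ge_zero D])
  \<comment> \<open>The error of \<open>Q\<close> is multiplied by the bound \<open>D\<close> of
    \<open>P\<close>, so its tolerance is divided accordingly.\<close>
  have "\<epsilon> / (D + 1) > 0" using e D0 by simp
  then obtain Q where Q: "trig_poly Q" "L1_dist gauss (indicator B) Q < \<epsilon> / (D + 1)"
    using trig_approxD[OF trig_poly_dense[OF fg sets_gauss B]] by blast
  have De: "D * (\<epsilon> / (D + 1)) \<le> \<epsilon>"
  proof -
    have "D * (\<epsilon> / (D + 1)) \<le> (D + 1) * (\<epsilon> / (D + 1))" using e D0 by (intro mult_right_mono) auto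
    also have "\<dots> = \<epsilon>" using D0 by simp
    finally show ?thesis .
  qed
  obtain m where m: "(\<integral>w. P w * Q (twist (flicker \<rho> \<sigma> m) w) \<partial>gauss) = (\<integral>z. P (fst z) * Q (mix \<rho> \<sigma> 0 z) \<partial>gauss2)"
    using eventually_happens'[OF sequentially_bot twist_flicker_trig_poly[OF \<rho>\<sigma>(1) P(1) Q(1)]] by blast
  let ?T = "twist (flicker \<rho> \<sigma> m)"
  have mp: "measure_preserving gauss ?T" by (rule twist_measure_preserving[OF circular_flicker[OF \<rho>\<sigma>(1)]])
  have bg: "distr M borel X = distr M gauss X" for M :: "'c measure" and X
    by (rule distr_cong) (simp_all add: sets_gauss)
  have X: "(\<lambda>w. w) \<in> borel_measurable gauss" "distr gauss borel (\<lambda>w. w) = gauss"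
    unfolding bg by (simp_all add: measurable_cong_sets[OF sets_gauss refl] distr_id2)
  have Y: "?T \<in> borel_measurable gauss" "distr gauss borel ?T = gauss"
    using mp unfolding bg measure_preserving_def measurable_cong_sets[OF refl sets_gauss] by auto
  have Z1: "fst \<in> borel_measurable gauss2" "distr gauss2 borel fst = gauss"
    unfolding bg by (measurable, rule gauss.distr_pair_fst) 
  have Z2: "mix \<rho> \<sigma> 0 \<in> borel_measurable gauss2" "distr gauss2 borel (mix \<rho> \<sigma> 0) = gauss"
    by (rule measurable_mix, rule distr_mix[OF \<rho>\<sigma>(1)])
  have 1: "\<bar>measure gauss {w\<in>space gauss. w \<in> A \<and> ?T w \<in> B} - (\<integral>w. P w * Q (?T w) \<partial>gauss)\<bar> \<le> \<epsilon> + D * (\<epsilon> / (D + 1))"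
    by (rule indicator_trig_poly_pair_approx[OF fg X Y A B P(1) Q(1) D less_imp_le[OF P(2)] less_imp_le[OF Q(2)]])
  have 2: "\<bar>measure gauss2 {z\<in>space gauss2. fst z \<in> A \<and> mix \<rho> \<sigma> 0 z \<in> B} - (\<integral>z. P (fst z) * Q (mix \<rho> \<sigma> 0 z) \<partial>gauss2)\<bar> \<le> \<epsilon> + D * (\<epsilon> / (D + 1))"
    by (rule indicator_trig_poly_pair_approx[OF gauss_pair.P.finite_measure_axioms Z1 Z2 A B P(1) Q(1) D less_imp_le[OF P(2)] less_imp_le[OF Q(2)]])
  have s: "{w\<in>space gauss. w \<in> A \<and> ?T w \<in> B} = A \<inter> ?T -` B"
    "{z\<in>space gauss2. fst z \<in> A \<and> mix \<rho> \<sigma> 0 z \<in> B} = {z. fst z \<in> A \<and> mix \<rho> \<sigma> 0 z \<in> B}"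
    by (auto simp: space_pair_measure)
  have "measure gauss (A \<inter> ?T -` B) > 0"
    using 1 2 De m th unfolding s \<theta>_def[symmetric] \<epsilon>_def by linarith
  then show ?thesis by blast
qed

section \<open>Restriction to the Cantor set and the action of the group\<close>

lemma circular_comp:
  fixes M :: "'a metric"
  assumes cpt: "compact_space (mtopology_of M)"
    and \<kappa>: "\<And>x. \<kappa> x \<in> mspace M"
    and uc: "\<And>n x y. (\<forall>j<Suc n. x j = y j) \<Longrightarrow> mdist M (\<kappa> x) (\<kappa> y) < 1 / real (Suc n)"
    and f: "f \<in> carrier (circle_maps (mtopology_of M))"
  shows "circular (\<lambda>x. f (\<kappa> x))"
  unfolding circular_def cantor_cont_def
proof (intro conjI allI impI)
  show "cmod (f (\<kappa> x)) = 1" for x using circle_mapsD(2)[OF f, of "\<kappa> x"] \<kappa> by simp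
  fix \<epsilon> :: real assume "\<epsilon> > 0"
  then obtain \<delta> where \<delta>: "\<delta> > 0" "\<forall>x\<in>mspace M. \<forall>y\<in>mspace M. mdist M x y < \<delta> \<longrightarrow> cmod (f x - f y) < \<epsilon>"
    using circle_maps_uniformly_continuous[OF cpt f] by blast
  obtain n where n: "1 / real (Suc n) < \<delta>" using nat_approx_posE[OF \<delta>(1)] by auto
  show "\<exists>m. \<forall>x y. (\<forall>j<m. x j = y j) \<longrightarrow> cmod (f (\<kappa> x) - f (\<kappa> y)) \<le> \<epsilon>"
  proof (intro exI[of _ "Suc n"] allI impI)
    fix x y :: "nat \<Rightarrow> bool" assume "\<forall>j<Suc n. x j = y j"
    from uc[OF this] have "mdist M (\<kappa> x) (\<kappa> y) < \<delta>" using n by linarith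
    then show "cmod (f (\<kappa> x) - f (\<kappa> y)) \<le> \<epsilon>" using \<delta>(2) \<kappa> by (simp add: less_imp_le)
  qed
qed

lemma compose_exp_circle_maps:
  assumes h: "continuous_map X euclideanreal h"
  shows "(\<lambda>x\<in>topspace X. cis (\<epsilon> * h x)) \<in> carrier (circle_maps X)"
proof (rule continuous_map_norm_one_restrict)
  have "continuous_map euclideanreal euclidean (\<lambda>t. cis (\<epsilon> * t))"
    by (simp add: cis_conv_exp) (intro continuous_intros)
  from continuous_map_compose[OF h this] show "continuous_map X euclidean (\<lambda>x. cis (\<epsilon> * h x))"
    by (simp add: o_def)
qed simp

text \<open>A chord of the unit circle is at most as long as its arc; its length is the modulus of
  \<open>2 * sin (t / 2)\<close>.\<close>

lemma cmod_cis_diff_le: "cmod (cis t - 1) \<le> \<bar>t\<bar>"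
proof -
  have "(cmod (cis t - 1))\<^sup>2 = (2 * sin (t / 2))\<^sup>2"
  proof -
    have "(cmod (cis t - 1))\<^sup>2 = (cos t)\<^sup>2 + (sin t)\<^sup>2 + 1 - 2 * cos t"
      unfolding cmod_power2 by (simp add: power2_diff)
    also have "\<dots> = 2 - 2 * cos (2 * (t / 2))" by (simp add: sin_cos_squared_add3 add.commute)
    also have "\<dots> = (2 * sin (t / 2))\<^sup>2" unfolding cos_double_sin by (simp add: power_mult_distrib)
    finally show ?thesis .
  qed
  then have "cmod (cis t - 1) = \<bar>2 * sin (t / 2)\<bar>" by (metis norm_ge_zero real_sqrt_abs real_sqrt_unique)
  also have "\<dots> \<le> \<bar>t\<bar>" using abs_sin_x_le_abs_x[of "t / 2"] by (simp add: abs_mult)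
  finally show ?thesis .
qed

theorem theorem1p1:
  fixes M :: "'a metric"
  assumes "compact_space (mtopology_of M)" and "uncountable (mspace M)"
  shows "\<exists>(N :: (nat \<Rightarrow> real) measure) \<phi>.
           atomless N \<and>
           boolean_action (circle_maps (mtopology_of M)) (uniform_topology (mtopology_of M)) N \<phi> \<and>
           whirly (circle_maps (mtopology_of M)) (uniform_topology (mtopology_of M)) N \<phi>"
proof -
  note cpt = assms(1)
  let ?X = "mtopology_of M"
  let ?G = "circle_maps ?X" and ?T = "uniform_topology ?X" and ?C = "cfunspace ?X circle_metric"
  interpret M: Metric_space "mspace M" "mdist M" by (rule Metric_space_mspace_mdist)
  interpret C: Metric_space "mspace ?C" "mdist ?C" by (rule Metric_space_mspace_mdist)
  have X: "?X = M.mtopology" by (simp only: mtopology_of_def)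
  have topX: "topspace ?X = mspace M" by simp
  have T: "?T = C.mtopology" unfolding uniform_topology_def by (simp only: mtopology_of_def)
  obtain \<kappa> :: "(nat \<Rightarrow> bool) \<Rightarrow> 'a" and h :: "nat \<Rightarrow> 'a \<Rightarrow> real"
    where \<kappa>: "\<And>x. \<kappa> x \<in> mspace M"
      and uc: "\<And>n x y. (\<forall>j<Suc n. x j = y j) \<Longrightarrow> mdist M (\<kappa> x) (\<kappa> y) < 1 / real (Suc n)"
      and h: "\<And>m. continuous_map M.mtopology (top_of_set {-1..1}) (h m)"
      and h\<kappa>: "\<And>m x. h m (\<kappa> x) = (if x m then 1 else -1)"
    using M.cantor_embedding[OF cpt[unfolded X] assms(2)] by blast
  \<comment> \<open>The group acts through restriction to the Cantor set; the values of
    \<open>f\<close> elsewhere do not enter.\<close>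
  define R where "R f = twist (\<lambda>x. f (\<kappa> x))" for f :: "'a \<Rightarrow> complex"
  define \<phi> where "\<phi> f = malg_map gauss (R f)" for f
  have circ: "circular (\<lambda>x. f (\<kappa> x))" if "f \<in> carrier ?G" for f
    by (rule circular_comp[OF cpt \<kappa> uc that])
  have mp: "measure_preserving gauss (R f)" if "f \<in> carrier ?G" for f
    unfolding R_def by (rule twist_measure_preserving[OF circ[OF that]])
  have hom: "\<phi> \<in> hom ?G (malg_Aut gauss)"
    unfolding \<phi>_def[abs_def]
  proof (rule malg_map_hom[OF group_circle_maps mp])
    fix f g assume f: "f \<in> carrier ?G" and g: "g \<in> carrier ?G"
    have "(f \<otimes>\<^bsub>?G\<^esub> g) (\<kappa> x) = f (\<kappa> x) * g (\<kappa> x)" for x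
      using \<kappa>[of x] by (simp add: circle_maps_mult)
    then show "AE w in gauss. R g (R f w) = R (f \<otimes>\<^bsub>?G\<^esub> g) w"
      \<comment> \<open>The reversal of factors in \<open>twist_comp\<close> is the one that
        \<open>malg_map_hom\<close> asks for.\<close>
      unfolding R_def using twist_comp[OF circ[OF g] circ[OF f]] by (simp only:)
  next
    have "\<one>\<^bsub>?G\<^esub> (\<kappa> x) = 1" for x using \<kappa>[of x] by (simp add: circle_maps_one)
    then show "AE w in gauss. R \<one>\<^bsub>?G\<^esub> w = w" unfolding R_def using twist_one by (simp only:)
  qed
  interpret A: Metric_space "malg gauss" "malg_dist gauss"
    by (rule Metric_space_malg[OF gauss.finite_measure_axioms])
  have metA: "mtopology_of (malg_metric gauss) = A.mtopology"
    unfolding malg_metric_def by simp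
  have clos: "\<phi> f a \<in> malg gauss" if "f \<in> carrier ?G" "a \<in> malg gauss" for f a
    unfolding \<phi>_def by (rule malg_map_closed[OF mp[OF that(1)] that(2)])
  have cont1: "continuous_map ?T A.mtopology (\<lambda>f. \<phi> f a)" if a: "a \<in> malg gauss" for a
  proof -
    obtain B where B: "B \<in> sets gauss" "a = malg_class gauss B" using malgE[OF a] by blast
    have Bb: "B \<in> sets borel" using B(1) by (simp only: sets_gauss)
    show ?thesis
      unfolding T C.metric_continuous_map[OF A.Metric_space_axioms]
    proof (intro conjI ballI allI impI)
      show "(\<lambda>f. \<phi> f a) ` mspace ?C \<subseteq> malg gauss"
        unfolding carrier_circle_maps_mspace[symmetric] using clos[OF _ a] by blast
      fix f and \<epsilon> :: real assume f: "f \<in> mspace ?C" and e: "\<epsilon> > 0"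
      have fG: "f \<in> carrier ?G" using f by (simp only: carrier_circle_maps_mspace)
      obtain \<delta> where \<delta>: "\<delta> > 0" "\<forall>f g. circular f \<longrightarrow> circular g \<longrightarrow> (\<forall>x. cmod (f x - g x) \<le> \<delta>) \<longrightarrow>
          measure gauss (sym_diff (twist f -` B) (twist g -` B)) < \<epsilon>"
        using twist_continuous[OF Bb e] by blast
      show "\<exists>\<delta>>0. \<forall>g. g \<in> mspace ?C \<and> mdist ?C f g < \<delta> \<longrightarrow> malg_dist gauss (\<phi> f a) (\<phi> g a) < \<epsilon>"
      proof (intro exI[of _ \<delta>] conjI allI impI \<delta>(1))
        fix g assume g: "g \<in> mspace ?C \<and> mdist ?C f g < \<delta>"
        have gG: "g \<in> carrier ?G" using g by (simp only: carrier_circle_maps_mspace)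
        have "\<forall>x\<in>topspace ?X. cmod (f x - g x) \<le> \<delta>"
          using mdist_circle_maps_le[OF fG gG, of \<delta>] g \<delta>(1) by simp
        then have le: "\<forall>x. cmod (f (\<kappa> x) - g (\<kappa> x)) \<le> \<delta>" using \<kappa> unfolding topX by blast
        have "malg_dist gauss (\<phi> f a) (\<phi> g a) = measure gauss (sym_diff (R f -` B \<inter> space gauss) (R g -` B \<inter> space gauss))"
          unfolding \<phi>_def B(2) malg_map_class[OF mp[OF fG] B(1)] malg_map_class[OF mp[OF gG] B(1)]
          by (rule malg_dist_class[OF measure_preservingD(2)[OF mp[OF fG] B(1)] measure_preservingD(2)[OF mp[OF gG] B(1)]])
        also have "\<dots> = measure gauss (sym_diff (R f -` B) (R g -` B))" by (simp only: space_gauss Int_UNIV_right)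
        also have "\<dots> < \<epsilon>" unfolding R_def using \<delta>(2) circ[OF fG] circ[OF gG] le by blast
        finally show "malg_dist gauss (\<phi> f a) (\<phi> g a) < \<epsilon>" .
      qed
    qed
  qed
  have auts: "\<phi> f \<in> malg_auts gauss" if "f \<in> carrier ?G" for f
    using hom that by (auto simp: hom_def malg_Aut_def)
  have cont: "continuous_map ?T (malg_Aut_topology gauss) \<phi>"
    unfolding malg_Aut_topology_def continuous_map_in_subtopology continuous_map_componentwise metA
  proof (intro conjI ballI cont1)
    show "\<phi> ` topspace ?T \<subseteq> extensional (malg gauss)"
      unfolding \<phi>_def malg_map_def by auto
    show "\<phi> \<in> topspace ?T \<rightarrow> malg_auts gauss"
      unfolding topspace_uniform_topology using auts by blast
  qed
  have act: "boolean_action ?G ?T gauss \<phi>"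
    unfolding boolean_action_def
    using polish_group_circle_maps[OF cpt] standard_borel_gauss prob_space_gauss hom cont by blast
  have whirl: "whirly ?G ?T gauss \<phi>"
    unfolding whirly_def
  proof (intro allI impI, elim conjE exE)
    fix V U a b
    assume U: "openin ?T U" "\<one>\<^bsub>?G\<^esub> \<in> U" "U \<subseteq> V" and a: "a \<in> malg gauss" and b: "b \<in> malg gauss"
      and pa: "0 < malg_measure gauss a" and pb: "0 < malg_measure gauss b"
    obtain A where A: "A \<in> sets gauss" "a = malg_class gauss A" using malgE[OF a] by blast
    obtain B where B: "B \<in> sets gauss" "b = malg_class gauss B" using malgE[OF b] by blast
    have mA: "0 < measure gauss A" and mB: "0 < measure gauss B"
      using pa pb by (simp_all only: A(2) B(2) malg_measure_class[OF A(1)] malg_measure_class[OF B(1)])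
    obtain r where r: "r > 0" "C.mball \<one>\<^bsub>?G\<^esub> r \<subseteq> U"
      using U(1,2) unfolding T C.openin_mtopology by blast
    \<comment> \<open>Below \<open>r\<close>, so that the map lies in the ball, and at most 1, so
      that \<open>sin \<epsilon>\<close> is positive.\<close>
    define \<epsilon> where "\<epsilon> = min 1 (r / 2)"
    have e: "0 < \<epsilon>" "\<epsilon> \<le> 1" "\<epsilon> < r" using r(1) by (simp_all add: \<epsilon>_def min_def)
    have sin: "sin \<epsilon> \<noteq> 0"
      using sin_gt_zero[of \<epsilon>] e pi_gt3 by simp
    have cs: "(cos \<epsilon>)\<^sup>2 + (sin \<epsilon>)\<^sup>2 = 1" by simp
    \<comment> \<open>The roles of \<open>A\<close> and \<open>B\<close> are exchanged:
      \<open>\<phi> f a\<close> is the class of a preimage of \<open>A\<close>, and it has to meet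
      \<open>B\<close> itself.\<close>
    obtain m where m: "measure gauss (B \<inter> twist (flicker (cos \<epsilon>) (sin \<epsilon>) m) -` A) > 0"
      using twist_flicker_whirly[OF cs sin _ _ mB mA] A(1) B(1) sets_gauss by blast
    \<comment> \<open>On the Cantor set \<open>h m\<close> is 1 or -1 and the value is
      \<open>cos \<epsilon>\<close> plus or minus \<open>\<i> * sin \<epsilon>\<close>; elsewhere
      the bound of \<open>h m\<close> by 1 keeps the value within \<open>\<epsilon>\<close> of
      1.\<close>
    define f where "f = (\<lambda>p\<in>topspace ?X. cis (\<epsilon> * h m p))"
    have hr: "continuous_map ?X euclideanreal (h m)" and hb: "h m p \<in> {-1..1}" if "p \<in> mspace M" for p
      using h[of m] that unfolding X continuous_map_in_subtopology by auto
    have "continuous_map ?X euclideanreal (h m)"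
      using h[of m] unfolding X continuous_map_in_subtopology by blast
    then have fG: "f \<in> carrier ?G" unfolding f_def by (rule compose_exp_circle_maps)
    have "f (\<kappa> x) = flicker (cos \<epsilon>) (sin \<epsilon>) m x" for x
      using \<kappa>[of x] by (simp add: f_def h\<kappa> flicker_def rad_def complex_eq_iff)
    then have Rf: "R f = twist (flicker (cos \<epsilon>) (sin \<epsilon>) m)" unfolding R_def by (simp only:)
    have "mdist ?C \<one>\<^bsub>?G\<^esub> f \<le> \<epsilon>"
    proof (subst mdist_circle_maps_le[OF circle_maps_one_closed fG])
      show "0 \<le> \<epsilon>" using e by simp
      show "\<forall>x\<in>topspace ?X. cmod (\<one>\<^bsub>?G\<^esub> x - f x) \<le> \<epsilon>"
      proof
        fix x assume x: "x \<in> topspace ?X"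
        have "cmod (\<one>\<^bsub>?G\<^esub> x - f x) = cmod (cis (\<epsilon> * h m x) - 1)"
          using x by (simp add: circle_maps_one f_def norm_minus_commute)
        also have "\<dots> \<le> \<bar>\<epsilon> * h m x\<bar>" by (rule cmod_cis_diff_le)
        also have "\<dots> \<le> \<epsilon> * 1"
          unfolding abs_mult using hb[of x] x e by (intro mult_mono) auto
        finally show "cmod (\<one>\<^bsub>?G\<^esub> x - f x) \<le> \<epsilon>" by simp
      qed
    qed
    then have "mdist ?C \<one>\<^bsub>?G\<^esub> f < r" using e by linarith
    moreover have "f \<in> mspace ?C" "\<one>\<^bsub>?G\<^esub> \<in> mspace ?C"
      using fG circle_maps_one_closed[of ?X] by (simp_all only: carrier_circle_maps_mspace)
    ultimately have "f \<in> C.mball \<one>\<^bsub>?G\<^esub> r" unfolding C.in_mball by blast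
    then have fV: "f \<in> V" using r(2) U(3) by blast
    have fA: "R f -` A \<inter> space gauss \<in> sets gauss" by (rule measure_preservingD(2)[OF mp[OF fG] A(1)])
    have "malg_measure gauss (malg_inf gauss (\<phi> f a) b) = measure gauss (R f -` A \<inter> space gauss \<inter> B)"
      unfolding \<phi>_def A(2) B(2) malg_map_class[OF mp[OF fG] A(1)] malg_inf_class[OF fA B(1)]
      by (rule malg_measure_class) (use fA B(1) in auto)
    also have "R f -` A \<inter> space gauss \<inter> B = B \<inter> twist (flicker (cos \<epsilon>) (sin \<epsilon>) m) -` A"
      unfolding Rf by auto
    finally have "0 < malg_measure gauss (malg_inf gauss (\<phi> f a) b)" using m by simp
    then show "\<exists>g\<in>V. 0 < malg_measure gauss (malg_inf gauss (\<phi> g a) b)" using fV by blast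
  qed
  show ?thesis using atomless_gauss act whirl by blast
qed

end
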